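(* Let $N\ge1$, $c\in\mathbb{R}$, let $\phi:[0,\infty)\to(0,\infty)$ be an admissible profile, and let $d\mu_w=y^c\phi(|z|)\,dz$ on $\mathbb{H}^{N+1}$. Assume the tail coercivity condition (TC) holds with Lyapunov function $\Psi$ and constant $C_{TC}>0$. Then for every $R$ sufficiently large that $m_R:=\inf_{|z|\ge R}\Psi(|z|)>0$, and for all $u\in H^1_{\mu_w}$, $$\int_{\{|z|>R\}}|u|^2\,d\mu_w\le\frac{C_{TC}}{m_R}\,\|u\|_{H^1_{\mu_w}}^2 .$$
   Context: For an integer $N\ge1$, $\mathbb{H}^{N+1}=\{z=(y,x)\in\mathbb{R}\times\mathbb{R}^N: y>0\}$, and $dz$ is Lebesgue measure. Let $c\in\mathbb{R}$. A Borel measurable function $\phi:[0,\infty)\to(0,\infty)$ is admissible if for every compact interval $K\subset[0,\infty)$ (possibly containing $0$) there are constants $0<m_K\le M_K<\infty$ with $m_K\le\phi(\rho)\le M_K$ for a.e. $\rho\in K$. The weight is $w(z)=y^c\phi(|z|)$ and $d\mu_w=w(z)\,dz$ on $\mathbb{H}^{N+1}$. $L^2_{\mu_w}$ is the space of $u\in L^1_{\mathrm{loc}}(\mathbb{H}^{N+1})$ with $\|u\|_{L^2_{\mu_w}}^2=\int_{\mathbb{H}^{N+1}}|u|^2\,d\mu_w<\infty$. $H^1_{\mu_w}$ is the space of $u\in L^2_{\mu_w}$ whose weak gradient $\nabla u$ lies in $L^2_{\mu_w}(\mathbb{H}^{N+1};\mathbb{R}^{N+1})$, with $\|u\|_{H^1_{\mu_w}}^2=\|u\|_{L^2_{\mu_w}}^2+\|\nabla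 u\|_{L^2_{\mu_w}}^2$. $C_c^\infty(\overline{\mathbb{H}^{N+1}})$ denotes smooth functions on the closed half-space $\{y\ge0\}$ with compact support in the closed half-space. Condition (TC) with Lyapunov function $\Psi$ and constant $C_{TC}$: $\Psi:[0,\infty)\to[0,\infty)$ satisfies $\Psi(\rho)\uparrow\infty$ as $\rho\to\infty$ (nondecreasing and tending to infinity), and $$\int_{\mathbb{H}^{N+1}}\Psi(|z|)\,u^2\,d\mu_w\le C_{TC}\int_{\mathbb{H}^{N+1}}\big(|\nabla u|^2+u^2\big)\,d\mu_w$$ for all $u\in C_c^\infty(\overline{\mathbb{H}^{N+1}})$, where if $c\le-1$ only those $u$ that vanish near $y=0$ are considered (no boundary condition is imposed if $c>-1$). *)

theory Defs
  imports "HOL-Analysis.Analysis"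
begin

text \<open>
  The ambient space of points z = (y, x) is the Euclidean space \<open>real \<times> (real ^ 'n)\<close> with
  \<open>N = CARD('n)\<close>. Functions on the half-space are total functions whose values off the
  half-space play no role: all measures and integrals below live on \<open>half_space\<close>.
\<close>

definition half_space :: "(real \<times> (real ^ 'n)) set" where
  "half_space = {z. 0 < fst z}"

definition closed_half_space :: "(real \<times> (real ^ 'n)) set" where
  "closed_half_space = {z. 0 \<le> fst z}"

definition admissible :: "(real \<Rightarrow> real) \<Rightarrow> bool" where
  "admissible \<phi> \<longleftrightarrow>
     \<phi> \<in> borel_measurable (restrict_space borel {0..}) \<and>
     (\<forall>\<rho>\<ge>0. 0 < \<phi> \<rho>) \<and>
     (\<forall>a b. 0 \<le> a \<longrightarrow> a \<le> b \<longrightarrow>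
        (\<exists>m M. 0 < m \<and> m \<le> M \<and> (AE \<rho> in lborel. \<rho> \<in> {a..b} \<longrightarrow> m \<le> \<phi> \<rho> \<and> \<phi> \<rho> \<le> M)))"

definition weighted_measure :: "real \<Rightarrow> (real \<Rightarrow> real) \<Rightarrow> (real \<times> (real ^ 'n)) measure" where
  "weighted_measure c \<phi> =
     density (lebesgue_on half_space) (\<lambda>z. ennreal (fst z powr c * \<phi> (norm z)))"

primrec Ck :: "nat \<Rightarrow> ('a::euclidean_space \<Rightarrow> real) \<Rightarrow> bool" where
  "Ck 0 f \<longleftrightarrow> continuous_on UNIV f"
| "Ck (Suc k) f \<longleftrightarrow>
     f differentiable_on UNIV \<and> (\<forall>i\<in>Basis. Ck k (\<lambda>x. frechet_derivative f (at x) i))"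

definition smooth :: "('a::euclidean_space \<Rightarrow> real) \<Rightarrow> bool" where
  "smooth f \<longleftrightarrow> (\<forall>k. Ck k f)"

definition grad :: "('a::euclidean_space \<Rightarrow> real) \<Rightarrow> 'a \<Rightarrow> 'a" where
  "grad f x = (\<Sum>i\<in>Basis. frechet_derivative f (at x) i *\<^sub>R i)"

text \<open>
  Smooth functions on \<open>S\<close> with compact support in \<open>S\<close>, represented by smooth functions on the
  whole space; only the restriction to \<open>S\<close> matters. For open \<open>S\<close> these restrictions are the usual
  test functions (extend by zero); for the closed half-space, smoothness up to the boundary is
  the existence of a smooth extension.
\<close>
definition Cc_infty :: "'a::euclidean_space set \<Rightarrow> ('a \<Rightarrow> real) set" where
  "Cc_infty S = {f. smooth f \<and> (\<exists>K. compact K \<and> K \<subseteq> S \<and> (\<forall>x\<in>S - K. f x = 0))}"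

definition L1_loc :: "'a::euclidean_space set \<Rightarrow> ('a \<Rightarrow> 'b::euclidean_space) set" where
  "L1_loc S = {u. \<forall>K. compact K \<longrightarrow> K \<subseteq> S \<longrightarrow> u absolutely_integrable_on K}"

definition has_weak_gradient ::
    "(real \<times> (real ^ 'n) \<Rightarrow> real) \<Rightarrow> (real \<times> (real ^ 'n) \<Rightarrow> real \<times> (real ^ 'n)) \<Rightarrow> bool" where
  "has_weak_gradient u g \<longleftrightarrow>
     u \<in> L1_loc half_space \<and> g \<in> L1_loc half_space \<and>
     (\<forall>\<eta>\<in>Cc_infty half_space. \<forall>i\<in>Basis.
        (LINT z:half_space|lebesgue. u z * frechet_derivative \<eta> (at z) i) =
        - (LINT z:half_space|lebesgue. (g z \<bullet> i) * \<eta> z))"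

text \<open>The weak gradient is unique up to null sets, so any representative may be selected.\<close>
definition weak_gradient ::
    "(real \<times> (real ^ 'n) \<Rightarrow> real) \<Rightarrow> real \<times> (real ^ 'n) \<Rightarrow> real \<times> (real ^ 'n)" where
  "weak_gradient u = (SOME g. has_weak_gradient u g)"

text \<open>Squared norms take values in \<open>ennreal\<close>; they are finite exactly on the spaces below.\<close>
definition L2_norm_sq ::
    "(real \<times> (real ^ 'n)) measure \<Rightarrow> (real \<times> (real ^ 'n) \<Rightarrow> 'b::euclidean_space) \<Rightarrow> ennreal" where
  "L2_norm_sq \<mu> u = (\<integral>\<^sup>+ z. ennreal ((norm (u z))\<^sup>2) \<partial>\<mu>)"

definition L2_space ::
    "(real \<times> (real ^ 'n)) measure \<Rightarrow> (real \<times> (real ^ 'n) \<Rightarrow> 'b::euclidean_space) set" where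
  "L2_space \<mu> = {u \<in> L1_loc half_space. L2_norm_sq \<mu> u < \<infinity>}"

definition H1_space :: "(real \<times> (real ^ 'n)) measure \<Rightarrow> (real \<times> (real ^ 'n) \<Rightarrow> real) set" where
  "H1_space \<mu> =
     {u \<in> L2_space \<mu>. (\<exists>g. has_weak_gradient u g) \<and> weak_gradient u \<in> L2_space \<mu>}"

definition H1_norm_sq ::
    "(real \<times> (real ^ 'n)) measure \<Rightarrow> (real \<times> (real ^ 'n) \<Rightarrow> real) \<Rightarrow> ennreal" where
  "H1_norm_sq \<mu> u = L2_norm_sq \<mu> u + L2_norm_sq \<mu> (weak_gradient u)"

definition vanishes_near_boundary :: "(real \<times> (real ^ 'n) \<Rightarrow> real) \<Rightarrow> bool" where
  "vanishes_near_boundary u \<longleftrightarrow> (\<exists>\<delta>>0. \<forall>z\<in>closed_half_space. fst z < \<delta> \<longrightarrow> u z = 0)"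

text \<open>Condition (TC) for \<open>\<mu> = weighted_measure c \<phi>\<close>, Lyapunov function \<open>\<Psi>\<close> and constant \<open>C\<close>.\<close>
definition tail_coercive ::
    "(real \<times> (real ^ 'n)) measure \<Rightarrow> real \<Rightarrow> (real \<Rightarrow> real) \<Rightarrow> real \<Rightarrow> bool" where
  "tail_coercive \<mu> c \<Psi> C \<longleftrightarrow>
     (\<forall>\<rho>\<ge>0. 0 \<le> \<Psi> \<rho>) \<and> mono_on {0..} \<Psi> \<and> filterlim \<Psi> at_top at_top \<and>
     (\<forall>u\<in>Cc_infty closed_half_space. (c \<le> -1 \<longrightarrow> vanishes_near_boundary u) \<longrightarrow>
        (\<integral>\<^sup>+ z. ennreal (\<Psi> (norm z) * (u z)\<^sup>2) \<partial>\<mu>)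
          \<le> ennreal C * (\<integral>\<^sup>+ z. ennreal ((norm (grad u z))\<^sup>2 + (u z)\<^sup>2) \<partial>\<mu>))"

end

theory Submission imports Defs begin

text \<open>
  Since \<open>m_R \<le> \<Psi>(|z|)\<close> for \<open>|z| \<ge> R\<close>, condition (TC) gives the estimate for every admissible test
  function, and the point is to approximate an arbitrary \<open>u \<in> H\<^sup>1\<close> by such functions near the
  boundary \<open>y = 0\<close>, for every real \<open>c\<close>. We use averages
  \<open>u\<^sub>\<epsilon>(z) = \<integral> \<rho>(t) u(z + \<epsilon> t) dt\<close>. If \<open>c > -1\<close>, the kernel \<open>\<rho>\<close> lives in \<open>1 \<le> t_y \<le> 2\<close>: only values of
  \<open>u\<close> at height at least \<open>\<epsilon>\<close> enter, so \<open>u\<^sub>\<epsilon>\<close> is smooth up to the boundary, and the operator is bounded on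
  \<open>L\<^sup>2(y^c dz)\<close> because \<open>y^c\<close> is integrable at 0 and the shift is spread over an interval of length
  comparable to \<open>\<epsilon>\<close>. If \<open>c \<le> -1\<close>, the kernel lives in \<open>-2 \<le> t_y \<le> -1\<close> and \<open>u\<close> is extended by zero: the
  averages vanish for \<open>y < \<epsilon>\<close>, the shift is a contraction since \<open>y^c\<close> decreases, and the extension
  has the extended weak gradient because finiteness of \<open>\<integral> y^c u\<^sup>2\<close> forces a zero trace. In both cases
  the averages converge in norm on bounded sets, where \<open>\<phi>\<close> is bounded above and below.
\<close>

section \<open>Flat functions and the calculus of smooth functions\<close>

text \<open>Two limits are taken, and their order matters. (TC) accepts only compactly supported
  functions and \<open>\<phi>\<close> is controlled only on bounded sets, so the averages are
  multiplied by a cut-off of radius \<open>k\<close>; the averaging scale tends to 0 with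
  \<open>k\<close> fixed, and only then does \<open>k\<close> tend to infinity. To end with exactly
  the constant \<open>C_TC\<close>, the bound \<open>\<beta>\<close> on the gradient of the cut-off
  doubles as the parameter of Young's inequality: the main terms carry factors that tend to 1 with
  \<open>\<beta>\<close>, whereas the approximation errors carry a factor of order
  \<open>1 / \<beta>\<close> but disappear in the inner limit. The obstacle is that y^c is a
  Muckenhoupt A_2 weight only for |c| < 1, so the standard theory of mollification in weighted
  spaces does not cover all c; one-sided kernels do. The upward kernel stays away from 0 because,
  for large c, finiteness of the weighted norm does not make u integrable up to y = 0. The downward
  kernel is forced by (TC), which for c <= -1 speaks only of functions vanishing near the boundary.
  Both kernels are one bump of radius 1/2, centred at height 3/2 or -3/2.\<close>

definition flat_poly :: "real poly \<Rightarrow> real \<Rightarrow> real" where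
  "flat_poly p x = (if x \<le> 0 then 0 else poly p (1 / x) * exp (- (1 / x)))"

lemma poly_times_exp_neg_tendsto_0: "((\<lambda>x::real. poly p x * exp (- x)) \<longlongrightarrow> 0) at_top"
proof (induction p)
  case 0
  then show ?case by simp
next
  case (pCons a p)
  have P: "((\<lambda>x::real. x * (poly q x * exp (- x))) \<longlongrightarrow> 0) at_top" for q
  proof -
    have "((\<lambda>x. \<Sum>i\<le>degree q. coeff q i * (x ^ Suc i / exp x)) \<longlongrightarrow> (\<Sum>i\<le>degree q. coeff q i * 0)) at_top"
      by (intro tendsto_intros tendsto_power_div_exp_0)
    moreover have "(\<Sum>i\<le>degree q. coeff q i * (x ^ Suc i / exp x)) = x * (poly q x * exp (- x))" for x
      by (simp add: poly_altdef sum_distrib_left sum_distrib_right exp_minus field_simps)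
    ultimately show ?thesis by simp
  qed
  have "((\<lambda>x::real. a * (x ^ 0 / exp x) + x * (poly p x * exp (- x))) \<longlongrightarrow> a * 0 + 0) at_top"
    by (intro tendsto_intros tendsto_power_div_exp_0 P)
  then show ?case by (simp add: exp_minus field_simps)
qed

text \<open>With s = 1/x, d/dx is -s^2 d/ds, and p(s) exp(-s) becomes s^2 (p - p')(s) exp(-s). The
  family \<open>flat_poly p\<close> is thus closed under differentiation, which is why it is
  parametrised by polynomials; \<open>flat_poly 1\<close> is the classical exp(-1/x).\<close>

lemma flat_poly_has_real_derivative:
  "(flat_poly p has_real_derivative flat_poly ([:0, 0, 1:] * (p - pderiv p)) x) (at x)"
proof (cases x "0::real" rule: linorder_cases)
  case less
  have "((\<lambda>x. 0) has_real_derivative flat_poly ([:0, 0, 1:] * (p - pderiv p)) x) (at x)"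
    using less by (auto simp: flat_poly_def)
  then show ?thesis
    by (rule has_field_derivative_transform_within_open[where S="{..<0}"])
      (use less in \<open>auto simp: flat_poly_def\<close>)
next
  case greater
  have D: "((\<lambda>x. 1 / x) has_real_derivative - (1 / x\<^sup>2)) (at x)"
    using greater by (auto intro!: derivative_eq_intros simp: field_simps power2_eq_square)
  have E: "((\<lambda>x. exp (- (1 / x))) has_real_derivative exp (- (1 / x)) * (1 / x\<^sup>2)) (at x)"
    using DERIV_chain2[OF DERIV_exp DERIV_minus[OF D]] by simp
  have "((\<lambda>x. poly p (1 / x) * exp (- (1 / x))) has_real_derivative
      flat_poly ([:0, 0, 1:] * (p - pderiv p)) x) (at x)"
    by (rule DERIV_cong[OF DERIV_mult[OF DERIV_chain2[OF poly_DERIV D] E]])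
      (use greater in \<open>simp add: flat_poly_def field_simps power2_eq_square\<close>)
  then show ?thesis
    by (rule has_field_derivative_transform_within_open[where S="{0<..}"])
      (use greater in \<open>auto simp: flat_poly_def\<close>)
next
  case equal
  have "((\<lambda>h. flat_poly p h / h) \<longlongrightarrow> 0) (at 0)"
  proof (rule filterlim_split_at)
    show "((\<lambda>h. flat_poly p h / h) \<longlongrightarrow> 0) (at_left 0)"
      by (rule tendsto_eventually) (auto simp: flat_poly_def eventually_at_left[of "-1::real" 0] intro!: exI[of _ "-1::real"])
    \<comment> \<open>Dividing by h multiplies by s = 1/h, which is the passage from
      \<open>p\<close> to \<open>pCons 0 p\<close>.\<close>
    have "((\<lambda>h. poly (pCons 0 p) (inverse h) * exp (- inverse h)) \<longlongrightarrow> 0) (at_right (0::real))"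
      by (rule filterlim_compose[OF poly_times_exp_neg_tendsto_0 filterlim_inverse_at_top_right])
    then show "((\<lambda>h. flat_poly p h / h) \<longlongrightarrow> 0) (at_right 0)"
      by (rule Lim_transform_eventually)
        (auto simp: flat_poly_def eventually_at_right[of 0 "1::real"] field_simps intro!: exI[of _ "1::real"])
  qed
  then show ?thesis
    unfolding has_field_derivative_iff using equal by (simp add: flat_poly_def)
qed

lemma continuous_on_flat_poly: "continuous_on S (flat_poly p)"
  using flat_poly_has_real_derivative DERIV_isCont continuous_at_imp_continuous_on by blast

section \<open>Closure properties of the classes \<open>Ck\<close>\<close>

lemma Ck_SucI:
  assumes "\<And>x. (f has_derivative f' x) (at x)" "\<And>i. i \<in> Basis \<Longrightarrow> Ck k (\<lambda>x. f' x i)"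
  shows "Ck (Suc k) f"
proof -
  have "frechet_derivative f (at x) = f' x" for x
    using frechet_derivative_at[OF assms(1)] by simp
  then show ?thesis using assms by (auto simp: differentiable_on_def differentiable_def)
qed

lemma Ck_SucE:
  assumes "Ck (Suc k) f"
  shows "(f has_derivative frechet_derivative f (at x)) (at x)"
    "i \<in> Basis \<Longrightarrow> Ck k (\<lambda>x. frechet_derivative f (at x) i)"
  using assms by (auto simp: differentiable_on_def frechet_derivative_works)

text \<open>Product and chain rule leave an undifferentiated factor in each derivative; in the
  inductions below that factor must be lowered by one order.\<close>

lemma Ck_Suc_imp_Ck: "Ck (Suc k) f \<Longrightarrow> Ck k f"
proof (induction k arbitrary: f)
  case 0
  then show ?case
    by (auto simp: differentiable_imp_continuous_on)
next
  case (Suc k)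
  show ?case
    by (rule Ck_SucI[OF Ck_SucE(1)[OF Suc.prems]]) (rule Suc.IH[OF Ck_SucE(2)[OF Suc.prems]])
qed

lemma Ck_const: "Ck k (\<lambda>x. c)"
proof (induction k arbitrary: c)
  case (Suc k)
  show ?case by (rule Ck_SucI[where f'="\<lambda>_ _. 0"]) (use Suc in auto)
qed auto

lemma Ck_bounded_linear: "bounded_linear f \<Longrightarrow> Ck k f"
proof (cases k)
  case 0
  assume "bounded_linear f" then show ?thesis using 0 by (simp add: linear_continuous_on)
next
  case (Suc j)
  assume "bounded_linear f"
  then show ?thesis unfolding Suc
    by (intro Ck_SucI[where f'="\<lambda>_. f"] bounded_linear_imp_has_derivative Ck_const)
qed

lemma Ck_add: "Ck k f \<Longrightarrow> Ck k g \<Longrightarrow> Ck k (\<lambda>x. f x + g x)"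
proof (induction k arbitrary: f g)
  case 0
  then show ?case by (simp add: continuous_on_add)
next
  case (Suc k)
  show ?case
    by (rule Ck_SucI[OF has_derivative_add[OF Ck_SucE(1)[OF Suc.prems(1)] Ck_SucE(1)[OF Suc.prems(2)]]])
      (intro Suc.IH Ck_SucE(2)[OF Suc.prems(1)] Ck_SucE(2)[OF Suc.prems(2)])
qed

lemma Ck_mult: "Ck k f \<Longrightarrow> Ck k g \<Longrightarrow> Ck k (\<lambda>x. f x * g x)"
proof (induction k arbitrary: f g)
  case 0
  then show ?case by (simp add: continuous_on_mult)
next
  case (Suc k)
  show ?case
    by (rule Ck_SucI[OF has_derivative_mult[OF Ck_SucE(1)[OF Suc.prems(1)] Ck_SucE(1)[OF Suc.prems(2)]]])
      (intro Ck_add Suc.IH Ck_SucE(2)[OF Suc.prems(1)] Ck_SucE(2)[OF Suc.prems(2)]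
        Ck_Suc_imp_Ck[OF Suc.prems(1)] Ck_Suc_imp_Ck[OF Suc.prems(2)])
qed

lemma Ck_sum: "(\<And>i. i \<in> I \<Longrightarrow> Ck k (f i)) \<Longrightarrow> Ck k (\<lambda>x. \<Sum>i\<in>I. f i x)"
  by (induction I rule: infinite_finite_induct) (auto intro: Ck_const Ck_add)

text \<open>The induction has to run over all \<open>p\<close> at once, since each derivative
  replaces \<open>p\<close> by another polynomial.\<close>

lemma Ck_flat_poly: "Ck k q \<Longrightarrow> Ck k (\<lambda>x. flat_poly p (q x))"
proof (induction k arbitrary: p)
  case 0
  with continuous_on_flat_poly show ?case by (auto intro: continuous_on_compose2)
next
  case (Suc k)
  show ?case
    by (rule Ck_SucI[OF has_derivative_compose[OF Ck_SucE(1)[OF Suc.prems]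
            flat_poly_has_real_derivative[unfolded has_field_derivative_def]]])
      (intro Ck_mult Suc.IH Ck_SucE(2)[OF Suc.prems]
        Ck_Suc_imp_Ck[OF Suc.prems])
qed

text \<open>The factor \<open>s\<close> and the centre \<open>a\<close> are built in so that
  rescaled and translated kernels are again bumps: as a function of \<open>w\<close> the support is
  the ball of radius 1/(2s) around a/s when \<open>s > 0\<close>. The squared norm keeps the
  argument polynomial, hence smooth.\<close>

definition bump :: "real \<Rightarrow> 'a \<Rightarrow> 'a::euclidean_space \<Rightarrow> real" where
  "bump s a w = flat_poly 1 (1 / 4 - (norm (s *\<^sub>R w - a))\<^sup>2)"

lemma smooth_bump: "smooth (bump s a)"
proof -
  have "bounded_linear (\<lambda>w::'a. (s *\<^sub>R w) \<bullet> i)" for i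
    by (intro bounded_linear_inner_left_comp bounded_linear_scaleR_right)
  from Ck_add[OF Ck_bounded_linear[OF this] Ck_const]
  have "Ck k (\<lambda>w. (s *\<^sub>R w) \<bullet> i + - (a \<bullet> i))" for k i .
  then have inner: "Ck k (\<lambda>w. (s *\<^sub>R w - a) \<bullet> i)" for k i
    by (simp only: inner_diff_left add_uminus_conv_diff)
  have "Ck k (\<lambda>w. 1 / 4 + (- 1) * (\<Sum>i\<in>Basis. ((s *\<^sub>R w - a) \<bullet> i) * ((s *\<^sub>R w - a) \<bullet> i)))" for k
    by (intro Ck_add Ck_mult Ck_sum Ck_const inner)
  moreover have "(norm x)\<^sup>2 = (\<Sum>i\<in>Basis. (x \<bullet> i) * (x \<bullet> i))" for x :: 'a
    by (metis euclidean_inner power2_norm_eq_inner)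
  ultimately have "Ck k (\<lambda>w. 1 / 4 - (norm (s *\<^sub>R w - a))\<^sup>2)" for k
    by (simp only: mult_minus1 add_uminus_conv_diff)
  then show ?thesis unfolding smooth_def bump_def by (auto intro: Ck_flat_poly)
qed

lemma smooth_has_derivative: "smooth f \<Longrightarrow> (f has_derivative frechet_derivative f (at x)) (at x)"
  unfolding smooth_def by (rule Ck_SucE(1)[of 0]) blast

lemma smooth_frechet_derivative:
  "smooth f \<Longrightarrow> i \<in> Basis \<Longrightarrow> smooth (\<lambda>x. frechet_derivative f (at x) i)"
  unfolding smooth_def using Ck_SucE(2) by blast

lemma smooth_imp_continuous_on: "smooth f \<Longrightarrow> continuous_on S f"
  unfolding smooth_def by (metis Ck.simps(1) continuous_on_subset subset_UNIV)

lemma smooth_mult: "smooth f \<Longrightarrow> smooth g \<Longrightarrow> smooth (\<lambda>x. f x * g x)"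
  unfolding smooth_def by (simp add: Ck_mult)

lemma smooth_const: "smooth (\<lambda>x. c)"
  unfolding smooth_def by (simp add: Ck_const)

section \<open>Gradients of smooth functions\<close>

lemma frechet_derivative_eq_grad:
  assumes "f differentiable at x"
  shows "frechet_derivative f (at x) h = grad f x \<bullet> h"
proof -
  interpret linear "frechet_derivative f (at x)"
    by (rule linear_frechet_derivative[OF assms])
  have "frechet_derivative f (at x) (\<Sum>i\<in>Basis. (h \<bullet> i) *\<^sub>R i) = grad f x \<bullet> h"
    unfolding grad_def inner_sum_left by (simp add: sum scale mult.commute inner_commute)
  then show ?thesis by (simp add: euclidean_representation)
qed

lemma smooth_has_derivative_grad:
  assumes "smooth f" shows "(f has_derivative (\<lambda>h. grad f x \<bullet> h)) (at x)"
proof -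
  have "f differentiable at x" using smooth_has_derivative[OF assms] by (auto simp: differentiable_def)
  from frechet_derivative_eq_grad[OF this] smooth_has_derivative[OF assms, of x]
  show ?thesis by presburger
qed

lemma grad_eqI: "(f has_derivative (\<lambda>h. g \<bullet> h)) (at x) \<Longrightarrow> grad f x = g"
  unfolding grad_def by (simp add: frechet_derivative_at[symmetric] euclidean_representation)

lemma frechet_derivative_smooth: "smooth f \<Longrightarrow> frechet_derivative f (at x) h = grad f x \<bullet> h"
  by (rule frechet_derivative_eq_grad) (auto simp: differentiable_def intro: smooth_has_derivative)

lemma continuous_on_grad: "smooth f \<Longrightarrow> continuous_on S (grad f)"
  unfolding grad_def
  by (intro continuous_intros smooth_imp_continuous_on smooth_frechet_derivative)

lemma smooth_measurable: "smooth f \<Longrightarrow> f \<in> borel_measurable borel"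
  by (intro borel_measurable_continuous_onI smooth_imp_continuous_on)

lemma grad_measurable: "smooth f \<Longrightarrow> grad f \<in> borel_measurable borel"
  by (intro borel_measurable_continuous_onI continuous_on_grad)

lemma grad_zero_outside:
  assumes "closed K" "\<And>x. x \<notin> K \<Longrightarrow> f x = 0" "x \<notin> K"
  shows "grad f x = 0"
proof (rule grad_eqI)
  have "((\<lambda>x. 0::real) has_derivative (\<lambda>h. 0 \<bullet> h)) (at x)" by simp
  then show "(f has_derivative (\<lambda>h. 0 \<bullet> h)) (at x)"
    by (rule has_derivative_transform_within_open[of _ _ _ _ "- K"])
      (use assms in auto)
qed

section \<open>Compactly supported kernels and smoothness of convolutions\<close>

lemma uniformly_continuous_compact_support:
  fixes f :: "'a::euclidean_space \<Rightarrow> 'b::real_normed_vector"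
  assumes f: "continuous_on UNIV f" and K: "compact K" "\<And>x. x \<notin> K \<Longrightarrow> f x = 0" and "0 < e"
  obtains d where "0 < d" "\<And>x y. dist x y < d \<Longrightarrow> dist (f x) (f y) < e"
proof -
  \<comment> \<open>The unit enlargement of \<open>K\<close> contains both points as soon as one of
    them lies in \<open>K\<close> and their distance is at most 1.\<close>
  define L where "L = {x + y |x y. x \<in> K \<and> y \<in> cball 0 (1::real)}"
  have "compact L" unfolding L_def using K(1) by (rule compact_sums) simp
  then have "uniformly_continuous_on L f"
    using f by (intro compact_uniformly_continuous) (auto intro: continuous_on_subset)
  then obtain d where d: "0 < d" "\<And>x y. x \<in> L \<Longrightarrow> y \<in> L \<Longrightarrow> dist y x < d \<Longrightarrow> dist (f y) (f x) < e"
    using \<open>0 < e\<close> unfolding uniformly_continuous_on_def by metis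
  have L: "y \<in> L" if "x \<in> K" "dist x y \<le> 1" for x y
    unfolding L_def using that
    by (intro CollectI exI[of _ x] exI[of _ "y - x"]) (auto simp: dist_norm norm_minus_commute)
  have "dist (f x) (f y) < e" if "dist x y < min d 1" for x y
  proof (cases "x \<in> K \<or> y \<in> K")
    case True
    then have "x \<in> L" "y \<in> L" using that L[of x y] L[of y x] L[of x x] L[of y y] by (auto simp: dist_commute)
    then show ?thesis using d(2)[of y x] that by auto
  next
    case False
    then show ?thesis using K(2) \<open>0 < e\<close> by simp
  qed
  with d(1) show ?thesis by (intro that[of "min d 1"]) auto
qed

lemma bounded_compact_support:
  fixes f :: "'a::euclidean_space \<Rightarrow> 'b::real_normed_vector"
  assumes f: "continuous_on UNIV f" and K: "compact K" "\<And>x. x \<notin> K \<Longrightarrow> f x = 0"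
  obtains B where "0 < B" "\<And>x. norm (f x) \<le> B"
proof -
  have "bounded (f ` K)"
    using assms by (intro compact_imp_bounded compact_continuous_image) (auto intro: continuous_on_subset)
  then obtain B where B: "0 < B" "\<And>x. x \<in> K \<Longrightarrow> norm (f x) \<le> B"
    unfolding bounded_pos by auto
  then have "norm (f x) \<le> B" for x by (cases "x \<in> K") (auto simp: K(2))
  with B(1) show ?thesis by (intro that) auto
qed

lemma integrable_mult_bounded:
  fixes f g :: "'a \<Rightarrow> real"
  assumes "integrable M f" "g \<in> borel_measurable M" "\<And>x. \<bar>g x\<bar> \<le> B"
  shows "integrable M (\<lambda>x. g x * f x)"
proof (rule Bochner_Integration.integrable_bound)
  show "integrable M (\<lambda>x. B * f x)" using assms(1) by simp
  show "(\<lambda>x. g x * f x) \<in> borel_measurable M" using assms(1,2) by simp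
  show "AE x in M. norm (g x * f x) \<le> norm (B * f x)"
    using assms(3) by (auto simp: abs_mult intro!: AE_I2 mult_right_mono intro: order.trans[OF _ abs_ge_self])
qed

text \<open>The gradient of the kernel is uniformly continuous, so the linearisation error is at
  most \<open>e'\<close> times the norm of the increment, uniformly in the integration variable, and
  can be integrated against the absolute value of \<open>f\<close>. The minus sign comes from
  \<open>z\<close> entering through \<open>w - z\<close>.\<close>

lemma convolution_has_derivative:
  fixes \<kappa> :: "'a::euclidean_space \<Rightarrow> real"
  assumes \<kappa>: "smooth \<kappa>" and K: "compact K" "\<And>x. x \<notin> K \<Longrightarrow> \<kappa> x = 0"
    and f: "integrable lborel f"
  shows "((\<lambda>z. \<integral>w. \<kappa> (w - z) * f w \<partial>lborel) has_derivative
    (\<lambda>h. - (\<integral>w. (grad \<kappa> (w - z) \<bullet> h) * f w \<partial>lborel))) (at z)"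
proof -
  note [continuous_intros] = continuous_on_compose2[OF smooth_imp_continuous_on[OF \<kappa>, of UNIV]]
    continuous_on_compose2[OF continuous_on_grad[OF \<kappa>, of UNIV]]
  have g0: "grad \<kappa> x = 0" if "x \<notin> K" for x
    using grad_zero_outside[OF compact_imp_closed] K that by metis
  obtain B where B: "\<And>x. norm (\<kappa> x) \<le> B"
    using bounded_compact_support[OF smooth_imp_continuous_on[OF \<kappa>] K] by blast
  obtain B' where B': "0 < B'" "\<And>x. norm (grad \<kappa> x) \<le> B'"
    using bounded_compact_support[OF continuous_on_grad[OF \<kappa>] K(1) g0] by blast
  have i1: "integrable lborel (\<lambda>w. \<kappa> (w - z) * f w)" for z
    using B by (intro integrable_mult_bounded[OF f, of _ B])
      (auto intro!: borel_measurable_continuous_onI continuous_intros)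
  have bd: "\<bar>grad \<kappa> x \<bullet> h\<bar> \<le> B' * norm h" for x h
    using Cauchy_Schwarz_ineq2[of "grad \<kappa> x" h] B'(2)[of x] mult_right_mono[of "norm (grad \<kappa> x)" B' "norm h"] by auto
  have i2: "integrable lborel (\<lambda>w. (grad \<kappa> (w - z) \<bullet> h) * f w)" for z h
    by (intro integrable_mult_bounded[OF f _ bd])
      (auto intro!: borel_measurable_continuous_onI continuous_intros)
  let ?F = "\<lambda>z. \<integral>w. \<kappa> (w - z) * f w \<partial>lborel"
  let ?D = "\<lambda>h. - (\<integral>w. (grad \<kappa> (w - z) \<bullet> h) * f w \<partial>lborel)"
  define A where "A = (\<integral>w. \<bar>f w\<bar> \<partial>lborel)"
  have A: "0 \<le> A" unfolding A_def by simp
  show ?thesis unfolding has_derivative_at_alt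
  proof (intro conjI allI impI)
    show "bounded_linear ?D"
    proof (rule bounded_linear_intro[where K="B' * A"])
      show "?D (x + y) = ?D x + ?D y" for x y
        by (simp add: inner_add_right distrib_right Bochner_Integration.integral_add[OF i2 i2])
      show "?D (r *\<^sub>R x) = r *\<^sub>R ?D x" for r x
        by (simp add: mult.assoc)
      show "norm (?D h) \<le> norm h * (B' * A)" for h
      proof -
        have "norm (?D h) \<le> (\<integral>w. (B' * norm h) * \<bar>f w\<bar> \<partial>lborel)"
          unfolding norm_minus_cancel
          using f by (intro Bochner_Integration.integral_norm_bound_integral i2)
            (auto simp: abs_mult intro!: mult_right_mono bd)
        also have "\<dots> = norm h * (B' * A)" by (simp add: A_def)
        finally show ?thesis .
      qed
    qed
    fix e :: real assume "0 < e"
    \<comment> \<open>Adding 1 to the L^1 norm \<open>A\<close> of \<open>f\<close> avoids a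
      division by zero when \<open>f\<close> vanishes almost everywhere.\<close>
    define e' where "e' = e / (A + 1)"
    then have e': "0 < e'" using A \<open>0 < e\<close> by simp
    obtain d where d: "0 < d" "\<And>x y. dist x y < d \<Longrightarrow> dist (grad \<kappa> x) (grad \<kappa> y) < e'"
      using uniformly_continuous_compact_support[OF continuous_on_grad[OF \<kappa>] K(1) g0 e'] by blast
    \<comment> \<open>Mean value inequality on the ball of radius \<open>norm h\<close> around
      \<open>x\<close>: there the gradient differs from its value at \<open>x\<close> by at most
      \<open>e'\<close>.\<close>
    have lin: "\<bar>\<kappa> (x - h) - \<kappa> x + grad \<kappa> x \<bullet> h\<bar> \<le> norm h * e'" if "norm h < d" for x h
    proof -
      have "norm (\<kappa> (x - h) - \<kappa> x - grad \<kappa> x \<bullet> ((x - h) - x)) \<le> norm ((x - h) - x) * e'"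
      proof (rule differentiable_bound_linearization[where S="cball x (norm h)" and f'="\<lambda>x h. grad \<kappa> x \<bullet> h"])
        show "x + t *\<^sub>R (x - h - x) \<in> cball x (norm h)" if "t \<in> {0..1}" for t
          using that by (auto simp: dist_norm mult_left_le_one_le)
        show "(\<kappa> has_derivative (\<bullet>) (grad \<kappa> y)) (at y within cball x (norm h))" for y
          using smooth_has_derivative_grad[OF \<kappa>, of y] by (rule has_derivative_at_withinI)
        show "onorm ((\<bullet>) (grad \<kappa> y) - (\<bullet>) (grad \<kappa> x)) \<le> e'" if "y \<in> cball x (norm h)" for y
        proof (rule onorm_le)
          fix k :: 'a
          have "dist (grad \<kappa> y) (grad \<kappa> x) \<le> e'"
            using d(2)[of y x] that \<open>norm h < d\<close> by (auto simp: dist_commute)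
          then have "norm (grad \<kappa> y - grad \<kappa> x) * norm k \<le> e' * norm k"
            by (intro mult_right_mono) (auto simp: dist_norm)
          moreover have "norm (((\<bullet>) (grad \<kappa> y) - (\<bullet>) (grad \<kappa> x)) k) \<le> norm (grad \<kappa> y - grad \<kappa> x) * norm k"
            unfolding minus_apply real_norm_def inner_diff_left[symmetric] by (rule Cauchy_Schwarz_ineq2)
          ultimately show "norm (((\<bullet>) (grad \<kappa> y) - (\<bullet>) (grad \<kappa> x)) k) \<le> e' * norm k"
            by (rule order.trans[rotated])
        qed
      qed auto
      then show ?thesis by (simp add: inner_diff_right)
    qed
    show "\<exists>d>0. \<forall>y. norm (y - z) < d \<longrightarrow> norm (?F y - ?F z - ?D (y - z)) \<le> e * norm (y - z)"
    proof (intro exI conjI allI impI)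
      show "0 < d" by fact
      fix y assume y: "norm (y - z) < d"
      have "?F y - ?F z - ?D (y - z) =
          (\<integral>w. (\<kappa> ((w - z) - (y - z)) - \<kappa> (w - z) + grad \<kappa> (w - z) \<bullet> (y - z)) * f w \<partial>lborel)"
        using i1[of y] i1[of z] i2[of z "y - z"]
        by (simp add: distrib_right left_diff_distrib)
      also have "norm \<dots> \<le> (\<integral>w. (norm (y - z) * e') * \<bar>f w\<bar> \<partial>lborel)"
      proof (rule Bochner_Integration.integral_norm_bound_integral)
        show "integrable lborel (\<lambda>w. (\<kappa> ((w - z) - (y - z)) - \<kappa> (w - z) + grad \<kappa> (w - z) \<bullet> (y - z)) * f w)"
          using i1[of y] i1[of z] i2[of z "y - z"] by (simp add: distrib_right left_diff_distrib)
        show "integrable lborel (\<lambda>w. (norm (y - z) * e') * \<bar>f w\<bar>)" using f by simp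
        show "norm ((\<kappa> ((w - z) - (y - z)) - \<kappa> (w - z) + grad \<kappa> (w - z) \<bullet> (y - z)) * f w)
            \<le> (norm (y - z) * e') * \<bar>f w\<bar>" for w
          unfolding real_norm_def abs_mult by (rule mult_right_mono[OF lin[OF y, unfolded real_norm_def] abs_ge_zero])
      qed
      also have "\<dots> = norm (y - z) * (e * (A / (A + 1)))" by (simp add: A_def e'_def)
      also have "\<dots> \<le> norm (y - z) * (e * 1)"
        using A \<open>0 < e\<close> by (intro mult_left_mono) (auto simp: field_simps)
      finally show "norm (?F y - ?F z - ?D (y - z)) \<le> e * norm (y - z)" by (simp add: mult.commute)
    qed
  qed
qed

text \<open>Each partial derivative is minus a convolution of the same \<open>f\<close> with a
  kernel supported in the same \<open>K\<close>, so the induction generalises over the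
  kernel.\<close>

lemma smooth_convolution:
  fixes \<kappa> :: "'a::euclidean_space \<Rightarrow> real"
  assumes "smooth \<kappa>" and K: "compact K" "\<And>x. x \<notin> K \<Longrightarrow> \<kappa> x = 0"
    and f: "integrable lborel f"
  shows "smooth (\<lambda>z. \<integral>w. \<kappa> (w - z) * f w \<partial>lborel)"
proof -
  have "Ck k (\<lambda>z. \<integral>w. \<kappa> (w - z) * f w \<partial>lborel)" if "smooth \<kappa>" "\<And>x. x \<notin> K \<Longrightarrow> \<kappa> x = 0" for k \<kappa>
    using that
  proof (induction k arbitrary: \<kappa>)
    case 0
    then show ?case
      using has_derivative_continuous[OF convolution_has_derivative[OF 0(1) K(1) 0(2) f]]
      by (simp add: continuous_at_imp_continuous_on)
  next
    case (Suc k)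
    show ?case
    proof (rule Ck_SucI[OF convolution_has_derivative[OF Suc.prems(1) K(1) Suc.prems(2) f]])
      fix i :: 'a assume i: "i \<in> Basis"
      have "smooth (\<lambda>x. grad \<kappa> x \<bullet> i)"
        using smooth_frechet_derivative[OF Suc.prems(1) i]
        by (simp add: frechet_derivative_smooth[OF Suc.prems(1)])
      moreover have "grad \<kappa> x \<bullet> i = 0" if "x \<notin> K" for x
        using grad_zero_outside[OF compact_imp_closed[OF K(1)] Suc.prems(2) that] by simp
      ultimately have "Ck k (\<lambda>z. (- 1) * (\<integral>w. (grad \<kappa> (w - z) \<bullet> i) * f w \<partial>lborel))"
        by (intro Ck_mult Ck_const Suc.IH)
      then show "Ck k (\<lambda>z. - (\<integral>w. (grad \<kappa> (w - z) \<bullet> i) * f w \<partial>lborel))" by simp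
    qed
  qed
  then show ?thesis using assms unfolding smooth_def by blast
qed

lemma grad_convolution:
  fixes \<kappa> :: "'a::euclidean_space \<Rightarrow> real"
  assumes "smooth \<kappa>" and K: "compact K" "\<And>x. x \<notin> K \<Longrightarrow> \<kappa> x = 0"
    and f: "integrable lborel f"
  shows "grad (\<lambda>z. \<integral>w. \<kappa> (w - z) * f w \<partial>lborel) z \<bullet> i = - (\<integral>w. (grad \<kappa> (w - z) \<bullet> i) * f w \<partial>lborel)"
  by (rule fun_cong[OF has_derivative_unique[OF smooth_has_derivative_grad[OF smooth_convolution[OF assms]]
        convolution_has_derivative[OF assms]]])

section \<open>Weighted square norms on the half-space\<close>

text \<open>Setting the weight to 0 for \<open>s \<le> 0\<close> turns integrals over the half-space
  into integrals over the whole space, where translation invariance and Fubini apply without a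
  domain.\<close>

definition pow_weight :: "real \<Rightarrow> real \<Rightarrow> ennreal" where
  "pow_weight c s = (if 0 < s then ennreal (s powr c) else 0)"

lemma pow_weight_measurable [measurable]: "pow_weight c \<in> borel_measurable borel"
  unfolding pow_weight_def by measurable

lemma fst_borel_measurable [measurable]:
  "(fst :: real \<times> 'b::euclidean_space \<Rightarrow> real) \<in> borel_measurable borel"
  by (intro borel_measurable_continuous_onI continuous_intros)

lemma pow_weight_fst_measurable [measurable]:
  "(\<lambda>z :: real \<times> 'b::euclidean_space. pow_weight c (fst z)) \<in> borel_measurable borel"
  by (rule measurable_compose[OF fst_borel_measurable pow_weight_measurable])

text \<open>The profile \<open>\<phi>\<close> is left out on purpose: on bounded sets it lies
  between positive constants, while the pure power is homogeneous, which makes the shift estimates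
  independent of the scale.\<close>

definition wnorm_sq :: "real \<Rightarrow> (real \<times> 'b::euclidean_space \<Rightarrow> real) \<Rightarrow> ennreal" where
  "wnorm_sq c f = (\<integral>\<^sup>+ z. pow_weight c (fst z) * ennreal ((f z)\<^sup>2) \<partial>lborel)"

text \<open>A power is monotone in one direction or the other, so the sum of the two endpoint values
  is a bound for either sign of \<open>c\<close>.\<close>

lemma pow_weight_bounded:
  assumes "0 < a" "a \<le> b"
  obtains B where "\<And>s. a \<le> s \<Longrightarrow> s \<le> b \<Longrightarrow> pow_weight c s \<le> ennreal B" "0 \<le> B"
proof
  show "pow_weight c s \<le> ennreal (a powr c + b powr c)" if "a \<le> s" "s \<le> b" for s
  proof -
    have "s powr c \<le> a powr c + b powr c"
    proof (cases "0 \<le> c")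
      case True
      then have "s powr c \<le> b powr c" using that assms by (intro powr_mono2) auto
      then show ?thesis using powr_ge_zero[of a c] by linarith
    next
      case False
      then have "s powr c \<le> a powr c" using that assms by (intro powr_mono2') auto
      then show ?thesis using powr_ge_zero[of b c] by linarith
    qed
    then show ?thesis using that assms by (auto simp: pow_weight_def ennreal_leI simp del: ennreal_plus)
  qed
  show "0 \<le> a powr c + b powr c" by simp
qed

lemma pow_weight_mult: "0 < e \<Longrightarrow> pow_weight c (e * s) = ennreal (e powr c) * pow_weight c s"
  by (auto simp: pow_weight_def powr_mult ennreal_mult' zero_less_mult_iff)

text \<open>For \<open>0 < a\<close> these are compact subsets of the open half-space, and they
  exhaust it as \<open>a\<close> tends to 0 and \<open>b\<close> to infinity.\<close>

definition slab :: "real \<Rightarrow> real \<Rightarrow> (real \<times> 'b::euclidean_space) set" where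
  "slab a b = {z. a \<le> fst z \<and> norm z \<le> b}"

lemma compact_slab: "compact (slab a b :: (real \<times> 'b::euclidean_space) set)"
proof -
  have "slab a b = cball 0 b \<inter> {z. a \<le> fst z}"
    unfolding slab_def by auto
  moreover have "closed {z :: real \<times> 'b. a \<le> fst z}"
    by (intro closed_Collect_le continuous_intros)
  ultimately show ?thesis by (metis compact_Int_closed compact_cball)
qed

lemma slab_borel [measurable]: "slab a b \<in> sets borel"
  using compact_slab by (intro borel_closed compact_imp_closed)

lemma finite_weight_slab:
  assumes "0 < a"
  shows "(\<integral>\<^sup>+ z. pow_weight c (fst z) * indicator (slab a b) z \<partial>(lborel :: (real \<times> 'b::euclidean_space) measure)) < \<infinity>"
proof -
  obtain B where B: "\<And>s. a \<le> s \<Longrightarrow> s \<le> max a b \<Longrightarrow> pow_weight c s \<le> ennreal B" "0 \<le> B"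
    using pow_weight_bounded[of a "max a b"] assms by auto
  have "pow_weight c (fst z) \<le> ennreal B" if "z \<in> slab a b" for z :: "real \<times> 'b"
    using norm_fst_le[of "fst z" "snd z"] that by (intro B(1)) (auto simp: slab_def)
  then have "(\<integral>\<^sup>+ z. pow_weight c (fst z) * indicator (slab a b) z \<partial>(lborel :: (real \<times> 'b) measure))
      \<le> (\<integral>\<^sup>+ z. ennreal B * indicator (slab a b) z \<partial>(lborel :: (real \<times> 'b) measure))"
    by (intro nn_integral_mono) (simp split: split_indicator)
  also have "\<dots> = ennreal B * emeasure lborel (slab a b :: (real \<times> 'b) set)"
    by (subst nn_integral_cmult_indicator) auto
  also have "\<dots> < \<infinity>"
    using emeasure_compact_finite[OF compact_slab, of a b] by (auto simp: ennreal_mult_less_top)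
  finally show ?thesis .
qed

lemma ennreal_square_add3:
  "ennreal ((a + b + c)\<^sup>2) \<le> 3 * (ennreal (a\<^sup>2) + ennreal (b\<^sup>2) + ennreal (c\<^sup>2))"
proof -
  have "(a + b + c)\<^sup>2 + ((a - b)\<^sup>2 + (b - c)\<^sup>2 + (a - c)\<^sup>2) = 3 * (a\<^sup>2 + b\<^sup>2 + c\<^sup>2)"
    by (simp add: power2_eq_square algebra_simps)
  then have "(a + b + c)\<^sup>2 \<le> 3 * (a\<^sup>2 + b\<^sup>2 + c\<^sup>2)"
    using zero_le_power2[of "a - b"] zero_le_power2[of "b - c"] zero_le_power2[of "a - c"] by linarith
  then have "ennreal ((a + b + c)\<^sup>2) \<le> ennreal (3 * (a\<^sup>2 + b\<^sup>2 + c\<^sup>2))" by (rule ennreal_leI)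
  also have "\<dots> = 3 * (ennreal (a\<^sup>2) + ennreal (b\<^sup>2) + ennreal (c\<^sup>2))"
    by (simp add: ennreal_mult)
  finally show ?thesis .
qed

text \<open>This crude bound is what gives L^1 from L^2 on sets of finite measure.\<close>

lemma abs_le_one_plus_square: "\<bar>x\<bar> \<le> 1 + x\<^sup>2" for x :: real
  using zero_le_power2[of "\<bar>x\<bar> - 1"] by (simp add: power2_diff)

text \<open>The difference of the two sides is the variance. If the square is not integrable the
  right side is infinite, so the value that the Bochner integral then takes does no harm.\<close>

lemma square_integral_le:
  fixes f :: "'a \<Rightarrow> real"
  assumes P: "emeasure P (space P) = 1" and [measurable]: "f \<in> borel_measurable P"
  shows "ennreal ((\<integral>t. f t \<partial>P)\<^sup>2) \<le> (\<integral>\<^sup>+ t. ennreal ((f t)\<^sup>2) \<partial>P)"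
proof (cases "integrable P (\<lambda>t. (f t)\<^sup>2)")
  case True
  interpret finite_measure P by (rule finite_measureI) (simp add: P)
  have P': "measure P (space P) = 1" using P by (simp add: measure_def)
  have f: "integrable P f"
  proof (rule Bochner_Integration.integrable_bound)
    show "integrable P (\<lambda>t. 1 + (f t)\<^sup>2)" using True by simp
    show "AE t in P. norm (f t) \<le> norm (1 + (f t)\<^sup>2)"
      using abs_le_one_plus_square by (auto intro: order.trans)
  qed simp
  define m where "m = (\<integral>t. f t \<partial>P)"
  have "0 \<le> (\<integral>t. (f t - m)\<^sup>2 \<partial>P)" by simp
  also have "\<dots> = (\<integral>t. (f t)\<^sup>2 - (2 * m) * f t + m\<^sup>2 \<partial>P)"
    by (simp add: power2_diff algebra_simps)
  also have "\<dots> = (\<integral>t. (f t)\<^sup>2 \<partial>P) - (2 * m) * m + m\<^sup>2"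
    using True f by (simp add: P' m_def)
  finally have "m\<^sup>2 \<le> (\<integral>t. (f t)\<^sup>2 \<partial>P)" by (simp add: power2_eq_square)
  then show ?thesis
    using True by (simp add: nn_integral_eq_integral m_def ennreal_leI)
next
  case False
  then have "(\<integral>\<^sup>+ t. ennreal ((f t)\<^sup>2) \<partial>P) = \<infinity>"
    by (auto simp: integrable_iff_bounded less_top[symmetric])
  then show ?thesis by simp
qed

section \<open>Density of continuous functions supported in slabs\<close>

lemma wnorm_sq_approx_slab:
  fixes f :: "real \<times> 'b::euclidean_space \<Rightarrow> real"
  assumes [measurable]: "f \<in> borel_measurable borel" and f: "wnorm_sq c f < \<infinity>" and "0 < e"
  obtains n :: nat where "0 < n"
    "wnorm_sq c (\<lambda>z. f z - (if \<bar>f z\<bar> \<le> n \<and> norm z \<le> n \<and> 1 / n \<le> fst z then f z else 0)) < e"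
proof -
  let ?p = "\<lambda>z. pow_weight c (fst z) * ennreal ((f z)\<^sup>2)"
  let ?f = "\<lambda>n::nat. \<lambda>z. (if \<bar>f z\<bar> \<le> n \<and> norm z \<le> n \<and> 1 / n \<le> fst z then f z else 0)"
  have "(\<lambda>n. \<integral>\<^sup>+ z. pow_weight c (fst z) * ennreal ((f z - ?f n z)\<^sup>2) \<partial>lborel)
    \<longlonglongrightarrow> (\<integral>\<^sup>+ z. 0 \<partial>(lborel :: (real \<times> 'b) measure))"
  proof (rule nn_integral_dominated_convergence)
    show "(\<integral>\<^sup>+ z. ?p z \<partial>lborel) < \<infinity>"
      using f by (simp add: wnorm_sq_def)
    show "AE z in lborel. pow_weight c (fst z) * ennreal ((f z - ?f j z)\<^sup>2)
        \<le> ?p z" for j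
      by (intro AE_I2 mult_left_mono) auto
    show "AE z in lborel. (\<lambda>n. pow_weight c (fst z) * ennreal ((f z - ?f n z)\<^sup>2)) \<longlonglongrightarrow> 0"
    proof (intro AE_I2 tendsto_eventually)
      fix z :: "real \<times> 'b"
      show "\<forall>\<^sub>F n in sequentially. pow_weight c (fst z) * ennreal ((f z - ?f n z)\<^sup>2) = 0"
      proof (cases "0 < fst z")
        case True
        obtain N where N: "max (max \<bar>f z\<bar> (norm z)) (1 / fst z) < real N"
          using reals_Archimedean2 by blast
        have eq: "f z = ?f n z" if "N \<le> n" for n
        proof -
          have n: "max (max \<bar>f z\<bar> (norm z)) (1 / fst z) < real n" using N that by simp
          then have "0 < real n" using True by (smt (verit) divide_pos_pos)
          then have "1 / n \<le> fst z" using n True by (simp add: field_simps)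
          then show ?thesis using n by simp
        qed
        show ?thesis using eventually_ge_at_top[of N]
        proof eventually_elim
          case (elim n)
          show ?case unfolding eq[OF elim, symmetric] by simp
        qed
      qed (simp add: pow_weight_def)
    qed
  qed measurable
  then have "(\<lambda>n. wnorm_sq c (\<lambda>z. f z - ?f n z)) \<longlonglongrightarrow> 0"
    unfolding wnorm_sq_def by simp
  then have "\<forall>\<^sub>F n in sequentially. wnorm_sq c (\<lambda>z. f z - ?f n z) < e"
    using \<open>0 < e\<close> by (rule order_tendstoD)
  then have "\<forall>\<^sub>F n in sequentially. 0 < n \<and> wnorm_sq c (\<lambda>z. f z - ?f n z) < e"
    using eventually_gt_at_top[of 0] by eventually_elim auto
  then show ?thesis using that eventually_happens' sequentially_bot by blast
qed

lemma wnorm_sq_add3: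
  fixes f g h :: "real \<times> 'b::euclidean_space \<Rightarrow> real"
  assumes [measurable]: "f \<in> borel_measurable borel" "g \<in> borel_measurable borel" "h \<in> borel_measurable borel"
  shows "wnorm_sq c (\<lambda>z. f z + g z + h z) \<le> 3 * (wnorm_sq c f + wnorm_sq c g + wnorm_sq c h)"
proof -
  have "wnorm_sq c (\<lambda>z. f z + g z + h z) \<le> (\<integral>\<^sup>+ z. 3 * (pow_weight c (fst z) * ennreal ((f z)\<^sup>2)
      + pow_weight c (fst z) * ennreal ((g z)\<^sup>2) + pow_weight c (fst z) * ennreal ((h z)\<^sup>2)) \<partial>lborel)"
    unfolding wnorm_sq_def
    by (intro nn_integral_mono order.trans[OF mult_left_mono[OF ennreal_square_add3]])
      (auto simp: distrib_left mult.left_commute)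
  also have "\<dots> = 3 * (wnorm_sq c f + wnorm_sq c g + wnorm_sq c h)"
    unfolding wnorm_sq_def by (subst nn_integral_cmult, simp, subst nn_integral_add, simp, simp, subst nn_integral_add, simp_all)
  finally show ?thesis .
qed

text \<open>After truncation in size, radius and height, \<open>F\<close> is bounded and lives on a
  slab. Measurability yields continuous \<open>g j\<close> converging to \<open>F\<close> almost
  everywhere, without any bound or support condition; clamping to [-n, n] and multiplying by the
  continuous \<open>q\<close> supplies both without changing \<open>F\<close>, and dominated
  convergence applies.\<close>

lemma wnorm_sq_dense:
  fixes f :: "real \<times> 'b::euclidean_space \<Rightarrow> real"
  assumes [measurable]: "f \<in> borel_measurable borel" and f: "wnorm_sq c f < \<infinity>" and "0 < e"
  obtains g a b where "continuous_on UNIV g" "0 < a" "a \<le> b" "\<And>z. z \<notin> slab a b \<Longrightarrow> g z = 0"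
    "wnorm_sq c (\<lambda>z. f z - g z) < e"
proof -
  \<comment> \<open>The quadratic triangle inequality costs a factor 3 and there are two errors: the
    truncation and the continuous approximation.\<close>
  have e6: "0 < e / 6"
    using \<open>0 < e\<close> by (simp add: ennreal_zero_less_divide)
  from wnorm_sq_approx_slab[OF assms(1) f e6]
  obtain n :: nat where n: "0 < n"
    "wnorm_sq c (\<lambda>z. f z - (if \<bar>f z\<bar> \<le> n \<and> norm z \<le> n \<and> 1 / n \<le> fst z then f z else 0)) < e / 6" .
  define F where "F z = (if \<bar>f z\<bar> \<le> n \<and> norm z \<le> n \<and> 1 / n \<le> fst z then f z else 0)" for z
  have [measurable]: "F \<in> borel_measurable borel" unfolding F_def by measurable
  have "F \<in> borel_measurable lebesgue" by (intro measurable_completion) simp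
  then have "F measurable_on UNIV"
    by (simp add: measurable_on_iff_borel_measurable)
  then obtain N g where N: "negligible N" "\<And>j::nat. continuous_on UNIV (g j)"
    "\<And>x. x \<notin> N \<Longrightarrow> (\<lambda>j. g j x) \<longlonglongrightarrow> F x"
    unfolding measurable_on_def by auto
  have [measurable]: "g j \<in> borel_measurable borel" for j
    by (rule borel_measurable_continuous_onI) fact
  have [continuous_intros]: "continuous_on UNIV (\<lambda>z. g j z)" for j using N(2) by simp
  have AE: "AE z in lborel. (\<lambda>j. g j z) \<longlonglongrightarrow> F z"
  proof -
    have "AE z in lebesgue. z \<notin> N"
      using N(1) by (auto simp: negligible_iff_null_sets intro: AE_not_in)
    then have "AE z in lebesgue. (\<lambda>j. g j z) \<longlonglongrightarrow> F z"
      by eventually_elim (rule N(3))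
    then show ?thesis by (simp add: AE_completion_iff)
  qed
  let ?S = "slab (1 / (2 * real n)) (real n + 1)" and ?c = "\<lambda>x :: real. max (- real n) (min n x)"
  \<comment> \<open>Equal to 1 on the support of \<open>F\<close>, where the height is at least 1/n
    and the norm at most n; it vanishes outside the larger slab with bounds 1/(2n) and n +
    1.\<close>
  define q where "q z = max 0 (min 1 (2 * n * fst z - 1)) * max 0 (min 1 (n + 1 - norm z))" for z :: "real \<times> 'b"
  have q[continuous_intros]: "continuous_on UNIV q" unfolding q_def by (intro continuous_intros)
  then have [measurable]: "q \<in> borel_measurable borel" by (rule borel_measurable_continuous_onI)
  have q01: "0 \<le> q z" "q z \<le> 1" for z by (auto simp: q_def intro: mult_le_one)
  define G where "G j z = q z * ?c (g j z)" for j z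
  have Gc: "continuous_on UNIV (G j)" for j unfolding G_def by (intro continuous_intros)
  then have [measurable]: "G j \<in> borel_measurable borel" for j by (rule borel_measurable_continuous_onI)
  have qF: "q z * ?c (F z) = F z" for z
  proof (cases "F z = 0")
    case False
    then have *: "norm z \<le> n" "1 / n \<le> fst z" "\<bar>F z\<bar> \<le> n" by (auto simp: F_def split: if_splits)
    then have "1 \<le> fst z * n" using n(1) by (simp add: field_simps)
    then have "q z = 1" using * by (simp add: q_def algebra_simps)
    then show ?thesis using * by (auto simp: max_def min_def)
  qed simp
  have q0: "q z = 0" if "z \<notin> ?S" for z
  proof -
    have "2 * n * fst z - 1 \<le> 0 \<or> n + 1 - norm z \<le> 0"
      using that n(1) by (auto simp: slab_def field_simps)
    then show ?thesis by (auto simp: q_def)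
  qed
  have F_eq: "\<bar>q z * ?c x\<bar> \<le> n" for z and x :: real
  proof -
    have "\<bar>?c x\<bar> \<le> n" by auto
    then show ?thesis using q01[of z] mult_mono[of "q z" 1 "\<bar>?c x\<bar>" n]
      by (auto simp: abs_mult)
  qed
  have bd: "(F z - G j z)\<^sup>2 \<le> (2 * real n)\<^sup>2" for z j
    using F_eq[of z "F z"] F_eq[of z "g j z"] unfolding qF G_def[symmetric]
    by (intro abs_le_square_iff[THEN iffD1]) auto
  have "(\<lambda>j. \<integral>\<^sup>+ z. pow_weight c (fst z) * ennreal ((F z - G j z)\<^sup>2) \<partial>lborel)
    \<longlonglongrightarrow> (\<integral>\<^sup>+ z. 0 \<partial>(lborel :: (real \<times> 'b) measure))"
  proof (rule nn_integral_dominated_convergence)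
    show "(\<integral>\<^sup>+ z. ennreal ((2 * real n)\<^sup>2) * (pow_weight c (fst z) * indicator (?S) z)
        \<partial>(lborel :: (real \<times> 'b) measure)) < \<infinity>"
      using finite_weight_slab[of "1 / (2 * real n)" c "real n + 1", where 'b='b] n(1)
      by (subst nn_integral_cmult) (auto simp: ennreal_mult_less_top)
    show "AE z in lborel. pow_weight c (fst z) * ennreal ((F z - G j z)\<^sup>2)
        \<le> ennreal ((2 * real n)\<^sup>2) * (pow_weight c (fst z) * indicator (?S) z)" for j
    proof (intro AE_I2)
      fix z
      show "pow_weight c (fst z) * ennreal ((F z - G j z)\<^sup>2)
        \<le> ennreal ((2 * real n)\<^sup>2) * (pow_weight c (fst z) * indicator (?S) z)"
      proof (cases "z \<in> ?S")
        case True
        then show ?thesis using ennreal_leI[OF bd[of z j]] by (simp add: mult_left_mono mult.commute)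
      next
        case False
        then show ?thesis using q0[OF False] qF[of z] by (simp add: G_def)
      qed
    qed
    show "AE z in lborel. (\<lambda>j. pow_weight c (fst z) * ennreal ((F z - G j z)\<^sup>2)) \<longlonglongrightarrow> 0"
      using AE
    proof eventually_elim
      fix z assume "(\<lambda>j. g j z) \<longlonglongrightarrow> F z"
      then have "(\<lambda>j. G j z) \<longlonglongrightarrow> F z"
        unfolding G_def by (subst qF[symmetric]) (intro tendsto_intros)
      then have "(\<lambda>j. ennreal ((F z - G j z)\<^sup>2)) \<longlonglongrightarrow> ennreal ((F z - F z)\<^sup>2)"
        by (intro tendsto_intros)
      then have "(\<lambda>j. pow_weight c (fst z) * ennreal ((F z - G j z)\<^sup>2)) \<longlonglongrightarrow> pow_weight c (fst z) * ennreal ((F z - F z)\<^sup>2)"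
        by (intro ennreal_tendsto_cmult) (auto simp: pow_weight_def)
      then show "(\<lambda>j. pow_weight c (fst z) * ennreal ((F z - G j z)\<^sup>2)) \<longlonglongrightarrow> 0" by simp
    qed
  qed measurable
  then have "(\<lambda>j. wnorm_sq c (\<lambda>z. F z - G j z)) \<longlonglongrightarrow> 0"
    unfolding wnorm_sq_def by simp
  then have "\<forall>\<^sub>F j in sequentially. wnorm_sq c (\<lambda>z. F z - G j z) < e / 6"
    using e6 by (rule order_tendstoD)
  then obtain j where j: "wnorm_sq c (\<lambda>z. F z - G j z) < e / 6"
    using eventually_happens' sequentially_bot by blast
  have "wnorm_sq c (\<lambda>z. f z - G j z) \<le> 3 * (wnorm_sq c (\<lambda>z. f z - F z) + wnorm_sq c (\<lambda>z. F z - G j z) + wnorm_sq c (\<lambda>z::real\<times>'b. 0))"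
    using wnorm_sq_add3[of "\<lambda>z. f z - F z" "\<lambda>z. F z - G j z" "\<lambda>z. 0" c] by simp
  also have "\<dots> = 3 * (wnorm_sq c (\<lambda>z. f z - F z) + wnorm_sq c (\<lambda>z. F z - G j z))"
    by (simp add: wnorm_sq_def)
  also have "\<dots> < 3 * (e / 6 + e / 6)"
    using n(2) j unfolding F_def[abs_def, symmetric] F_def[symmetric]
    by (intro ennreal_mult_strict_left_mono add_strict_mono) auto
  also have "\<dots> \<le> e"
  proof (cases e rule: ennreal_cases)
    case (real r)
    then have "e / 6 = ennreal (r / 6)" using divide_ennreal[of r 6] by simp
    then have "3 * (e / 6 + e / 6) = ennreal (3 * (r / 6 + r / 6))"
      using real by (subst ennreal_mult) (auto simp: ennreal_plus[symmetric] simp del: ennreal_plus)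
    then show ?thesis using real by simp
  qed simp
  finally have fin: "wnorm_sq c (\<lambda>z. f z - G j z) < e" .
  have G0: "G j z = 0" if "z \<notin> ?S" for z
    unfolding G_def q0[OF that] by simp
  have "1 / (2 * real n) \<le> 1" using n(1) by (simp add: field_simps)
  then have "1 / (2 * real n) \<le> real n + 1" by simp
  moreover have "0 < 1 / (2 * real n)" using n(1) by simp
  ultimately show ?thesis using that[OF Gc _ _ G0 fin] by blast
qed

section \<open>Averaging along shifts comparable to the distance from the boundary\<close>

lemma nn_integral_lborel_translate:
  fixes F :: "'a::euclidean_space \<Rightarrow> ennreal"
  assumes [measurable]: "F \<in> borel_measurable borel"
  shows "(\<integral>\<^sup>+ z. F (z + a) \<partial>lborel) = (\<integral>\<^sup>+ z. F z \<partial>lborel)"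
proof -
  have "(\<integral>\<^sup>+ z. F z \<partial>lborel) = (\<integral>\<^sup>+ z. F z \<partial>distr lborel borel ((+) a))"
    by (simp add: lborel_distr_plus)
  also have "\<dots> = (\<integral>\<^sup>+ z. F (a + z) \<partial>lborel)"
    by (subst nn_integral_distr) auto
  finally show ?thesis by (simp add: add.commute)
qed

text \<open>Fubini and a translation move the shift from the function onto the weight, so
  boundedness of averaging on L^2(y^c dz) reduces to the inequality \<open>kernel\<close>. It is
  stated at scale 1 only; homogeneity of the power gives every other scale.\<close>

locale averaging =
  fixes P :: "(real \<times> 'b::euclidean_space) measure" and c C :: real
  assumes sets_P [measurable_cong]: "sets P = sets borel"
    and emeasure_P: "emeasure P (space P) = 1"
    and norm_le_3: "AE t in P. norm t \<le> 3"
    and kernel: "\<And>a. 0 < a \<Longrightarrow> (\<integral>\<^sup>+ t. pow_weight c (a - fst t) \<partial>P) \<le> ennreal C * pow_weight c a"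
begin

sublocale finite_measure P
  by (rule finite_measureI) (simp add: emeasure_P)

definition average :: "real \<Rightarrow> (real \<times> 'b \<Rightarrow> real) \<Rightarrow> real \<times> 'b \<Rightarrow> real" where
  "average e f z = (\<integral>t. f (z + e *\<^sub>R t) \<partial>P)"

text \<open>A nonnegative integral dominating the squared error of \<open>average\<close>. Unlike
  the Bochner average, which is not additive on functions that fail to be integrable, it can be
  split freely.\<close>

definition oscillation :: "real \<Rightarrow> (real \<times> 'b \<Rightarrow> real) \<Rightarrow> ennreal" where
  "oscillation e f = (\<integral>\<^sup>+ z. pow_weight c (fst z) * (\<integral>\<^sup>+ t. ennreal ((f (z + e *\<^sub>R t) - f z)\<^sup>2) \<partial>P) \<partial>lborel)"

lemma shift_measurable [measurable]:
  assumes [measurable]: "f \<in> borel_measurable borel"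
  shows "(\<lambda>p :: (real \<times> 'b) \<times> (real \<times> 'b). f (fst p + e *\<^sub>R snd p) :: 'z::topological_space) \<in> borel_measurable (lborel \<Otimes>\<^sub>M P)"
proof -
  have "(\<lambda>p :: (real \<times> 'b) \<times> (real \<times> 'b). fst p + e *\<^sub>R snd p) \<in> borel_measurable (borel \<Otimes>\<^sub>M borel)"
    by measurable
  moreover have "sets (lborel \<Otimes>\<^sub>M P) = sets (borel \<Otimes>\<^sub>M (borel :: (real \<times> 'b) measure))"
    by (intro sets_pair_measure_cong) (simp_all add: sets_P)
  ultimately have "(\<lambda>p :: (real \<times> 'b) \<times> (real \<times> 'b). fst p + e *\<^sub>R snd p) \<in> borel_measurable (lborel \<Otimes>\<^sub>M P)"
    by (simp cong: measurable_cong_sets)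
  then show ?thesis by (rule measurable_compose) (rule assms)
qed

text \<open>Substituting \<open>z - e *\<^sub>R t\<close> for \<open>z\<close> leaves
  \<open>f\<close> unshifted and averages the weight over \<open>t\<close>. The vanishing of
  \<open>f\<close> for \<open>fst z \<le> 0\<close> confines the use of \<open>kernel\<close> to
  positive heights.\<close>

lemma wnorm_sq_shift_le:
  assumes [measurable]: "f \<in> borel_measurable borel" and f0: "\<And>z. fst z \<le> 0 \<Longrightarrow> f z = 0" and "0 < e"
  shows "(\<integral>\<^sup>+ z. pow_weight c (fst z) * (\<integral>\<^sup>+ t. ennreal ((f (z + e *\<^sub>R t))\<^sup>2) \<partial>P) \<partial>lborel)
    \<le> ennreal C * wnorm_sq c f"
proof -
  let ?s = "\<lambda>z t. ennreal ((f (z + e *\<^sub>R t))\<^sup>2)" and ?W = "\<lambda>z t. pow_weight c (fst (z - e *\<^sub>R t))"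
  interpret pair_sigma_finite lborel P ..
  have [measurable]: "(\<lambda>p. pow_weight c (fst (fst p)) * ennreal ((f (fst p + e *\<^sub>R snd p))\<^sup>2)) \<in> borel_measurable (lborel \<Otimes>\<^sub>M P)"
    using shift_measurable[of f e] measurable_compose[OF measurable_fst, of "\<lambda>z. pow_weight c (fst z)" lborel borel P]
    by measurable
  have [measurable]: "(\<lambda>t. f (z + e *\<^sub>R t)) \<in> borel_measurable P" for z
    by (rule measurable_compose[OF _ assms(1)]) measurable
  have [measurable]: "(\<lambda>p. pow_weight c (fst (fst p - e *\<^sub>R snd p)) * ennreal ((f (fst p))\<^sup>2)) \<in> borel_measurable (lborel \<Otimes>\<^sub>M P)"
    using shift_measurable[OF pow_weight_fst_measurable, of c "- e"] measurable_compose[OF measurable_fst, of f lborel borel P]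
    by simp
  have "(\<integral>\<^sup>+ z. pow_weight c (fst z) * (\<integral>\<^sup>+ t. ?s z t \<partial>P) \<partial>lborel)
      = (\<integral>\<^sup>+ z. (\<integral>\<^sup>+ t. pow_weight c (fst z) * ?s z t \<partial>P) \<partial>lborel)"
    by (simp add: nn_integral_cmult)
  also have "\<dots> = (\<integral>\<^sup>+ t. (\<integral>\<^sup>+ z. pow_weight c (fst z) * ?s z t \<partial>lborel) \<partial>P)"
    by (rule Fubini'[symmetric]) (simp add: split_beta')
  also have "\<dots> = (\<integral>\<^sup>+ t. (\<integral>\<^sup>+ z. ?W z t * ennreal ((f z)\<^sup>2) \<partial>lborel) \<partial>P)"
  proof (rule nn_integral_cong)
    fix t
    have "(\<lambda>z. ?W z t * ennreal ((f z)\<^sup>2)) \<in> borel_measurable borel"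
      using measurable_compose[OF _ pow_weight_fst_measurable[of c], of "\<lambda>z. z - e *\<^sub>R t" borel] by measurable
    from nn_integral_lborel_translate[OF this, of "e *\<^sub>R t"]
    show "(\<integral>\<^sup>+ z. pow_weight c (fst z) * ?s z t \<partial>lborel)
      = (\<integral>\<^sup>+ z. ?W z t * ennreal ((f z)\<^sup>2) \<partial>lborel)"
      by simp
  qed
  also have "\<dots> = (\<integral>\<^sup>+ z. (\<integral>\<^sup>+ t. ?W z t * ennreal ((f z)\<^sup>2) \<partial>P) \<partial>lborel)"
    by (rule Fubini') (simp add: split_beta')
  also have "\<dots> \<le> (\<integral>\<^sup>+ z. ennreal C * (pow_weight c (fst z) * ennreal ((f z)\<^sup>2)) \<partial>lborel)"
  proof (rule nn_integral_mono)
    fix z :: "real \<times> 'b"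
    show "(\<integral>\<^sup>+ t. ?W z t * ennreal ((f z)\<^sup>2) \<partial>P)
      \<le> ennreal C * (pow_weight c (fst z) * ennreal ((f z)\<^sup>2))"
    proof (cases "0 < fst z")
      case True
      have fstm: "(\<lambda>t. pow_weight c (a - fst t)) \<in> borel_measurable P" for a
        using measurable_compose[of "\<lambda>t. a - fst t" P borel "pow_weight c" borel] fst_borel_measurable
        by (simp cong: measurable_cong_sets add: sets_P)
      \<comment> \<open>The height y - e t_y equals e (y/e - t_y); the factor
        \<open>e powr c\<close> comes out here and is absorbed again after \<open>kernel\<close> has
        been applied at height y/e.\<close>
      have "(\<integral>\<^sup>+ t. ?W z t \<partial>P)
          = (\<integral>\<^sup>+ t. ennreal (e powr c) * pow_weight c (fst z / e - fst t) \<partial>P)"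
        using \<open>0 < e\<close> by (simp add: pow_weight_mult[symmetric] right_diff_distrib)
      also have "\<dots> = ennreal (e powr c) * (\<integral>\<^sup>+ t. pow_weight c (fst z / e - fst t) \<partial>P)"
        by (rule nn_integral_cmult) (rule fstm)
      also have "\<dots> \<le> ennreal (e powr c) * (ennreal C * pow_weight c (fst z / e))"
        using True \<open>0 < e\<close> by (intro mult_left_mono kernel) auto
      also have "\<dots> = ennreal C * pow_weight c (e * (fst z / e))"
        using \<open>0 < e\<close> by (simp only: pow_weight_mult mult.left_commute)
      finally have *: "(\<integral>\<^sup>+ t. ?W z t \<partial>P) \<le> ennreal C * pow_weight c (fst z)"
        using \<open>0 < e\<close> by simp
      have "(\<integral>\<^sup>+ t. ?W z t * ennreal ((f z)\<^sup>2) \<partial>P)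
          = (\<integral>\<^sup>+ t. ?W z t \<partial>P) * ennreal ((f z)\<^sup>2)"
        using measurable_compose[of "\<lambda>t. fst z - e * fst t" P borel "pow_weight c" borel] fst_borel_measurable
        by (intro nn_integral_multc) (simp cong: measurable_cong_sets add: sets_P)
      also have "\<dots> \<le> (ennreal C * pow_weight c (fst z)) * ennreal ((f z)\<^sup>2)"
        using * by (rule mult_right_mono) simp
      finally show ?thesis by (simp add: mult.assoc)
    qed (simp add: f0)
  qed
  also have "\<dots> = ennreal C * wnorm_sq c f"
    unfolding wnorm_sq_def by (rule nn_integral_cmult) simp
  finally show ?thesis .
qed

text \<open>Jensen's inequality at each point \<open>z\<close>.\<close>

lemma average_diff_le_oscillation:
  assumes [measurable]: "f \<in> borel_measurable borel"
  shows "wnorm_sq c (\<lambda>z. average e f z - f z) \<le> oscillation e f"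
proof -
  let ?s = "\<lambda>z t. ennreal ((f (z + e *\<^sub>R t) - f z)\<^sup>2)"
  have [measurable]: "(\<lambda>t. f (z + e *\<^sub>R t)) \<in> borel_measurable P" for z
    by (rule measurable_compose[OF _ assms(1)]) measurable
  have P: "measure P (space P) = 1" using emeasure_P by (simp add: measure_def)
  have "ennreal ((average e f z - f z)\<^sup>2) \<le> (\<integral>\<^sup>+ t. ?s z t \<partial>P)" for z
  proof (cases "integrable P (\<lambda>t. f (z + e *\<^sub>R t))")
    case True
    then have "average e f z - f z = (\<integral>t. f (z + e *\<^sub>R t) - f z \<partial>P)"
      by (simp add: average_def P)
    then show ?thesis using square_integral_le[OF emeasure_P, of "\<lambda>t. f (z + e *\<^sub>R t) - f z"] by simp
  next
    \<comment> \<open>Now the average has its default value, but the right side is infinite: a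
      finite mean square of the increments would make them integrable, and the constant
      \<open>f z\<close> is integrable too.\<close>
    case False
    have "(\<integral>\<^sup>+ t. ?s z t \<partial>P) = \<infinity>"
    proof (rule ccontr)
      assume "\<not> ?thesis"
      then have "integrable P (\<lambda>t. (f (z + e *\<^sub>R t) - f z)\<^sup>2)"
        by (intro integrableI_bounded) (auto simp: less_top)
      then have i: "integrable P (\<lambda>t. 1 + (f (z + e *\<^sub>R t) - f z)\<^sup>2)" by simp
      have "integrable P (\<lambda>t. f (z + e *\<^sub>R t) - f z)"
      proof (rule Bochner_Integration.integrable_bound[OF i])
        show "AE t in P. norm (f (z + e *\<^sub>R t) - f z) \<le> norm (1 + (f (z + e *\<^sub>R t) - f z)\<^sup>2)"
          using abs_le_one_plus_square by (auto intro: order.trans)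
      qed simp
      then have "integrable P (\<lambda>t. (f (z + e *\<^sub>R t) - f z) + f z)" by (intro Bochner_Integration.integrable_add) simp_all
      with False show False by simp
    qed
    then show ?thesis by simp
  qed
  then show ?thesis
    unfolding wnorm_sq_def oscillation_def by (intro nn_integral_mono mult_left_mono) auto
qed

text \<open>By uniform continuity the increments are small, and for small \<open>e\<close> they
  vanish outside a slightly larger slab, which has finite weighted mass.\<close>

lemma oscillation_continuous_tendsto:
  assumes g: "continuous_on UNIV g" and a: "0 < a" "\<And>z. z \<notin> slab a b \<Longrightarrow> g z = 0"
  shows "((\<lambda>e. oscillation e g) \<longlongrightarrow> 0) (at_right 0)"
proof -
  let ?S = "slab (a / 2) (b + 1) :: (real \<times> 'b) set"
  let ?O = "\<lambda>e z. \<integral>\<^sup>+ t. ennreal ((g (z + e *\<^sub>R t) - g z)\<^sup>2) \<partial>P"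
  define I where "I = (\<integral>\<^sup>+ z. pow_weight c (fst z) * indicator (?S) z \<partial>(lborel :: (real \<times> 'b) measure))"
  have I: "I < \<infinity>" unfolding I_def using a(1) by (intro finite_weight_slab) simp
  have le: "\<forall>\<^sub>F e in at_right 0. oscillation e g \<le> I * ennreal (d\<^sup>2)" if "0 < d" for d
  proof -
    obtain r where r: "0 < r" "\<And>x y. dist x y < r \<Longrightarrow> dist (g x) (g y) < d"
      using uniformly_continuous_compact_support[OF g compact_slab a(2) \<open>0 < d\<close>] by blast
    \<comment> \<open>Since \<open>norm t \<le> 3\<close>, the shift has norm at most 3e; the three
      bounds make it smaller than \<open>r\<close>, at most a/2 and at most 1.\<close>
    define e0 where "e0 = min (r / 4) (min (a / 6) (1 / 3))"
    have "0 < e0" using r(1) a(1) by (simp add: e0_def)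
    have "oscillation e g \<le> I * ennreal (d\<^sup>2)" if e: "0 < e" "e < e0" for e
    proof -
      have inner: "?O e z \<le> ennreal (d\<^sup>2) * indicator (?S) z" for z
      proof -
        have "?O e z \<le> (\<integral>\<^sup>+ t. ennreal (d\<^sup>2) * indicator (?S) z \<partial>P)"
        proof (rule nn_integral_mono_AE, use norm_le_3 in eventually_elim)
          fix t :: "real \<times> 'b" assume t: "norm t \<le> 3"
          have e3: "4 * e < r" "6 * e < a" "3 * e < 1" using e(2) by (auto simp: e0_def)
          have nt: "norm (e *\<^sub>R t) \<le> 3 * e" using t e(1) by (simp add: mult.commute)
          have nt': "norm (e *\<^sub>R t) < r" "norm (e *\<^sub>R t) \<le> a / 2" "norm (e *\<^sub>R t) \<le> 1"
            using nt e3 e(1) by linarith+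
          show "ennreal ((g (z + e *\<^sub>R t) - g z)\<^sup>2) \<le> ennreal (d\<^sup>2) * indicator (?S) z"
          proof (cases "z \<in> ?S")
            case True
            have "\<bar>g (z + e *\<^sub>R t) - g z\<bar> \<le> \<bar>d\<bar>"
              using r(2)[of "z + e *\<^sub>R t" z] nt' \<open>0 < d\<close> by (simp add: dist_norm)
            then have "(g (z + e *\<^sub>R t) - g z)\<^sup>2 \<le> d\<^sup>2" by (simp only: abs_le_square_iff)
            then show ?thesis using True by (simp add: ennreal_leI)
          next
            case False
            have "\<bar>fst (e *\<^sub>R t)\<bar> \<le> a / 2"
              using norm_fst_le[of "fst (e *\<^sub>R t)" "snd (e *\<^sub>R t)"] nt'(2)
              unfolding prod.collapse real_norm_def by linarith
            moreover have "norm z \<le> norm (z + e *\<^sub>R t) + norm (e *\<^sub>R t)"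
              using norm_triangle_ineq4[of "z + e *\<^sub>R t" "e *\<^sub>R t"] by simp
            ultimately have "z \<notin> slab a b" "z + e *\<^sub>R t \<notin> slab a b"
              using False nt' a(1) by (auto simp: slab_def)
            then show ?thesis by (simp add: a(2))
          qed
        qed
        also have "\<dots> = ennreal (d\<^sup>2) * indicator (?S) z"
          by (simp add: emeasure_P)
        finally show ?thesis .
      qed
      have "oscillation e g \<le> (\<integral>\<^sup>+ z. ennreal (d\<^sup>2) * (pow_weight c (fst z) * indicator (?S) z) \<partial>(lborel :: (real \<times> 'b) measure))"
        unfolding oscillation_def
      proof (rule nn_integral_mono)
        fix z
        show "pow_weight c (fst z) * ?O e z
          \<le> ennreal (d\<^sup>2) * (pow_weight c (fst z) * indicator (?S) z)"
          using mult_left_mono[OF inner[of z], of "pow_weight c (fst z)"] by (simp add: mult.left_commute)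
      qed
      also have "\<dots> = I * ennreal (d\<^sup>2)" unfolding I_def by (subst mult.commute) (rule nn_integral_cmult, simp)
      finally show ?thesis .
    qed
    then show ?thesis using \<open>0 < e0\<close> unfolding eventually_at_right_field by (intro exI[of _ e0]) auto
  qed
  show ?thesis
  proof (rule order_tendstoI)
    fix y :: ennreal assume "0 < y"
    have "((\<lambda>d. I * ennreal (d\<^sup>2)) \<longlongrightarrow> I * ennreal (0\<^sup>2)) (at_right 0)"
      using I by (intro ennreal_tendsto_cmult tendsto_intros) auto
    then have "\<forall>\<^sub>F d in at_right 0. I * ennreal (d\<^sup>2) < y"
      using \<open>0 < y\<close> by (intro order_tendstoD(2)) auto
    moreover have "\<forall>\<^sub>F d in at_right (0::real). 0 < d" by (simp add: eventually_at_right_less)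
    ultimately have "\<forall>\<^sub>F d in at_right 0. 0 < d \<and> I * ennreal (d\<^sup>2) < y" by eventually_elim simp
    from eventually_happens'[OF trivial_limit_at_right_real this]
    obtain d where d: "0 < d" "I * ennreal (d\<^sup>2) < y" by blast
    show "\<forall>\<^sub>F e in at_right 0. oscillation e g < y"
      using le[OF d(1)] by eventually_elim (use d(2) in auto)
  qed simp
qed

text \<open>With \<open>g\<close> continuous and close to \<open>f\<close>, and h = f - g, the
  increment of \<open>f\<close> is h(z + et), plus the increment of \<open>g\<close>, minus h(z).
  The first part is bounded through \<open>wnorm_sq_shift_le\<close>, the second tends to 0, the
  third is small by the choice of \<open>g\<close>.\<close>

lemma average_tendsto:
  assumes [measurable]: "f \<in> borel_measurable borel" and f0: "\<And>z. fst z \<le> 0 \<Longrightarrow> f z = 0"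
    and f: "wnorm_sq c f < \<infinity>"
  shows "((\<lambda>e. wnorm_sq c (\<lambda>z. average e f z - f z)) \<longlongrightarrow> 0) (at_right 0)"
proof (rule order_tendstoI)
  fix y :: ennreal assume "0 < y"
  \<comment> \<open>A value strictly between 0 and \<open>y\<close> is a finite positive real and
    leaves room for the strict inequality at the end.\<close>
  obtain x where x: "0 < x" "x < y" using dense[OF \<open>0 < y\<close>] by blast
  then obtain r where r: "x = ennreal r" "0 < r"
    by (cases x rule: ennreal_cases) auto
  \<comment> \<open>Solves 3 (C q + q + q) = r, with \<open>max 0 C\<close> because
    \<open>ennreal C\<close> is 0 for negative \<open>C\<close>.\<close>
  define q where "q = ennreal (r / (3 * (max 0 C + 2)))"
  have y': "0 < q" using r(2) by (simp add: q_def add_nonneg_pos)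
  from wnorm_sq_dense[OF assms(1) f y']
  obtain g a b where g: "continuous_on UNIV g" "0 < a" "a \<le> b" "\<And>z. z \<notin> slab a b \<Longrightarrow> g z = 0"
    "wnorm_sq c (\<lambda>z. f z - g z) < q" by metis
  note [measurable] = borel_measurable_continuous_onI[OF g(1)]
  have "\<forall>\<^sub>F e in at_right 0. oscillation e g < q"
    using oscillation_continuous_tendsto[OF g(1,2,4)] y' by (rule order_tendstoD)
  moreover have "\<forall>\<^sub>F e in at_right (0::real). 0 < e" by (simp add: eventually_at_right_less)
  ultimately show "\<forall>\<^sub>F e in at_right 0. wnorm_sq c (\<lambda>z. average e f z - f z) < y"
  proof eventually_elim
    fix e :: real assume e: "oscillation e g < q" "0 < e"
    have [measurable]: "(\<lambda>t. h (z + e *\<^sub>R t)) \<in> borel_measurable P"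
      if "h \<in> borel_measurable borel" for z and h :: "real \<times> 'b \<Rightarrow> real"
      by (rule measurable_compose[OF _ that]) measurable
    let ?h = "\<lambda>z. f z - g z"
    have inner_m: "(\<lambda>z. \<integral>\<^sup>+ t. ennreal ((h (z + e *\<^sub>R t) - k z)\<^sup>2) \<partial>P) \<in> borel_measurable lborel"
      if [measurable]: "h \<in> borel_measurable borel" "k \<in> borel_measurable borel" for h k
    proof -
      have "(\<lambda>p. ennreal ((h (fst p + e *\<^sub>R snd p) - k (fst p))\<^sup>2)) \<in> borel_measurable (lborel \<Otimes>\<^sub>M P)"
        using shift_measurable[OF that(1), of e] measurable_compose[OF measurable_fst, of k lborel borel P] by measurable
      then show ?thesis by (intro borel_measurable_nn_integral) (simp add: split_beta')
    qed
    have h0: "?h z = 0" if "fst z \<le> 0" for z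
      using f0[OF that] g(2) g(4)[of z] that by (auto simp: slab_def)
    let ?O = "\<lambda>f z. \<integral>\<^sup>+ t. ennreal ((f (z + e *\<^sub>R t) - f z)\<^sup>2) \<partial>P"
    let ?H = "\<lambda>z t. ennreal ((?h (z + e *\<^sub>R t))\<^sup>2)"
    define X where "X z = pow_weight c (fst z) * (\<integral>\<^sup>+ t. ?H z t \<partial>P)" for z
    define Y where "Y z = pow_weight c (fst z) * ?O g z" for z
    define Z where "Z z = pow_weight c (fst z) * ennreal ((?h z)\<^sup>2)" for z
    have [measurable]: "X \<in> borel_measurable lborel" "Y \<in> borel_measurable lborel" "Z \<in> borel_measurable lborel"
      unfolding X_def Y_def Z_def using inner_m[of ?h "\<lambda>_. 0"] inner_m[of g g]
      by (auto intro!: borel_measurable_times_ennreal)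
    have "oscillation e f \<le> (\<integral>\<^sup>+ z. 3 * (X z + Y z + Z z) \<partial>lborel)"
      unfolding oscillation_def
    proof (rule nn_integral_mono)
      fix z
      have "?O f z \<le> (\<integral>\<^sup>+ t. 3 * (?H z t
          + ennreal ((g (z + e *\<^sub>R t) - g z)\<^sup>2) + ennreal ((?h z)\<^sup>2)) \<partial>P)"
      proof (rule nn_integral_mono)
        fix t
        show "ennreal ((f (z + e *\<^sub>R t) - f z)\<^sup>2) \<le> 3 * (?H z t
          + ennreal ((g (z + e *\<^sub>R t) - g z)\<^sup>2) + ennreal ((?h z)\<^sup>2))"
          using ennreal_square_add3[of "?h (z + e *\<^sub>R t)" "g (z + e *\<^sub>R t) - g z" "- ?h z"]
          by (simp add: power2_commute)
      qed
      also have "\<dots> = 3 * ((\<integral>\<^sup>+ t. ?H z t \<partial>P)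
          + ?O g z + ennreal ((?h z)\<^sup>2))"
        by (subst nn_integral_cmult, measurable, subst nn_integral_add, measurable, subst nn_integral_add, measurable)
          (simp add: emeasure_P)
      finally have "pow_weight c (fst z) * ?O f z \<le> pow_weight c (fst z) * \<dots>"
        by (rule mult_left_mono) simp
      also have "\<dots> = 3 * (X z + Y z + Z z)"
        unfolding X_def Y_def Z_def by (simp only: mult.left_commute[of "pow_weight c (fst z)" 3] distrib_left[of "pow_weight c (fst z)"])
      finally show "pow_weight c (fst z) * ?O f z \<le> 3 * (X z + Y z + Z z)" .
    qed
    also have "\<dots> = 3 * ((\<integral>\<^sup>+ z. X z \<partial>lborel) + (\<integral>\<^sup>+ z. Y z \<partial>lborel) + (\<integral>\<^sup>+ z. Z z \<partial>lborel))"
      by (subst nn_integral_cmult, measurable, subst nn_integral_add, measurable, subst nn_integral_add, measurable)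
    also have "\<dots> = 3 * ((\<integral>\<^sup>+ z. X z \<partial>lborel) + oscillation e g + wnorm_sq c ?h)"
      unfolding oscillation_def wnorm_sq_def Y_def Z_def ..
    also have "\<dots> \<le> 3 * (ennreal C * wnorm_sq c ?h + oscillation e g + wnorm_sq c ?h)"
      unfolding X_def using wnorm_sq_shift_le[of ?h e] h0 e(2)
      by (intro mult_left_mono add_right_mono) auto
    also have "\<dots> \<le> 3 * (ennreal C * q + q + q)"
      using g(5) e(1) by (intro mult_left_mono add_mono) auto
    also have "\<dots> = ennreal r"
    proof -
      define s where "s = r / (3 * (max 0 C + 2))"
      have s: "0 \<le> s" using r(2) by (simp add: s_def add_nonneg_nonneg)
      have qs: "q = ennreal s" by (simp only: q_def s_def)
      define m where "m = max 0 C"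
      have m: "0 \<le> m" and C: "ennreal C = ennreal m" by (simp_all add: m_def max_def ennreal_neg)
      have "ennreal (3 * (m * s + s + s)) = ennreal 3 * (ennreal m * ennreal s + ennreal s + ennreal s)"
        using s m by (simp only: ennreal_mult ennreal_plus add_nonneg_nonneg mult_nonneg_nonneg zero_le_numeral)
      then have "3 * (ennreal C * q + q + q) = ennreal (3 * (m * s + s + s))"
        by (simp only: qs C ennreal_numeral)
      also have "3 * (m * s + s + s) = r"
      proof -
        have "3 * (m * s + s + s) = (3 * (m + 2)) * s" by (simp add: algebra_simps)
        also have "\<dots> = r" using m unfolding s_def m_def[symmetric] by simp
        finally show ?thesis .
      qed
      finally show ?thesis .
    qed
    finally have "oscillation e f \<le> x" by (simp add: r(1))
    with average_diff_le_oscillation[of f e] x(2)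
    show "wnorm_sq c (\<lambda>z. average e f z - f z) < y" by (auto intro: order.strict_trans1)
  qed
qed simp

end

section \<open>Mollifiers\<close>

lemma bump_nonneg: "0 \<le> bump s a w"
  by (simp add: bump_def flat_poly_def)

lemma bump_le_1: "bump s a w \<le> 1"
  by (simp add: bump_def flat_poly_def)

lemma bump_eq_0_iff: "bump s a w = 0 \<longleftrightarrow> 1 / 2 \<le> norm (s *\<^sub>R w - a)"
proof -
  have "bump s a w = 0 \<longleftrightarrow> (1 / 2)\<^sup>2 \<le> (norm (s *\<^sub>R w - a))\<^sup>2"
    by (simp add: bump_def flat_poly_def power2_eq_square)
  also have "\<dots> \<longleftrightarrow> 1 / 2 \<le> norm (s *\<^sub>R w - a)"
    using abs_le_square_iff[of "1 / 2" "norm (s *\<^sub>R w - a)"] by simp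
  finally show ?thesis .
qed

lemma bump_measurable [measurable]: "bump s a \<in> borel_measurable borel"
  by (intro smooth_measurable smooth_bump)

lemma integrable_bump: "integrable lborel (bump 1 a)"
proof (rule Bochner_Integration.integrable_bound)
  show "integrable lborel (indicator (cball a (1 / 2)) :: _ \<Rightarrow> real)"
    using emeasure_compact_finite[OF compact_cball] by (simp add: integrable_indicator_iff less_top)
  show "AE x in lborel. norm (bump 1 a x) \<le> norm (indicator (cball a (1 / 2)) x :: real)"
  proof (rule AE_I2)
    fix x
    show "norm (bump 1 a x) \<le> norm (indicator (cball a (1 / 2)) x :: real)"
      using bump_eq_0_iff[of 1 a x] bump_nonneg[of 1 a x] bump_le_1[of 1 a x]
      by (cases "x \<in> cball a (1 / 2)") (auto simp: dist_norm norm_minus_commute)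
  qed
qed simp

definition bump_mass :: "'a::euclidean_space \<Rightarrow> real" where
  "bump_mass a = (\<integral>t. bump 1 a t \<partial>lborel)"

lemma bump_mass_pos: "0 < bump_mass a"
proof -
  have "bump_mass a \<noteq> 0"
  proof
    assume "bump_mass a = 0"
    then have "AE t in lborel. bump 1 a t = 0"
      unfolding bump_mass_def using integral_nonneg_eq_0_iff_AE[OF integrable_bump[of a]] by (simp add: bump_nonneg)
    then have "AE t in lborel. t \<notin> ball a (1 / 2)"
      by eventually_elim (auto simp: bump_eq_0_iff dist_norm norm_minus_commute)
    then have "emeasure lborel (ball a (1 / 2)) = 0"
      by (subst (asm) AE_iff_measurable[of "ball a (1 / 2)"]) auto
    then have "measure lborel (ball a (1 / 2)) = 0" by (simp add: measure_def)
    with content_ball_pos[of "1 / 2" a] show False by simp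
  qed
  moreover have "0 \<le> bump_mass a" unfolding bump_mass_def by (simp add: bump_nonneg)
  ultimately show ?thesis by simp
qed

text \<open>A probability measure on the ball of radius 1/2 around \<open>a\<close>. The direction
  of the shift is encoded in the centre: height 3/2 gives heights in [1, 2], height -3/2 gives
  heights in [-2, -1].\<close>

definition mollifier :: "'a::euclidean_space \<Rightarrow> 'a measure" where
  "mollifier a = density lborel (\<lambda>t. ennreal (bump 1 a t / bump_mass a))"

lemma sets_mollifier [measurable_cong]: "sets (mollifier a) = sets borel"
  by (simp add: mollifier_def)

lemma emeasure_mollifier: "emeasure (mollifier a) (space (mollifier a)) = 1"
proof -
  have "(\<integral>\<^sup>+ t. ennreal (bump 1 a t / bump_mass a) \<partial>lborel) = ennreal (\<integral>t. bump 1 a t / bump_mass a \<partial>lborel)"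
    using integrable_bump[of a] bump_mass_pos[of a]
    by (intro nn_integral_eq_integral) (auto simp: bump_nonneg)
  also have "\<dots> = 1" using bump_mass_pos[of a] by (simp add: bump_mass_def[symmetric])
  finally show ?thesis
    by (simp add: mollifier_def emeasure_density cong: nn_integral_cong)
qed

lemma AE_mollifier: "AE t in mollifier a. norm (t - a) \<le> 1 / 2"
proof -
  have "norm (t - a) \<le> 1 / 2" if "0 < bump 1 a t / bump_mass a" for t
    using bump_eq_0_iff[of 1 a t] that by (cases "norm (t - a) \<le> 1 / 2") auto
  then show ?thesis unfolding mollifier_def by (subst AE_density) auto
qed

lemma AE_mollifier_norm:
  assumes "norm a + 1 / 2 \<le> r"
  shows "AE t in mollifier a. norm t \<le> r"
  using AE_mollifier[of a]
proof eventually_elim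
  fix t assume "norm (t - a) \<le> 1 / 2"
  moreover have "norm t \<le> norm (t - a) + norm a" using norm_triangle_ineq[of "t - a" a] by simp
  ultimately show "norm t \<le> r" using assms by simp
qed

lemma abs_fst_le_norm: "\<bar>fst z\<bar> \<le> norm z" for z :: "real \<times> 'b::real_normed_vector"
  using norm_fst_le[of "fst z" "snd z"] by simp

lemma cball_sets_borel [measurable]: "cball (a :: 'a::euclidean_space) r \<in> sets borel"
  by simp

lemma finite_pow_weight_near_0:
  assumes "-1 < c"
  shows "(\<integral>\<^sup>+ s. pow_weight c s * indicator {..b} s \<partial>lborel) < \<infinity>"
proof -
  have "((\<lambda>s. s powr c) has_integral (max 0 b powr (c + 1) / (c + 1))) {0..max 0 b}"
    using assms by (intro has_integral_powr_from_0) auto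
  then have "(\<integral>\<^sup>+ s. ennreal (s powr c) * indicator {0..max 0 b} s \<partial>lborel) = ennreal (max 0 b powr (c + 1) / (c + 1))"
    by (intro nn_integral_has_integral_lebesgue') auto
  moreover have "(\<integral>\<^sup>+ s. pow_weight c s * indicator {..b} s \<partial>lborel) \<le> (\<integral>\<^sup>+ s. ennreal (s powr c) * indicator {0..max 0 b} s \<partial>lborel)"
    by (intro nn_integral_mono) (auto simp: pow_weight_def split: split_indicator)
  ultimately show ?thesis by (auto simp: order.strict_trans1 less_top[symmetric] top_unique)
qed

text \<open>On the support \<open>a - fst t\<close> is at least \<open>a\<close>, and the power is
  nonincreasing.\<close>

lemma averaging_mollifier_down:
  assumes "c \<le> 0"
  shows "averaging (mollifier (- (3 / 2), 0) :: (real \<times> 'b::euclidean_space) measure) c 1"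
proof
  let ?a = "(- (3 / 2), 0) :: real \<times> 'b"
  show "AE t in mollifier ?a. norm t \<le> 3"
    by (rule AE_mollifier_norm) (simp add: norm_Pair)
  fix a :: real assume "0 < a"
  have "(\<integral>\<^sup>+ t. pow_weight c (a - fst t) \<partial>mollifier ?a) \<le> (\<integral>\<^sup>+ t. pow_weight c a \<partial>mollifier ?a)"
  proof (rule nn_integral_mono_AE, use AE_mollifier[of ?a] in eventually_elim)
    fix t :: "real \<times> 'b" assume "norm (t - ?a) \<le> 1 / 2"
    then have "\<bar>fst t + 3 / 2\<bar> \<le> 1 / 2" using abs_fst_le_norm[of "t - ?a"] by simp
    then have "a \<le> a - fst t" by linarith
    then show "pow_weight c (a - fst t) \<le> pow_weight c a"
      using \<open>0 < a\<close> assms by (simp add: pow_weight_def ennreal_leI powr_mono2')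
  qed
  then show "(\<integral>\<^sup>+ t. pow_weight c (a - fst t) \<partial>mollifier ?a) \<le> ennreal 1 * pow_weight c a"
    by (simp add: emeasure_mollifier)
qed (simp_all add: sets_mollifier emeasure_mollifier)

text \<open>Three ranges of the height \<open>a\<close>. For \<open>a \<le> 1\<close> all shifted
  heights are nonpositive and the weight is 0. For \<open>1 < a < 4\<close> they may approach 0,
  where only the average is bounded, by integrability of the power. For \<open>4 \<le> a\<close>
  they lie in [a/2, a], where the power is comparable with \<open>a powr c\<close>.\<close>

lemma averaging_mollifier_up:
  assumes "-1 < c"
  obtains C where "averaging (mollifier (3 / 2, 0) :: (real \<times> 'b::euclidean_space) measure) c C"
proof -
  let ?a = "(3 / 2, 0) :: real \<times> 'b"
  let ?I = "\<lambda>a. \<integral>\<^sup>+ t. pow_weight c (a - fst t) \<partial>mollifier ?a"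
  \<comment> \<open>After the substitution of a - s for s, the indicator of {a - 6..} becomes that
    of {..6}, so the resulting bound \<open>J\<close> does not depend on \<open>a\<close>.\<close>
  let ?F = "\<lambda>a t. (pow_weight c (a - fst t) * indicator {a - 6..} (fst t)) * indicator (cball 0 2) (snd t :: 'b)"
  define V where "V = emeasure lborel (cball (0 :: 'b) 2)"
  define J where "J = ennreal (1 / bump_mass ?a) * ((\<integral>\<^sup>+ s. pow_weight c s * indicator {..6} s \<partial>lborel) * V)"
  have "J < \<infinity>"
    using finite_pow_weight_near_0[OF assms, of 6] emeasure_compact_finite[OF compact_cball, of "0::'b" 2]
    by (auto simp: J_def V_def ennreal_mult_less_top)
  then obtain j where j: "J = ennreal j" "0 \<le> j" by (cases J rule: ennreal_cases) auto
  \<comment> \<open>A lower bound for \<open>a powr c\<close> on (1, 4): the value 1 serves for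
    nonnegative \<open>c\<close>, the value at 4 for negative \<open>c\<close>.\<close>
  define m where "m = min 1 (4 powr c)"
  have m: "0 < m" by (simp add: m_def)
  define C where "C = max (max 1 (2 powr (- c))) (j / m)"
  have supp: "1 \<le> fst t" "fst t \<le> 2" "norm (snd t) \<le> 2" if "norm (t - ?a) \<le> 1 / 2" for t :: "real \<times> 'b"
  proof -
    have "\<bar>fst t - 3 / 2\<bar> \<le> 1 / 2" using that abs_fst_le_norm[of "t - ?a"] by simp
    then show "1 \<le> fst t" "fst t \<le> 2" by linarith+
    show "norm (snd t) \<le> 2" using that norm_snd_le[of "snd t" "fst (t - ?a)"] by (simp add: minus_prod_def)
  qed
  show ?thesis
  proof (rule that[of C], unfold_locales)
    show "AE t in mollifier ?a. norm t \<le> 3"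
      by (rule AE_mollifier_norm) (simp add: norm_Pair)
    fix a :: real assume "0 < a"
    consider "a \<le> 1" | "1 < a" "a < 4" | "4 \<le> a" by linarith
    then show "?I a \<le> ennreal C * pow_weight c a"
    proof cases
      case 1
      have "?I a \<le> (\<integral>\<^sup>+ t. 0 \<partial>mollifier ?a)"
        by (rule nn_integral_mono_AE, use AE_mollifier[of ?a] in eventually_elim)
          (use 1 supp(1) in \<open>fastforce simp: pow_weight_def\<close>)
      then show ?thesis by simp
    next
      case 2
      have "?I a
          = (\<integral>\<^sup>+ t. ennreal (bump 1 ?a t / bump_mass ?a) * pow_weight c (a - fst t) \<partial>lborel)"
        unfolding mollifier_def
        using measurable_compose[of "\<lambda>t :: real \<times> 'b. a - fst t" borel borel "pow_weight c" borel] fst_borel_measurable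
        by (intro nn_integral_density) auto
      also have "\<dots> \<le> (\<integral>\<^sup>+ t. ennreal (1 / bump_mass ?a) * (?F a t) \<partial>(lborel :: (real \<times> 'b) measure))"
      proof (rule nn_integral_mono)
        fix t :: "real \<times> 'b"
        show "ennreal (bump 1 ?a t / bump_mass ?a) * pow_weight c (a - fst t)
          \<le> ennreal (1 / bump_mass ?a) * (?F a t)"
        proof (cases "bump 1 ?a t = 0")
          case False
          then have "norm (t - ?a) \<le> 1 / 2" using bump_eq_0_iff[of 1 ?a t] by auto
          from supp[OF this] have "fst t \<in> {a - 6..}" "snd t \<in> cball 0 2" using 2 by auto
          moreover have "ennreal (bump 1 ?a t / bump_mass ?a) \<le> ennreal (1 / bump_mass ?a)"
            using bump_mass_pos[of ?a] by (intro ennreal_leI divide_right_mono bump_le_1) auto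
          ultimately show ?thesis by (simp add: mult_right_mono)
        qed simp
      qed
      also have "\<dots> = ennreal (1 / bump_mass ?a) * (\<integral>\<^sup>+ t. ?F a t \<partial>(lborel \<Otimes>\<^sub>M (lborel :: 'b measure)))"
        unfolding lborel_prod[symmetric] by (rule nn_integral_cmult) measurable
      also have "(\<integral>\<^sup>+ t. ?F a t \<partial>(lborel \<Otimes>\<^sub>M (lborel :: 'b measure)))
          = (\<integral>\<^sup>+ s. (\<integral>\<^sup>+ y. (pow_weight c (a - s) * indicator {a - 6..} s) * indicator (cball 0 2) y \<partial>(lborel :: 'b measure)) \<partial>lborel)"
      proof -
        have "(\<lambda>t :: real \<times> 'b. ?F a t)
            \<in> borel_measurable (lborel \<Otimes>\<^sub>M lborel)"
          by measurable
        from lborel.nn_integral_fst[OF this] show ?thesis by simp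
      qed
      also have "\<dots> = (\<integral>\<^sup>+ s. (pow_weight c (a - s) * indicator {a - 6..} s) * V \<partial>lborel)"
        unfolding V_def by (intro nn_integral_cong nn_integral_cmult_indicator) simp
      also have "\<dots> = (\<integral>\<^sup>+ s. pow_weight c (a - s) * indicator {a - 6..} s \<partial>lborel) * V"
        by (rule nn_integral_multc) measurable
      also have "(\<integral>\<^sup>+ s. pow_weight c (a - s) * indicator {a - 6..} s \<partial>lborel) = (\<integral>\<^sup>+ s. pow_weight c s * indicator {..6} s \<partial>lborel)"
        by (subst nn_integral_real_affine[where c="-1" and t=a])
          (auto intro!: nn_integral_cong split: split_indicator)
      finally have "?I a \<le> ennreal j"
        unfolding J_def[symmetric] j .
      also have "\<dots> \<le> ennreal (C * a powr c)"
      proof (rule ennreal_leI)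
        have "m \<le> a powr c"
        proof (cases "0 \<le> c")
          case True
          then have "1 \<le> a powr c" using 2 by (intro ge_one_powr_ge_zero) auto
          then show ?thesis by (simp add: m_def)
        next
          case False
          then have "4 powr c \<le> a powr c" using 2 by (intro powr_mono2') auto
          then show ?thesis by (simp add: m_def)
        qed
        then have "(j / m) * m \<le> C * a powr c"
          using j(2) m by (intro mult_mono) (auto simp: C_def)
        then show "j \<le> C * a powr c" using m by simp
      qed
      also have "\<dots> = ennreal C * pow_weight c a"
        using \<open>0 < a\<close> by (simp add: pow_weight_def ennreal_mult'')
      finally show ?thesis .
    next
      case 3
      have "?I a \<le> (\<integral>\<^sup>+ t. ennreal C * pow_weight c a \<partial>mollifier ?a)"
      proof (rule nn_integral_mono_AE, use AE_mollifier[of ?a] in eventually_elim)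
        fix t :: "real \<times> 'b" assume "norm (t - ?a) \<le> 1 / 2"
        from supp[OF this] have t: "a / 2 \<le> a - fst t" "a - fst t \<le> a" using 3 by auto
        have "(a - fst t) powr c \<le> C * a powr c"
        proof (cases "0 \<le> c")
          case True
          then have "(a - fst t) powr c \<le> 1 * a powr c" using t 3 unfolding mult_1 by (intro powr_mono2) auto
          also have "1 * a powr c \<le> C * a powr c" by (intro mult_right_mono) (auto simp: C_def)
          finally show ?thesis .
        next
          case False
          then have "(a - fst t) powr c \<le> (a / 2) powr c" using t 3 by (intro powr_mono2') auto
          also have "\<dots> = 2 powr (- c) * a powr c" using 3 by (simp add: powr_divide powr_minus field_simps)
          also have "\<dots> \<le> C * a powr c" by (intro mult_right_mono) (auto simp: C_def)
          finally show ?thesis .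
        qed
        then show "pow_weight c (a - fst t) \<le> ennreal C * pow_weight c a"
          using t 3 by (simp add: pow_weight_def ennreal_mult''[symmetric] ennreal_leI)
      qed
      then show ?thesis by (simp add: emeasure_mollifier)
    qed
  qed (simp_all add: sets_mollifier emeasure_mollifier)
qed

lemma integral_lborel_affine:
  fixes F :: "'a::euclidean_space \<Rightarrow> real"
  assumes [measurable]: "F \<in> borel_measurable borel" and "e \<noteq> 0"
  shows "(\<integral>w. F w \<partial>lborel) = \<bar>e\<bar> ^ DIM('a) * (\<integral>t. F (z + e *\<^sub>R t) \<partial>lborel)"
proof -
  have "(\<integral>w. F w \<partial>lborel) = (\<integral>w. F w \<partial>density (distr lborel borel (\<lambda>x. z + e *\<^sub>R x)) (\<lambda>_. ennreal (\<bar>e\<bar> ^ DIM('a))))"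
    using lborel_affine[OF assms(2), of z] by (simp add: ennreal_power)
  also have "\<dots> = (\<integral>w. \<bar>e\<bar> ^ DIM('a) * F w \<partial>distr lborel borel (\<lambda>x. z + e *\<^sub>R x))"
    by (subst integral_density) auto
  also have "\<dots> = (\<integral>t. \<bar>e\<bar> ^ DIM('a) * F (z + e *\<^sub>R t) \<partial>lborel)"
    by (subst integral_distr) auto
  finally show ?thesis by simp
qed

text \<open>Substitution of w = z + e t. The left form suits the weighted estimates; the right one,
  with \<open>z\<close> only in the kernel, gives smoothness.\<close>

lemma integral_mollifier_eq_convolution:
  fixes f :: "'a::euclidean_space \<Rightarrow> real"
  assumes [measurable]: "f \<in> borel_measurable borel" and e: "0 < e"
  shows "(\<integral>t. f (z + e *\<^sub>R t) \<partial>mollifier a)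
    = (\<integral>w. bump (1 / e) a (w - z) / (bump_mass a * e ^ DIM('a)) * f w \<partial>lborel)"
proof -
  have "(\<integral>t. f (z + e *\<^sub>R t) \<partial>mollifier a) = (\<integral>t. bump 1 a t / bump_mass a * f (z + e *\<^sub>R t) \<partial>lborel)"
    unfolding mollifier_def using bump_mass_pos[of a]
    by (subst integral_density) (auto simp: bump_nonneg)
  moreover have "(\<integral>w. bump (1 / e) a (w - z) / (bump_mass a * e ^ DIM('a)) * f w \<partial>lborel)
    = e ^ DIM('a) * (\<integral>t. bump (1 / e) a (e *\<^sub>R t) / (bump_mass a * e ^ DIM('a)) * f (z + e *\<^sub>R t) \<partial>lborel)"
    using e by (subst integral_lborel_affine[where e=e and z=z]) auto
  moreover have "\<dots> = (\<integral>t. e ^ DIM('a) * (bump (1 / e) a (e *\<^sub>R t) / (bump_mass a * e ^ DIM('a)) * f (z + e *\<^sub>R t)) \<partial>lborel)"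
    by simp
  moreover have "e ^ DIM('a) * (bump (1 / e) a (e *\<^sub>R t) / (bump_mass a * e ^ DIM('a)) * x) = bump 1 a t / bump_mass a * x" for t x
    using e by (simp add: bump_def)
  ultimately show ?thesis by simp
qed

section \<open>The weight\<close>

lemma nn_integral_lborel_scale:
  fixes F :: "'a::euclidean_space \<Rightarrow> ennreal"
  assumes [measurable]: "F \<in> borel_measurable borel" and "s \<noteq> 0"
  shows "(\<integral>\<^sup>+ w. F w \<partial>lborel) = ennreal (\<bar>s\<bar> ^ DIM('a)) * (\<integral>\<^sup>+ t. F (s *\<^sub>R t) \<partial>lborel)"
proof -
  have "(\<integral>\<^sup>+ w. F w \<partial>lborel) = (\<integral>\<^sup>+ w. F w \<partial>density (distr lborel borel (\<lambda>x. 0 + s *\<^sub>R x)) (\<lambda>_. ennreal (\<bar>s\<bar> ^ DIM('a))))"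
    using lborel_affine[OF assms(2), of "0 :: 'a"] by (simp add: ennreal_power)
  also have "\<dots> = (\<integral>\<^sup>+ w. ennreal (\<bar>s\<bar> ^ DIM('a)) * F w \<partial>distr lborel borel (\<lambda>x. 0 + s *\<^sub>R x))"
    by (subst nn_integral_density) auto
  also have "\<dots> = (\<integral>\<^sup>+ t. ennreal (\<bar>s\<bar> ^ DIM('a)) * F (s *\<^sub>R t) \<partial>lborel)"
    by (subst nn_integral_distr) auto
  also have "\<dots> = ennreal (\<bar>s\<bar> ^ DIM('a)) * (\<integral>\<^sup>+ t. F (s *\<^sub>R t) \<partial>lborel)"
    by (rule nn_integral_cmult) simp
  finally show ?thesis .
qed

text \<open>Scale invariance replaces polar coordinates: averaging the null set over dilations
  by \<open>s \<in> [1, 2]\<close> gives zero by Fubini, while every dilate has comparable measure.\<close>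
lemma AE_norm_notin_null_set:
  assumes A: "A \<in> null_sets (lborel :: real measure)"
  shows "AE z :: 'a::euclidean_space in lborel. norm z \<notin> A"
proof -
  let ?J = "\<lambda>s. \<integral>\<^sup>+ z. indicator A (s * norm z) \<partial>(lborel :: 'a measure)" and ?q = "ennreal (1 / 2 ^ DIM('a))"
  let ?K = "\<lambda>z :: 'a. \<integral>\<^sup>+ s. indicator {1..2} s * indicator A (s * norm z) \<partial>lborel"
  let ?N = "\<lambda>z :: 'a. \<integral>\<^sup>+ s. indicator A (norm z * s) \<partial>lborel"
  have [measurable]: "A \<in> sets borel" using A by auto
  define J where "J = (\<integral>\<^sup>+ z. indicator A (norm z) \<partial>(lborel :: 'a measure))"
  have "(\<integral>\<^sup>+ s. indicator {1..2::real} s * (?q * J) \<partial>lborel)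
      \<le> (\<integral>\<^sup>+ s. (\<integral>\<^sup>+ z. indicator {1..2} s * indicator A (s * norm z) \<partial>(lborel :: 'a measure)) \<partial>lborel)"
  proof (rule nn_integral_mono)
    fix s :: real
    show "indicator {1..2} s * (?q * J) \<le> (\<integral>\<^sup>+ z. indicator {1..2} s * indicator A (s * norm z) \<partial>(lborel :: 'a measure))"
    proof (cases "s \<in> {1..2}")
      case True
      then have J: "J = ennreal (s ^ DIM('a)) * ?J s"
        unfolding J_def by (subst nn_integral_lborel_scale[where s=s]) auto
      have "?q * J = (?q * ennreal (s ^ DIM('a))) * ?J s"
        by (simp add: J mult.assoc)
      also have "\<dots> \<le> 1 * ?J s"
      proof (rule mult_right_mono)
        have "1 / 2 ^ DIM('a) * s ^ DIM('a) \<le> 1" using True by (simp add: power_mono)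
        then show "?q * ennreal (s ^ DIM('a)) \<le> 1"
          using True by (subst ennreal_mult[symmetric]) auto
      qed simp
      finally show ?thesis using True by simp
    qed simp
  qed
  also have "\<dots> = (\<integral>\<^sup>+ z. ?K z \<partial>(lborel :: 'a measure))"
    by (rule lborel_pair.Fubini') (simp add: split_beta')
  also have "\<dots> = (\<integral>\<^sup>+ z. 0 \<partial>(lborel :: 'a measure))"
  proof (rule nn_integral_cong_AE)
    have "AE z :: 'a in lborel. z \<noteq> 0" by (rule AE_lborel_singleton)
    then show "AE z :: 'a in lborel. ?K z = 0"
    proof eventually_elim
      fix z :: 'a assume z: "z \<noteq> 0"
      have "?K z \<le> ?N z"
        by (intro nn_integral_mono) (auto simp: mult.commute split: split_indicator)
      moreover have "ennreal (norm z) * ?N z = 0"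
        using nn_integral_lborel_scale[of "indicator A" "norm z"] z null_setsD1[OF A] by simp
      ultimately show "?K z = 0"
        using z by simp
    qed
  qed
  finally have "(\<integral>\<^sup>+ s. indicator {1..2::real} s * (?q * J) \<partial>lborel) = 0" by simp
  then have "?q * J = 0" by (simp add: nn_integral_multc)
  then have "J = 0" by simp
  then have "AE z :: 'a in lborel. indicator A (norm z) = (0 :: ennreal)"
    unfolding J_def by (subst (asm) nn_integral_0_iff_AE) auto
  then show ?thesis by eventually_elim (auto split: split_indicator_asm)
qed

text \<open>The exceptional null set of radii has a null preimage under the norm, so bounds for
  almost every radius hold for almost every point.\<close>

lemma admissible_bounds:
  assumes "admissible \<phi>" "0 \<le> L"
  obtains m M where "0 < m" "m \<le> M" "AE z :: 'a::euclidean_space in lborel. norm z \<le> L \<longrightarrow> m \<le> \<phi> (norm z) \<and> \<phi> (norm z) \<le> M"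
proof -
  obtain m M where mM: "0 < m" "m \<le> M" "AE \<rho> in lborel. \<rho> \<in> {0..L} \<longrightarrow> m \<le> \<phi> \<rho> \<and> \<phi> \<rho> \<le> M"
    using assms unfolding admissible_def by blast
  from AE_E3[OF mM(3)] obtain A where A: "A \<in> null_sets lborel"
    "\<And>\<rho>. \<rho> \<in> space lborel - A \<Longrightarrow> \<rho> \<in> {0..L} \<longrightarrow> m \<le> \<phi> \<rho> \<and> \<phi> \<rho> \<le> M" by blast
  have "AE z :: 'a in lborel. norm z \<le> L \<longrightarrow> m \<le> \<phi> (norm z) \<and> \<phi> (norm z) \<le> M"
    using AE_norm_notin_null_set[OF A(1)] by eventually_elim (use A(2) in auto)
  with mM show ?thesis by (intro that) auto
qed

text \<open>A version of \<open>weighted_measure\<close> on the Borel sets of the whole space; the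
  original lives on the completed sigma-algebra of the half-space, which is unsuitable for product
  measures.\<close>

definition borel_weight :: "real \<Rightarrow> (real \<Rightarrow> real) \<Rightarrow> (real \<times> (real ^ 'n)) measure" where
  "borel_weight c \<phi> = density lborel (\<lambda>z. pow_weight c (fst z) * ennreal (\<phi> (norm z)))"

lemma admissible_measurable:
  assumes "admissible \<phi>"
  shows "(\<lambda>z :: 'a::euclidean_space. \<phi> (norm z)) \<in> borel_measurable borel"
proof (rule measurable_compose[where f=norm and g=\<phi>])
  show "norm \<in> borel \<rightarrow>\<^sub>M restrict_space borel {0 :: real..}"
    by (intro measurable_restrict_space2) auto
  show "\<phi> \<in> borel_measurable (restrict_space borel {0..})" using assms by (simp add: admissible_def)
qed

lemma sets_borel_weight [measurable_cong, simp]: "sets (borel_weight c \<phi>) = sets borel"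
  by (simp add: borel_weight_def)

lemma nn_integral_borel_weight:
  assumes \<phi>: "admissible \<phi>" and F: "F \<in> borel_measurable borel"
  shows "(\<integral>\<^sup>+ z. F z \<partial>borel_weight c \<phi>) = (\<integral>\<^sup>+ z. pow_weight c (fst z) * ennreal (\<phi> (norm z)) * F z \<partial>lborel)"
proof -
  note [measurable] = admissible_measurable[OF \<phi>] F
  show ?thesis unfolding borel_weight_def by (intro nn_integral_density) measurable
qed

lemma half_space_borel [measurable]: "(half_space :: (real \<times> (real ^ 'n)) set) \<in> sets borel"
  unfolding half_space_def by (intro borel_open open_Collect_less continuous_intros)

lemma lebesgue_on_half_space_weight_measurable:
  assumes "admissible \<phi>"
  shows "(\<lambda>z :: real \<times> (real ^ 'n). ennreal (fst z powr c * \<phi> (norm z))) \<in> borel_measurable (lebesgue_on half_space)"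
proof -
  note [measurable] = admissible_measurable[OF assms]
  have "(\<lambda>z :: real \<times> (real ^ 'n). ennreal (fst z powr c * \<phi> (norm z))) \<in> borel_measurable borel"
    by measurable
  then show ?thesis by (intro measurable_restrict_space1 measurable_completion) simp
qed

lemma nn_integral_weighted_measure:
  assumes \<phi>: "admissible \<phi>" and F: "F \<in> borel_measurable (borel :: (real \<times> (real ^ 'n)) measure)"
  shows "(\<integral>\<^sup>+ z. F z \<partial>weighted_measure c \<phi>) = (\<integral>\<^sup>+ z. F z \<partial>borel_weight c \<phi>)"
proof -
  have "F \<in> borel_measurable (lebesgue_on half_space)"
    using F by (intro measurable_restrict_space1 measurable_completion) simp
  then have "(\<integral>\<^sup>+ z. F z \<partial>weighted_measure c \<phi>) = (\<integral>\<^sup>+ z. ennreal (fst z powr c * \<phi> (norm z)) * F z \<partial>lebesgue_on half_space)"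
    unfolding weighted_measure_def
    by (intro nn_integral_density lebesgue_on_half_space_weight_measurable \<phi>)
  also have "\<dots> = (\<integral>\<^sup>+ z. ennreal (fst z powr c * \<phi> (norm z)) * F z * indicator half_space z \<partial>lborel)"
    by (subst nn_integral_restrict_space) (auto simp: nn_integral_completion)
  also have "\<dots> = (\<integral>\<^sup>+ z. pow_weight c (fst z) * ennreal (\<phi> (norm z)) * F z \<partial>lborel)"
    using \<phi> by (intro nn_integral_cong)
      (auto simp: half_space_def pow_weight_def ennreal_mult admissible_def less_imp_le split: split_indicator)
  finally show ?thesis unfolding nn_integral_borel_weight[OF \<phi> F] .
qed

text \<open>A smooth transition from 0 at 1 to 1 at 2. The usual quotient would need a rule for
  dividing functions; here only compositions of \<open>flat_poly 1\<close> occur and the denominator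
  is constant. The inner argument is maximal for \<open>s \<le> 1\<close> and nonpositive for
  \<open>2 \<le> s\<close>.\<close>

definition step :: "real \<Rightarrow> real" where
  "step s = 1 - flat_poly 1 (flat_poly 1 1 - flat_poly 1 (s - 1)) / flat_poly 1 (flat_poly 1 1)"

definition step' :: "real \<Rightarrow> real" where
  "step' s = flat_poly [:0, 0, 1:] (flat_poly 1 1 - flat_poly 1 (s - 1)) * flat_poly [:0, 0, 1:] (s - 1) / flat_poly 1 (flat_poly 1 1)"

lemma flat_mono: "x \<le> y \<Longrightarrow> flat_poly 1 x \<le> flat_poly 1 y"
  by (auto simp: flat_poly_def frac_le)

lemma flat_pos: "0 < x \<Longrightarrow> 0 < flat_poly 1 x"
  by (simp add: flat_poly_def)

lemma flat_nonneg: "0 \<le> flat_poly 1 x"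
  by (simp add: flat_poly_def)

lemma step_eq_0: "s \<le> 1 \<Longrightarrow> step s = 0"
  using flat_pos[OF flat_pos[of 1]] by (simp add: step_def) (simp add: flat_poly_def)

lemma step_eq_1: "2 \<le> s \<Longrightarrow> step s = 1"
  using flat_mono[of 1 "s - 1"] by (simp add: step_def) (simp add: flat_poly_def)

lemma step_bounds: "0 \<le> step s" "step s \<le> 1"
proof -
  have "flat_poly 1 (flat_poly 1 1 - flat_poly 1 (s - 1)) \<le> flat_poly 1 (flat_poly 1 1)"
    using flat_nonneg[of "s - 1"] by (intro flat_mono) simp
  then show "0 \<le> step s" using flat_pos[OF flat_pos[of 1]] by (simp add: step_def)
  show "step s \<le> 1" by (simp add: step_def flat_nonneg)
qed

lemma step_has_derivative: "(step has_real_derivative step' s) (at s)"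
proof -
  have D: "(flat_poly 1 has_real_derivative flat_poly [:0, 0, 1:] x) (at x)" for x
    using flat_poly_has_real_derivative[of 1 x] by simp
  have "((\<lambda>s. flat_poly 1 (s - 1)) has_real_derivative flat_poly [:0, 0, 1:] (s - 1) * 1) (at s)"
    by (rule DERIV_chain2[OF D]) (auto intro!: derivative_eq_intros)
  then have "((\<lambda>s. flat_poly 1 1 - flat_poly 1 (s - 1)) has_real_derivative - flat_poly [:0, 0, 1:] (s - 1)) (at s)"
    by (auto intro!: derivative_eq_intros)
  from DERIV_diff[OF DERIV_const[of 1] DERIV_cdivide[OF DERIV_chain2[OF D this]]] show ?thesis
    unfolding step_def[abs_def] step'_def by (rule DERIV_cong) simp
qed

lemma step'_eq_0: "s < 1 \<or> 2 < s \<Longrightarrow> step' s = 0"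
  using flat_mono[of 1 "s - 1"] by (auto simp: step'_def) (auto simp: flat_poly_def)

lemma continuous_on_step': "continuous_on S step'"
proof -
  note [continuous_intros] = continuous_on_compose2[OF continuous_on_flat_poly[of UNIV]]
  show ?thesis unfolding step'_def[abs_def]
    using flat_pos[OF flat_pos[of 1]] by (intro continuous_intros) auto
qed

lemma smooth_step_fst: "smooth (\<lambda>z :: real \<times> 'b::euclidean_space. step (fst z / d))"
proof -
  have "bounded_linear (\<lambda>z :: real \<times> 'b. fst z / d)"
    by (intro bounded_linear_divide[THEN bounded_linear_compose] bounded_linear_fst)
  from Ck_add[OF Ck_bounded_linear[OF this] Ck_const, of _ "- 1"]
  have "Ck k (\<lambda>z :: real \<times> 'b. flat_poly 1 (fst z / d - 1))" for k
    by (intro Ck_flat_poly) simp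
  from Ck_add[OF Ck_const[of _ "flat_poly 1 1"] Ck_mult[OF Ck_const[of _ "- 1"] this]]
  have "Ck k (\<lambda>z :: real \<times> 'b. flat_poly 1 (flat_poly 1 1 - flat_poly 1 (fst z / d - 1)))" for k
    by (intro Ck_flat_poly) simp
  from Ck_add[OF Ck_const[of _ 1] Ck_mult[OF Ck_const[of _ "- (1 / flat_poly 1 (flat_poly 1 1))"] this]]
  show ?thesis unfolding smooth_def step_def by simp
qed

lemma grad_step_fst:
  fixes z :: "real \<times> 'b::euclidean_space"
  shows "grad (\<lambda>z. step (fst z / d)) z \<bullet> h = step' (fst z / d) * (fst h / d)"
proof -
  have "((\<lambda>z :: real \<times> 'b. step (fst z / d)) has_derivative (\<lambda>h. step' (fst z / d) * (fst h / d))) (at z)"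
    by (rule has_derivative_compose[OF _ step_has_derivative[unfolded has_field_derivative_def]])
      (intro bounded_linear_imp_has_derivative bounded_linear_divide[THEN bounded_linear_compose] bounded_linear_fst)
  from has_derivative_unique[OF smooth_has_derivative_grad[OF smooth_step_fst] this]
  show ?thesis by (rule fun_cong)
qed

lemma grad_mult:
  assumes "smooth f" "smooth g"
  shows "grad (\<lambda>x. f x * g x) x = f x *\<^sub>R grad g x + g x *\<^sub>R grad f x"
proof (rule grad_eqI)
  show "((\<lambda>x. f x * g x) has_derivative (\<bullet>) (f x *\<^sub>R grad g x + g x *\<^sub>R grad f x)) (at x)"
    by (rule has_derivative_eq_rhs[OF has_derivative_mult[OF smooth_has_derivative_grad[OF assms(1)]
            smooth_has_derivative_grad[OF assms(2)]]])
      (simp add: fun_eq_iff inner_add_left)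
qed

section \<open>Weak gradients up to the boundary\<close>

text \<open>The class \<open>H\<close> of test functions is a parameter because the argument
  consists in enlarging it from supports in the open half-space to supports in a full ball.\<close>

definition weak_identity ::
    "('a::euclidean_space \<Rightarrow> real) set \<Rightarrow> ('a \<Rightarrow> real) \<Rightarrow> ('a \<Rightarrow> 'a) \<Rightarrow> bool" where
  "weak_identity H U G \<longleftrightarrow> (\<forall>\<eta>\<in>H. \<forall>i\<in>Basis.
     (\<integral>w. U w * (grad \<eta> w \<bullet> i) \<partial>lborel) = - (\<integral>w. (G w \<bullet> i) * \<eta> w \<partial>lborel))"

text \<open>Unlike \<open>Cc_infty\<close>, the functions vanish off \<open>K\<close> in the whole
  space, as integrals over the whole space require.\<close>

definition test_functions :: "'a::euclidean_space set \<Rightarrow> ('a \<Rightarrow> real) set" where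
  "test_functions T = {\<eta>. smooth \<eta> \<and> (\<exists>K. compact K \<and> K \<subseteq> T \<and> (\<forall>x. x \<notin> K \<longrightarrow> \<eta> x = 0))}"

text \<open>For \<open>c \<le> 0\<close> the weight is bounded below by \<open>m\<close> at bounded
  heights, so the weighted L^2 norm controls the unweighted one, and L^2 embeds in L^1 on a
  ball.\<close>

lemma integrable_of_wnorm_sq:
  fixes f :: "real \<times> 'b::euclidean_space \<Rightarrow> real"
  assumes c: "c \<le> 0" and [measurable]: "f \<in> borel_measurable borel"
    and f0: "\<And>z. fst z \<le> 0 \<Longrightarrow> f z = 0" "\<And>z. z \<notin> cball 0 L \<Longrightarrow> f z = 0"
    and fin: "wnorm_sq c f < \<infinity>"
  shows "integrable lborel f"
proof (rule integrableI_bounded)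
  let ?p = "\<lambda>z. pow_weight c (fst z) * ennreal ((f z)\<^sup>2)"
  define m where "m = (\<bar>L\<bar> + 1) powr c"
  have m: "0 < m" by (simp add: m_def)
  have "(\<integral>\<^sup>+ z. ennreal (norm (f z)) \<partial>lborel)
    \<le> (\<integral>\<^sup>+ z. indicator (cball 0 L) z + ennreal (1 / m) * (?p z) \<partial>(lborel :: (real \<times> 'b) measure))"
  proof (rule nn_integral_mono)
    fix z :: "real \<times> 'b"
    show "ennreal (norm (f z)) \<le> indicator (cball 0 L) z + ennreal (1 / m) * (?p z)"
    proof (cases "0 < fst z \<and> z \<in> cball 0 L")
      case True
      then have "fst z \<le> \<bar>L\<bar> + 1" using abs_fst_le_norm[of z] by simp
      then have "m \<le> fst z powr c" unfolding m_def using True c by (intro powr_mono2') auto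
      then have "1 * (f z)\<^sup>2 \<le> (1 / m * (fst z powr c)) * (f z)\<^sup>2"
        using m by (intro mult_right_mono) (auto simp: field_simps)
      moreover note abs_le_one_plus_square[of "f z"]
      ultimately have "\<bar>f z\<bar> \<le> 1 + 1 / m * (fst z powr c * (f z)\<^sup>2)" by (simp add: mult.assoc)
      then have "ennreal \<bar>f z\<bar> \<le> ennreal (1 + 1 / m * (fst z powr c * (f z)\<^sup>2))" by (rule ennreal_leI)
      also have "\<dots> = 1 + ennreal (1 / m) * (ennreal (fst z powr c) * ennreal ((f z)\<^sup>2))"
        using m by (simp add: ennreal_mult[symmetric])
      finally show ?thesis using True by (simp add: pow_weight_def)
    next
      case False
      then have "f z = 0" using f0(1)[of z] f0(2)[of z] by linarith
      then show ?thesis by simp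
    qed
  qed
  also have "\<dots> = emeasure lborel (cball 0 L :: (real \<times> 'b) set) + ennreal (1 / m) * wnorm_sq c f"
    unfolding wnorm_sq_def by (subst nn_integral_add, simp, simp, subst nn_integral_cmult, simp, simp)
  also have "\<dots> < \<infinity>"
    using fin emeasure_compact_finite[OF compact_cball, of "0 :: real \<times> 'b" L] by (simp add: ennreal_mult_less_top)
  finally show "(\<integral>\<^sup>+ z. ennreal (norm (f z)) \<partial>lborel) < \<infinity>" .
qed simp

text \<open>For \<open>c \<le> -1\<close> finiteness of \<open>\<integral> y^c u^2\<close> forces a zero trace: when a test function is cut off
  in the strip \<open>d \<le> y \<le> 2 d\<close>, the commutator is controlled, via Cauchy--Schwarz, by
  \<open>d^(- c - 1)\<close> times the vanishing weighted mass of the strip.\<close>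
lemma strip_commutator_tendsto_0:
  fixes f :: "real \<times> 'b::euclidean_space \<Rightarrow> real"
  assumes c: "c \<le> -1" and [measurable]: "f \<in> borel_measurable borel"
    and f0: "\<And>z. fst z \<le> 0 \<Longrightarrow> f z = 0" "\<And>z. z \<notin> cball 0 L \<Longrightarrow> f z = 0"
    and fin: "wnorm_sq c f < \<infinity>"
  shows "(\<lambda>n. (\<integral>\<^sup>+ z. ennreal (\<bar>f z\<bar> * (real (Suc n) * indicator {inverse (real (Suc n))..2 * inverse (real (Suc n))} (fst z))) \<partial>lborel)\<^sup>2) \<longlonglongrightarrow> 0"
proof -
  let ?p = "\<lambda>z. pow_weight c (fst z) * ennreal ((f z)\<^sup>2)"
  define d where "d n = inverse (real (Suc n))" for n
  have d: "0 < d n" "d n \<le> 1" for n by (auto simp: d_def field_simps)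
  define W where "W = emeasure lborel (cball (0 :: 'b) L)"
  have W: "W < \<infinity>" unfolding W_def using emeasure_compact_finite[OF compact_cball] .
  define \<epsilon> where "\<epsilon> n = (\<integral>\<^sup>+ z. ?p z * indicator {..2 * d n} (fst z) \<partial>lborel)" for n
  have d_lim: "d \<longlonglongrightarrow> 0" unfolding d_def by (rule LIMSEQ_inverse_real_of_nat)
  have "\<epsilon> \<longlonglongrightarrow> (\<integral>\<^sup>+ z. 0 \<partial>(lborel :: (real \<times> 'b) measure))"
    unfolding \<epsilon>_def
  proof (rule nn_integral_dominated_convergence)
    show "(\<integral>\<^sup>+ z. ?p z \<partial>lborel) < \<infinity>" using fin by (simp add: wnorm_sq_def)
    show "AE z in lborel. ?p z * indicator {..2 * d j} (fst z)
        \<le> ?p z" for j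
      by (auto split: split_indicator)
    show "AE z in lborel. (\<lambda>n. ?p z * indicator {..2 * d n} (fst z)) \<longlonglongrightarrow> 0"
    proof (intro AE_I2 tendsto_eventually)
      fix z :: "real \<times> 'b"
      show "\<forall>\<^sub>F n in sequentially. ?p z * indicator {..2 * d n} (fst z) = 0"
      proof (cases "0 < fst z")
        case True
        then have "\<forall>\<^sub>F n in sequentially. d n < fst z / 2" using d_lim by (intro order_tendstoD(2)) auto
        then show ?thesis by eventually_elim (auto split: split_indicator)
      qed (simp add: pow_weight_def)
    qed
  qed measurable
  then have \<epsilon>: "\<epsilon> \<longlonglongrightarrow> 0" by simp
  let ?W = "\<lambda>n. ennreal (2 powr (- c)) * W * \<epsilon> n"
  have bound: "(\<integral>\<^sup>+ z. ennreal (\<bar>f z\<bar> * (real (Suc n) * indicator {d n..2 * d n} (fst z))) \<partial>lborel)\<^sup>2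
      \<le> ?W n" for n
  proof -
    let ?a = "ennreal ((2 * d n) powr (- c))" and ?b = "ennreal ((1 / d n)\<^sup>2)"
    let ?S = "\<lambda>z :: real \<times> 'b. indicator {d n..2 * d n} (fst z) :: ennreal"
    let ?B = "\<lambda>z :: real \<times> 'b. indicator (cball 0 L) (snd z) :: ennreal"
    let ?g = "\<lambda>z. ennreal (1 / d n) * (?S z * ?B z)"
    let ?K = "{d n..2 * d n} \<times> (cball 0 L :: 'b set)"
    have B[measurable]: "?B \<in> borel_measurable borel"
      by (rule measurable_compose[of snd borel borel])
        (intro borel_measurable_continuous_onI continuous_intros, simp)
    have eq: "(\<integral>\<^sup>+ z. ennreal (\<bar>f z\<bar> * (real (Suc n) * indicator {d n..2 * d n} (fst z))) \<partial>lborel)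
      = (\<integral>\<^sup>+ z. (ennreal \<bar>f z\<bar> * ?S z) * ?g z \<partial>lborel)"
    proof (rule nn_integral_cong)
      fix z :: "real \<times> 'b"
      show "ennreal (\<bar>f z\<bar> * (real (Suc n) * indicator {d n..2 * d n} (fst z)))
        = (ennreal \<bar>f z\<bar> * ?S z) * ?g z"
      proof (cases "z \<in> cball 0 L")
        case True
        then have "snd z \<in> cball 0 L" using norm_snd_le[of "snd z" "fst z"] by simp
        then show ?thesis by (auto simp: d_def ennreal_mult divide_inverse split: split_indicator)
      qed (simp add: f0(2))
    qed
    have "(\<integral>\<^sup>+ z. ennreal (\<bar>f z\<bar> * (real (Suc n) * indicator {d n..2 * d n} (fst z))) \<partial>lborel)\<^sup>2
      \<le> (\<integral>\<^sup>+ z. (ennreal \<bar>f z\<bar> * ?S z)\<^sup>2 \<partial>lborel) * (\<integral>\<^sup>+ z. (?g z)\<^sup>2 \<partial>(lborel :: (real \<times> 'b) measure))"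
      unfolding eq by (rule Cauchy_Schwarz_nn_integral) measurable
    also have "\<dots> \<le> (?a * \<epsilon> n) * (?b * (ennreal (d n) * W))"
    proof (rule mult_mono)
      have "(\<integral>\<^sup>+ z. (ennreal \<bar>f z\<bar> * ?S z)\<^sup>2 \<partial>lborel)
        \<le> (\<integral>\<^sup>+ z. ?a * (?p z * indicator {..2 * d n} (fst z)) \<partial>lborel)"
      proof (rule nn_integral_mono)
        fix z
        show "(ennreal \<bar>f z\<bar> * ?S z)\<^sup>2 \<le> ?a * (?p z * indicator {..2 * d n} (fst z))"
        proof (cases "fst z \<in> {d n..2 * d n}")
          case True
          then have pos: "0 < fst z" using d(1)[of n] by simp
          have "(2 * d n) powr c \<le> fst z powr c" using True pos c by (intro powr_mono2') auto
          then have "1 \<le> (2 * d n) powr (- c) * fst z powr c"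
            using d(1)[of n] by (simp add: powr_minus field_simps)
          then have "1 * (f z)\<^sup>2 \<le> ((2 * d n) powr (- c) * fst z powr c) * (f z)\<^sup>2"
            by (rule mult_right_mono) simp
          then have "ennreal ((f z)\<^sup>2) \<le> ennreal ((2 * d n) powr (- c) * (fst z powr c * (f z)\<^sup>2))"
            by (intro ennreal_leI) (simp add: mult.assoc)
          also have "\<dots> = ?a * (ennreal (fst z powr c) * ennreal ((f z)\<^sup>2))"
            by (simp only: ennreal_mult powr_ge_zero zero_le_power2 mult_nonneg_nonneg)
          finally show ?thesis using True pos by (simp add: pow_weight_def ennreal_power)
        qed simp
      qed
      also have "\<dots> = ?a * \<epsilon> n"
        unfolding \<epsilon>_def by (rule nn_integral_cmult) measurable
      finally show "(\<integral>\<^sup>+ z. (ennreal \<bar>f z\<bar> * ?S z)\<^sup>2 \<partial>lborel) \<le> ?a * \<epsilon> n" .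
      have "(\<integral>\<^sup>+ z. (?g z)\<^sup>2 \<partial>(lborel :: (real \<times> 'b) measure))
        = (\<integral>\<^sup>+ z. ?b * indicator ?K z \<partial>(lborel :: (real \<times> 'b) measure))"
        using d(1)[of n] by (intro nn_integral_cong) (auto simp: ennreal_power indicator_def)
      also have "\<dots> = ?b * emeasure lborel ?K"
      proof (rule nn_integral_cmult_indicator)
        have "closed ?K" by (intro closed_Times) auto
        then show "?K \<in> sets lborel" by simp
      qed
      also have "emeasure lborel ?K = ennreal (d n) * W"
        unfolding W_def lborel_prod[symmetric] using d(1)[of n]
        by (subst lborel.emeasure_pair_measure_Times) auto
      finally show "(\<integral>\<^sup>+ z. (?g z)\<^sup>2 \<partial>(lborel :: (real \<times> 'b) measure))
        \<le> ?b * (ennreal (d n) * W)" by simp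
    qed auto
    also have "\<dots> = (?a * ?b * ennreal (d n)) * W * \<epsilon> n"
      by (simp only: ac_simps)
    also have "?a * ?b * ennreal (d n) = ennreal ((2 * d n) powr (- c) * (1 / d n)\<^sup>2 * d n)"
      using d(1)[of n] by (simp only: ennreal_mult powr_ge_zero zero_le_power2 mult_nonneg_nonneg less_imp_le)
    \<comment> \<open>Count of exponents: -c from the weight on the strip, -2 from the squared slope
      1/d, +1 from the thickness of the strip. The total -c - 1 is nonnegative exactly when
      \<open>c \<le> -1\<close>.\<close>
    also have "(2 * d n) powr (- c) * (1 / d n)\<^sup>2 * d n = 2 powr (- c) * d n powr (- c - 1)"
      using d(1)[of n] by (simp add: powr_mult powr_diff field_simps power2_eq_square)
    also have "ennreal (2 powr (- c) * d n powr (- c - 1)) * W * \<epsilon> n \<le> ?W n"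
    proof (intro mult_right_mono ennreal_leI)
      have "d n powr (- c - 1) \<le> 1" using d[of n] c by (intro powr_le1) auto
      then show "2 powr (- c) * d n powr (- c - 1) \<le> 2 powr (- c)" by (intro mult_left_le) auto
    qed auto
    finally show ?thesis .
  qed
  have "(\<lambda>n. ?W n) \<longlonglongrightarrow> ennreal (2 powr (- c)) * W * 0"
    using W \<epsilon> by (intro ennreal_tendsto_cmult) (auto simp: ennreal_mult_less_top)
  then have "(\<lambda>n. ?W n) \<longlonglongrightarrow> 0" by simp
  from tendsto_sandwich[OF _ always_eventually tendsto_const this] bound
  show ?thesis unfolding d_def by auto
qed

text \<open>The test function is multiplied by the steps \<open>s n\<close>, which vanish for
  heights up to 1/(n+1) and tend to 1 on the half-space. The product rule adds the commutator
  \<open>C n\<close>, which tends to 0; the other terms converge dominatedly. So the zero extension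
  has the zero extension of the gradient as its weak gradient across y = 0.\<close>

lemma weak_identity_up_to_boundary:
  fixes U :: "real \<times> (real ^ 'n) \<Rightarrow> real" and G :: "real \<times> (real ^ 'n) \<Rightarrow> real \<times> (real ^ 'n)"
  assumes c: "c \<le> -1" and [measurable]: "U \<in> borel_measurable borel" "G \<in> borel_measurable borel"
    and U0: "\<And>z. fst z \<le> 0 \<Longrightarrow> U z = 0" and G0: "\<And>z. fst z \<le> 0 \<Longrightarrow> G z = 0"
    and U: "wnorm_sq c (\<lambda>z. indicator (cball 0 L) z * U z) < \<infinity>"
    and G: "\<And>i. i \<in> Basis \<Longrightarrow> wnorm_sq c (\<lambda>z. indicator (cball 0 L) z * (G z \<bullet> i)) < \<infinity>"
    and weak: "weak_identity (test_functions half_space) U G"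
  shows "weak_identity (test_functions (cball 0 L)) U G"
  unfolding weak_identity_def
proof (intro ballI)
  let ?d = "\<lambda>n. inverse (real (Suc n))"
  let ?q = "\<lambda>n z. real (Suc n) * indicator {?d n..2 * ?d n} (fst z)"
  fix \<eta> :: "real \<times> (real ^ 'n) \<Rightarrow> real" and i :: "real \<times> (real ^ 'n)"
  assume "\<eta> \<in> test_functions (cball 0 L)" and i: "i \<in> Basis"
  let ?r = "\<lambda>n w. \<eta> w * (step' (fst w / ?d n) * (fst i / ?d n))"
  from \<open>\<eta> \<in> _\<close> obtain K where \<eta>: "smooth \<eta>" and K: "compact K" "K \<subseteq> cball 0 L" "\<And>x. x \<notin> K \<Longrightarrow> \<eta> x = 0"
    unfolding test_functions_def by blast
  have g0: "grad \<eta> x = 0" if "x \<notin> K" for x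
    using grad_zero_outside[OF compact_imp_closed[OF K(1)] K(3) that] .
  obtain A where A: "0 < A" "\<And>x. norm (\<eta> x) \<le> A"
    using bounded_compact_support[OF smooth_imp_continuous_on[OF \<eta>] K(1) K(3)] by blast
  obtain A' where A': "0 < A'" "\<And>x. norm (grad \<eta> x) \<le> A'"
    using bounded_compact_support[OF continuous_on_grad[OF \<eta>] K(1) g0] by blast
  obtain M where M: "0 < M" "\<And>s. norm (step' s) \<le> M"
    using bounded_compact_support[OF continuous_on_step', of "{1..2}"] step'_eq_0 by (metis atLeastAtMost_iff compact_Icc not_le)
  note [measurable] = smooth_measurable[OF \<eta>] grad_measurable[OF \<eta>]
  have [measurable]: "step' \<in> borel_measurable borel"
    by (intro borel_measurable_continuous_onI continuous_on_step')
  have [measurable]: "step \<in> borel_measurable borel"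
    using step_has_derivative by (intro borel_measurable_continuous_onI continuous_at_imp_continuous_on) (auto intro: DERIV_isCont)
  let ?T = "cball 0 L :: (real \<times> (real ^ 'n)) set"
  \<comment> \<open>Restricted to the ball, both functions are integrable because
    \<open>c \<le> 0\<close>; on the support of the test function nothing changes.\<close>
  define UT where "UT z = indicator ?T z * U z" for z
  define VT where "VT z = indicator ?T z * (G z \<bullet> i)" for z
  have [measurable]: "UT \<in> borel_measurable borel" "VT \<in> borel_measurable borel"
    unfolding UT_def VT_def by measurable
  have UT: "wnorm_sq c UT < \<infinity>" "\<And>z. fst z \<le> 0 \<Longrightarrow> UT z = 0" "\<And>z. z \<notin> cball 0 L \<Longrightarrow> UT z = 0"
    using U U0 by (auto simp: UT_def[abs_def])
  have VT: "wnorm_sq c VT < \<infinity>" "\<And>z. fst z \<le> 0 \<Longrightarrow> VT z = 0" "\<And>z. z \<notin> cball 0 L \<Longrightarrow> VT z = 0"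
    using G[OF i] G0 by (auto simp: VT_def[abs_def])
  have iU: "integrable lborel UT" using c UT by (intro integrable_of_wnorm_sq[of c]) auto
  have iV: "integrable lborel VT" using c VT by (intro integrable_of_wnorm_sq[of c]) auto
  have VT_eq: "(G w \<bullet> i) * (\<eta> w * x) = VT w * (\<eta> w * x)" for w x
    using subsetD[OF K(2), of w] K(3)[of w] by (cases "w \<in> K") (auto simp: VT_def)
  have UT_eq: "U w * (grad \<eta> w \<bullet> i) = UT w * (grad \<eta> w \<bullet> i)" for w
    using subsetD[OF K(2), of w] g0[of w] by (cases "w \<in> K") (auto simp: UT_def)
  define s where "s n = (\<lambda>w :: real \<times> (real ^ 'n). step (fst w / ?d n))" for n
  have s: "smooth (s n)" for n unfolding s_def by (rule smooth_step_fst)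
  have s01: "\<bar>s n w\<bar> \<le> 1" for n w using step_bounds by (simp add: s_def)
  have s_lim: "(\<lambda>n. s n w) \<longlonglongrightarrow> 1" if "0 < fst w" for w
  proof (rule tendsto_eventually)
    obtain N where "2 / fst w < real N" using reals_Archimedean2 by blast
    then have N: "2 < real N * fst w" using that by (simp add: field_simps)
    show "\<forall>\<^sub>F n in sequentially. s n w = 1" using eventually_ge_at_top[of N]
    proof eventually_elim
      fix n assume "N \<le> n"
      then have "real N * fst w \<le> real (Suc n) * fst w" using that by (intro mult_right_mono) auto
      then have "2 \<le> fst w / ?d n" using N by (simp add: divide_inverse mult.commute)
      then show "s n w = 1" unfolding s_def by (rule step_eq_1)
    qed
  qed
  note [measurable] = smooth_measurable[OF s]
  define C where "C n = (\<integral>w. UT w * (?r n w) \<partial>lborel)" for n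
  have fsti: "\<bar>fst i\<bar> \<le> 1" using abs_fst_le_norm[of i] i by simp
  have Cb: "\<bar>?r n w\<bar>
      \<le> A * M * (?q n w)" for n w
  proof (cases "fst w \<in> {?d n..2 * ?d n}")
    case True
    have "\<bar>\<eta> w\<bar> * (\<bar>step' (fst w / ?d n)\<bar> * (\<bar>fst i\<bar> * real (Suc n))) \<le> A * (M * (1 * real (Suc n)))"
      using A M fsti by (intro mult_mono) auto
    then show ?thesis using True by (simp add: abs_mult divide_inverse mult.assoc)
  next
    case False
    then have "fst w / ?d n < 1 \<or> 2 < fst w / ?d n"
      by (auto simp: not_le field_simps)
    then have z: "step' (fst w / ?d n) = 0" by (rule step'_eq_0)
    show ?thesis unfolding z using False by simp
  qed
  have iC: "integrable lborel (\<lambda>w. (?r n w) * UT w)" for n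
  proof (rule integrable_mult_bounded[OF iU])
    show "\<bar>?r n w\<bar> \<le> A * M * real (Suc n)" for w
    proof (rule order.trans[OF Cb])
      have "A * M * (?q n w) \<le> A * M * (real (Suc n) * 1)"
        using A(1) M(1) by (intro mult_left_mono) (auto simp: indicator_def)
      then show "A * M * (?q n w) \<le> A * M * real (Suc n)"
        by simp
    qed
  qed measurable
  have identity: "(\<integral>w. UT w * ((grad \<eta> w \<bullet> i) * s n w) \<partial>lborel) + C n = - (\<integral>w. VT w * (\<eta> w * s n w) \<partial>lborel)" for n
  proof -
    have sm: "smooth (\<lambda>w. \<eta> w * s n w)" by (intro smooth_mult \<eta> s)
    have "(\<lambda>w. \<eta> w * s n w) \<in> test_functions half_space"
      unfolding test_functions_def
    proof (intro CollectI conjI sm exI[of _ "K \<inter> {w. ?d n \<le> fst w}"] allI impI)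
      show "compact (K \<inter> {w. ?d n \<le> fst w})"
        by (intro compact_Int_closed K(1) closed_Collect_le continuous_intros)
      show "K \<inter> {w. ?d n \<le> fst w} \<subseteq> half_space"
        by (auto simp: half_space_def intro: less_le_trans[of 0 "?d n"])
      show "\<eta> w * s n w = 0" if "w \<notin> K \<inter> {w. ?d n \<le> fst w}" for w
      proof (cases "w \<in> K")
        case True
        then have "fst w / ?d n \<le> 1" using that by (simp add: field_simps)
        then show ?thesis by (simp add: s_def step_eq_0)
      qed (simp add: K(3))
    qed
    with weak i have "(\<integral>w. U w * (grad (\<lambda>w. \<eta> w * s n w) w \<bullet> i) \<partial>lborel) = - (\<integral>w. (G w \<bullet> i) * (\<eta> w * s n w) \<partial>lborel)"
      unfolding weak_identity_def by blast
    also have "(\<integral>w. U w * (grad (\<lambda>w. \<eta> w * s n w) w \<bullet> i) \<partial>lborel)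
      = (\<integral>w. UT w * ((grad \<eta> w \<bullet> i) * s n w) + UT w * (?r n w) \<partial>lborel)"
    proof (rule Bochner_Integration.integral_cong[OF refl])
      fix w
      have "grad (\<lambda>w. \<eta> w * s n w) w \<bullet> i = ?r n w + (grad \<eta> w \<bullet> i) * s n w"
        unfolding grad_mult[OF \<eta> s] inner_add_left inner_scaleR_left
        unfolding s_def grad_step_fst by (simp add: mult.commute)
      then show "U w * (grad (\<lambda>w. \<eta> w * s n w) w \<bullet> i) = UT w * ((grad \<eta> w \<bullet> i) * s n w) + UT w * (?r n w)"
        using subsetD[OF K(2), of w] K(3)[of w] g0[of w] by (cases "w \<in> K") (auto simp: UT_def algebra_simps)
    qed
    also have "\<dots> = (\<integral>w. UT w * ((grad \<eta> w \<bullet> i) * s n w) \<partial>lborel) + C n"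
      unfolding C_def
    proof (rule Bochner_Integration.integral_add)
      have "\<bar>(grad \<eta> w \<bullet> i) * s n w\<bar> \<le> A' * 1" for w
        unfolding abs_mult using A'(2)[of w] Basis_le_norm[OF i, of "grad \<eta> w"] s01[of n w] A'(1)
        by (intro mult_mono) auto
      from integrable_mult_bounded[OF iU _ this] show "integrable lborel (\<lambda>w. UT w * ((grad \<eta> w \<bullet> i) * s n w))"
        by (simp add: mult.commute)
      show "integrable lborel (\<lambda>w. UT w * (?r n w))"
        using iC[of n] by (simp add: mult.commute)
    qed
    also have "(\<integral>w. (G w \<bullet> i) * (\<eta> w * s n w) \<partial>lborel) = (\<integral>w. VT w * (\<eta> w * s n w) \<partial>lborel)"
      unfolding VT_eq ..
    finally show ?thesis .
  qed
  have lim: "(\<lambda>n. \<integral>w. F w * (h w * s n w) \<partial>lborel) \<longlonglongrightarrow> (\<integral>w. F w * h w \<partial>lborel)"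
    if F: "integrable lborel F" "\<And>w. fst w \<le> 0 \<Longrightarrow> F w = 0" and [measurable]: "h \<in> borel_measurable borel"
      and h: "\<And>w. \<bar>h w\<bar> \<le> B" for F h B
  proof (rule integral_dominated_convergence)
    have [measurable]: "F \<in> borel_measurable borel" using borel_measurable_integrable[OF F(1)] by simp
    show "(\<lambda>w. F w * h w) \<in> borel_measurable lborel" "(\<lambda>w. F w * (h w * s n w)) \<in> borel_measurable lborel" for n
      by measurable
    show "integrable lborel (\<lambda>w. B * \<bar>F w\<bar>)" using F(1) by simp
    show "AE w in lborel. (\<lambda>n. F w * (h w * s n w)) \<longlonglongrightarrow> F w * h w"
    proof (rule AE_I2)
      fix w
      show "(\<lambda>n. F w * (h w * s n w)) \<longlonglongrightarrow> F w * h w"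
      proof (cases "0 < fst w")
        case True
        have "(\<lambda>n. F w * (h w * s n w)) \<longlonglongrightarrow> F w * (h w * 1)"
          by (intro tendsto_intros s_lim True)
        then show ?thesis by simp
      qed (simp add: F(2))
    qed
    show "AE w in lborel. norm (F w * (h w * s n w)) \<le> B * \<bar>F w\<bar>" for n
    proof (rule AE_I2)
      fix w
      have "\<bar>h w\<bar> * \<bar>s n w\<bar> \<le> B * 1"
        using h[of w] s01[of n w] by (intro mult_mono) auto
      from mult_left_mono[OF this, of "\<bar>F w\<bar>"]
      show "norm (F w * (h w * s n w)) \<le> B * \<bar>F w\<bar>" by (simp add: abs_mult mult.commute)
    qed
  qed
  have l1: "(\<lambda>n. \<integral>w. UT w * ((grad \<eta> w \<bullet> i) * s n w) \<partial>lborel) \<longlonglongrightarrow> (\<integral>w. UT w * (grad \<eta> w \<bullet> i) \<partial>lborel)"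
  proof (rule lim[OF iU UT(2)])
    show "\<bar>grad \<eta> w \<bullet> i\<bar> \<le> A'" for w
      using A'(2)[of w] Basis_le_norm[OF i, of "grad \<eta> w"] by simp
  qed measurable
  have l2: "(\<lambda>n. \<integral>w. VT w * (\<eta> w * s n w) \<partial>lborel) \<longlonglongrightarrow> (\<integral>w. VT w * \<eta> w \<partial>lborel)"
    by (rule lim[OF iV VT(2) _ A(2)[unfolded real_norm_def]]) measurable
  have l3: "C \<longlonglongrightarrow> 0"
  proof -
    define r where "r n = (\<integral>\<^sup>+ z. ennreal (\<bar>UT z\<bar> * (?q n z)) \<partial>lborel)" for n
    \<comment> \<open>Squares, because the strip estimate comes from Cauchy-Schwarz without
      extracting a root.\<close>
    have Cr: "ennreal ((C n)\<^sup>2) \<le> ennreal ((A * M)\<^sup>2) * (r n)\<^sup>2" for n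
    proof -
      have "ennreal (norm (C n)) \<le> (\<integral>\<^sup>+ w. ennreal (norm (UT w * (?r n w))) \<partial>lborel)"
        unfolding C_def using iC[of n] by (intro integral_norm_bound_ennreal) (simp add: mult.commute)
      also have "\<dots> \<le> (\<integral>\<^sup>+ z. ennreal (A * M) * ennreal (\<bar>UT z\<bar> * (?q n z)) \<partial>lborel)"
      proof (rule nn_integral_mono)
        fix w
        have "\<bar>UT w\<bar> * \<bar>?r n w\<bar>
          \<le> (A * M) * (\<bar>UT w\<bar> * (?q n w))"
          using mult_left_mono[OF Cb[of w n], of "\<bar>UT w\<bar>"] by (simp only: ac_simps abs_ge_zero)
        then show "ennreal (norm (UT w * (?r n w))) \<le>
           ennreal (A * M) * ennreal (\<bar>UT w\<bar> * (?q n w))"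
          using A(1) M(1) by (subst ennreal_mult[symmetric]) (auto simp only: norm_mult real_norm_def abs_mult intro!: ennreal_leI mult_nonneg_nonneg indicator_pos_le)
      qed
      also have "\<dots> = ennreal (A * M) * r n" unfolding r_def by (rule nn_integral_cmult) measurable
      finally have "(ennreal (norm (C n)))\<^sup>2 \<le> (ennreal (A * M) * r n)\<^sup>2" by (rule power_mono) simp
      then show ?thesis using A(1) M(1) by (simp add: power_mult_distrib ennreal_power)
    qed
    have "(\<lambda>n. ennreal ((A * M)\<^sup>2) * (r n)\<^sup>2) \<longlonglongrightarrow> ennreal ((A * M)\<^sup>2) * 0"
      unfolding r_def using c UT by (intro ennreal_tendsto_cmult strip_commutator_tendsto_0) auto
    then have lim: "(\<lambda>n. ennreal ((A * M)\<^sup>2) * (r n)\<^sup>2) \<longlonglongrightarrow> 0" by simp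
    have "(\<lambda>n. ennreal ((C n)\<^sup>2)) \<longlonglongrightarrow> 0"
      by (rule tendsto_sandwich[OF always_eventually always_eventually tendsto_const lim]) (simp_all add: Cr)
    then have "(\<lambda>n. (C n)\<^sup>2) \<longlonglongrightarrow> 0" by (subst (asm) ennreal_tendsto_0_iff) auto
    from tendsto_real_sqrt[OF this] show ?thesis by (simp add: tendsto_rabs_zero_iff)
  qed
  have "(\<integral>w. UT w * (grad \<eta> w \<bullet> i) \<partial>lborel) + 0 = - (\<integral>w. VT w * \<eta> w \<partial>lborel)"
    using tendsto_add[OF l1 l3] tendsto_minus[OF l2] unfolding identity by (rule LIMSEQ_unique)
  moreover have "(\<integral>w. UT w * (grad \<eta> w \<bullet> i) \<partial>lborel) = (\<integral>w. U w * (grad \<eta> w \<bullet> i) \<partial>lborel)"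
    unfolding UT_eq ..
  moreover have "(\<integral>w. VT w * \<eta> w \<partial>lborel) = (\<integral>w. (G w \<bullet> i) * \<eta> w \<partial>lborel)"
    by (rule Bochner_Integration.integral_cong[OF refl]) (metis VT_eq mult.right_neutral)
  ultimately show "(\<integral>w. U w * (grad \<eta> w \<bullet> i) \<partial>lborel) = - (\<integral>w. (G w \<bullet> i) * \<eta> w \<partial>lborel)" by simp
qed

section \<open>Smooth approximation\<close>

lemma bump_zero_outside:
  assumes "0 < e" "w \<notin> cball (z + e *\<^sub>R a) (e / 2)"
  shows "bump (1 / e) a (w - z) = 0"
proof -
  have "w - (z + e *\<^sub>R a) = e *\<^sub>R ((1 / e) *\<^sub>R (w - z) - a)"
    using assms(1) by (simp add: scaleR_diff_right)
  then have "norm (w - (z + e *\<^sub>R a)) = e * norm ((1 / e) *\<^sub>R (w - z) - a)"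
    using assms(1) by simp
  then have "e / 2 < e * norm ((1 / e) *\<^sub>R (w - z) - a)"
    using assms(2) by (simp add: dist_norm norm_minus_commute)
  then have "1 / 2 \<le> norm ((1 / e) *\<^sub>R (w - z) - a)"
    using assms(1) by (simp add: field_simps)
  then show ?thesis unfolding bump_eq_0_iff .
qed

lemma smooth_divide_const: "smooth f \<Longrightarrow> smooth (\<lambda>x. f x / c)"
  using smooth_mult[OF _ smooth_const[of "1 / c"], of f] by simp

lemma grad_translate:
  assumes "smooth \<kappa>"
  shows "grad (\<lambda>w. \<kappa> (w - z)) w = grad \<kappa> (w - z)"
proof (rule grad_eqI)
  have "((\<lambda>w. w - z) has_derivative (\<lambda>h. h)) (at w)" by (auto intro!: derivative_eq_intros)
  from has_derivative_compose[OF this smooth_has_derivative_grad[OF assms]]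
  show "((\<lambda>w. \<kappa> (w - z)) has_derivative (\<bullet>) (grad \<kappa> (w - z))) (at w)" .
qed

text \<open>\<open>T\<close> is a region where \<open>U\<close> is integrable and the weak identity
  holds; cutting \<open>U\<close> off outside \<open>T\<close> makes \<open>v\<close> smooth
  everywhere. Where the kernel ball lies inside \<open>T\<close> the cut is invisible, and testing
  with the translated kernel moves the derivative onto \<open>G\<close>. The conclusions mention
  \<open>cball 0 L\<close> in place of \<open>T\<close> so that the averaged function stays fixed
  when \<open>T\<close> varies with \<open>e\<close>.\<close>

lemma mollified_weak_gradient:
  fixes U :: "'a::euclidean_space \<Rightarrow> real" and G :: "'a \<Rightarrow> 'a" and a :: 'a
  assumes [measurable]: "U \<in> borel_measurable borel" "G \<in> borel_measurable borel" "T \<in> sets borel"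
    and T: "T \<subseteq> cball 0 L" and iU: "integrable lborel (\<lambda>w. indicator T w * U w)"
    and weak: "weak_identity (test_functions T) U G" and e: "0 < e"
  defines "v \<equiv> \<lambda>z. \<integral>w. bump (1 / e) a (w - z) / (bump_mass a * e ^ DIM('a)) * (indicator T w * U w) \<partial>lborel"
  shows "smooth v"
    and "cball (z + e *\<^sub>R a) (e / 2) \<subseteq> T \<Longrightarrow>
      v z = (\<integral>t. indicator (cball 0 L) (z + e *\<^sub>R t) * U (z + e *\<^sub>R t) \<partial>mollifier a)"
    and "cball (z + e *\<^sub>R a) (e / 2) \<subseteq> T \<Longrightarrow> i \<in> Basis \<Longrightarrow>
      grad v z \<bullet> i = (\<integral>t. indicator (cball 0 L) (z + e *\<^sub>R t) * (G (z + e *\<^sub>R t) \<bullet> i) \<partial>mollifier a)"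
proof -
  define \<kappa> where "\<kappa> w = bump (1 / e) a w / (bump_mass a * e ^ DIM('a))" for w
  have \<kappa>: "smooth \<kappa>" unfolding \<kappa>_def by (intro smooth_divide_const smooth_bump)
  have \<kappa>0: "\<kappa> (w - z) = 0" if "w \<notin> cball (z + e *\<^sub>R a) (e / 2)" for w z
    unfolding \<kappa>_def using bump_zero_outside[OF e that] by simp
  have \<kappa>0': "\<kappa> x = 0" if "x \<notin> cball (e *\<^sub>R a) (e / 2)" for x
    using \<kappa>0[of x 0] that by simp
  have v: "v = (\<lambda>z. \<integral>w. \<kappa> (w - z) * (indicator T w * U w) \<partial>lborel)"
    unfolding v_def \<kappa>_def ..
  show "smooth v" unfolding v by (rule smooth_convolution[OF \<kappa> compact_cball \<kappa>0' iU])
  assume sub: "cball (z + e *\<^sub>R a) (e / 2) \<subseteq> T"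
  have [simp]: "indicator T w = (1 :: real)" "indicator (cball 0 L) w = (1 :: real)" if "w \<in> cball (z + e *\<^sub>R a) (e / 2)" for w
    using that sub T by (auto simp del: mem_cball)
  have "v z = (\<integral>w. \<kappa> (w - z) * (indicator (cball 0 L) w * U w) \<partial>lborel)"
    unfolding v
  proof (rule Bochner_Integration.integral_cong[OF refl])
    fix w
    show "\<kappa> (w - z) * (indicator T w * U w) = \<kappa> (w - z) * (indicator (cball 0 L) w * U w)"
      by (cases "w \<in> cball (z + e *\<^sub>R a) (e / 2)") (simp_all add: \<kappa>0 del: mem_cball)
  qed
  also have "\<dots> = (\<integral>t. indicator (cball 0 L) (z + e *\<^sub>R t) * U (z + e *\<^sub>R t) \<partial>mollifier a)"
    unfolding \<kappa>_def by (rule integral_mollifier_eq_convolution[OF _ e, symmetric]) measurable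
  finally show "v z = \<dots>" .
  assume i: "i \<in> Basis"
  define \<eta> where "\<eta> w = \<kappa> (w - z)" for w
  \<comment> \<open>The translated kernel is again a bump, with centre moved by z/e, so its
    smoothness needs no separate argument.\<close>
  have eta_eq: "\<eta> w = bump (1 / e) (a + (1 / e) *\<^sub>R z) w / (bump_mass a * e ^ DIM('a))" for w
    by (simp add: \<eta>_def \<kappa>_def bump_def scaleR_diff_right algebra_simps)
  have \<eta>: "smooth \<eta>" unfolding eta_eq[abs_def] by (intro smooth_divide_const smooth_bump)
  have g: "grad \<eta> w = grad \<kappa> (w - z)" for w unfolding \<eta>_def by (rule grad_translate[OF \<kappa>])
  have g0: "grad \<kappa> (w - z) = 0" if "w \<notin> cball (z + e *\<^sub>R a) (e / 2)" for w
    unfolding g[symmetric] using grad_zero_outside[OF closed_cball _ that, of \<eta>] \<kappa>0 by (simp add: \<eta>_def)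
  have "\<eta> \<in> test_functions T"
    unfolding test_functions_def using \<eta> sub \<kappa>0 by (auto simp: \<eta>_def intro!: exI[of _ "cball (z + e *\<^sub>R a) (e / 2)"])
  with weak i have w: "(\<integral>w. U w * (grad \<eta> w \<bullet> i) \<partial>lborel) = - (\<integral>w. (G w \<bullet> i) * \<eta> w \<partial>lborel)"
    unfolding weak_identity_def by blast
  have "grad v z \<bullet> i = - (\<integral>w. (grad \<kappa> (w - z) \<bullet> i) * (indicator T w * U w) \<partial>lborel)"
    unfolding v by (rule grad_convolution[OF \<kappa> compact_cball \<kappa>0' iU])
  also have "(\<integral>w. (grad \<kappa> (w - z) \<bullet> i) * (indicator T w * U w) \<partial>lborel) = (\<integral>w. U w * (grad \<eta> w \<bullet> i) \<partial>lborel)"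
  proof (rule Bochner_Integration.integral_cong[OF refl])
    fix w
    show "(grad \<kappa> (w - z) \<bullet> i) * (indicator T w * U w) = U w * (grad \<eta> w \<bullet> i)"
      unfolding g by (cases "w \<in> cball (z + e *\<^sub>R a) (e / 2)") (simp_all add: g0 del: mem_cball)
  qed
  also have "- \<dots> = (\<integral>w. \<kappa> (w - z) * (indicator (cball 0 L) w * (G w \<bullet> i)) \<partial>lborel)"
    unfolding w minus_minus
  proof (rule Bochner_Integration.integral_cong[OF refl])
    fix w
    show "(G w \<bullet> i) * \<eta> w = \<kappa> (w - z) * (indicator (cball 0 L) w * (G w \<bullet> i))"
      unfolding \<eta>_def by (cases "w \<in> cball (z + e *\<^sub>R a) (e / 2)") (simp_all add: \<kappa>0 del: mem_cball)
  qed
  also have "\<dots> = (\<integral>t. indicator (cball 0 L) (z + e *\<^sub>R t) * (G (z + e *\<^sub>R t) \<bullet> i) \<partial>mollifier a)"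
    unfolding \<kappa>_def by (rule integral_mollifier_eq_convolution[OF _ e, symmetric]) measurable
  finally show "grad v z \<bullet> i = \<dots>" .
qed

text \<open>On the ball \<open>\<phi>\<close> is at least \<open>m\<close> almost everywhere, so
  dropping it costs at most the factor 1/m.\<close>

lemma wnorm_sq_ball_le:
  fixes f :: "real \<times> (real ^ 'n) \<Rightarrow> real"
  assumes \<phi>: "admissible \<phi>" and [measurable]: "f \<in> borel_measurable borel"
    and m: "0 < m" "AE z :: real \<times> (real ^ 'n) in lborel. norm z \<le> L \<longrightarrow> m \<le> \<phi> (norm z)"
    and fin: "(\<integral>\<^sup>+ z. ennreal ((f z)\<^sup>2) \<partial>borel_weight c \<phi>) < \<infinity>"
  shows "wnorm_sq c (\<lambda>z. indicator (cball 0 L) z * f z) < \<infinity>"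
proof -
  note [measurable] = admissible_measurable[OF \<phi>]
  have "wnorm_sq c (\<lambda>z. indicator (cball 0 L) z * f z)
    \<le> (\<integral>\<^sup>+ z. ennreal (1 / m) * (pow_weight c (fst z) * ennreal (\<phi> (norm z)) * ennreal ((f z)\<^sup>2)) \<partial>lborel)"
    unfolding wnorm_sq_def
  proof (rule nn_integral_mono_AE, use m(2) in eventually_elim)
    fix z :: "real \<times> (real ^ 'n)" assume z: "norm z \<le> L \<longrightarrow> m \<le> \<phi> (norm z)"
    show "pow_weight c (fst z) * ennreal ((indicator (cball 0 L) z * f z)\<^sup>2)
      \<le> ennreal (1 / m) * (pow_weight c (fst z) * ennreal (\<phi> (norm z)) * ennreal ((f z)\<^sup>2))"
    proof (cases "norm z \<le> L")
      case True
      then have "1 \<le> 1 / m * \<phi> (norm z)" using z m(1) by (simp add: field_simps)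
      then have "ennreal 1 \<le> ennreal (1 / m) * ennreal (\<phi> (norm z))"
        using m(1) by (subst ennreal_mult'[symmetric]) (auto intro: ennreal_leI)
      then have "1 * (pow_weight c (fst z) * ennreal ((f z)\<^sup>2)) \<le> (ennreal (1 / m) * ennreal (\<phi> (norm z))) * (pow_weight c (fst z) * ennreal ((f z)\<^sup>2))"
        by (intro mult_right_mono) simp_all
      then show ?thesis using True by (simp add: ac_simps)
    qed simp
  qed
  also have "\<dots> = ennreal (1 / m) * (\<integral>\<^sup>+ z. ennreal ((f z)\<^sup>2) \<partial>borel_weight c \<phi>)"
    by (subst nn_integral_borel_weight[OF \<phi>], measurable, subst nn_integral_cmult) auto
  also have "\<dots> < \<infinity>" using fin by (simp add: ennreal_mult_less_top)
  finally show ?thesis .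
qed

text \<open>Averages of the function truncated at radius \<open>L\<close> converge in the pure power
  norm, and the upper bound \<open>M\<close> on \<open>\<phi>\<close> transfers this to the weight.
  It suffices that \<open>h e\<close> agrees with the average on the part of the half-space inside
  the ball of radius \<open>k\<close>.\<close>

lemma mollified_tendsto:
  fixes f :: "real \<times> (real ^ 'n) \<Rightarrow> real"
  assumes avg: "averaging (mollifier a) c C" and \<phi>: "admissible \<phi>" and [measurable]: "f \<in> borel_measurable borel"
    and f0: "\<And>z. fst z \<le> 0 \<Longrightarrow> f z = 0"
    and fin: "(\<integral>\<^sup>+ z. ennreal ((f z)\<^sup>2) \<partial>borel_weight c \<phi>) < \<infinity>"
    and k: "0 < k" "k \<le> L"
    and hm: "\<And>e. 0 < e \<Longrightarrow> e < 1 \<Longrightarrow> h e \<in> borel_measurable borel"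
    and h: "\<And>e z. 0 < e \<Longrightarrow> e < 1 \<Longrightarrow> norm z \<le> k \<Longrightarrow> 0 < fst z \<Longrightarrow>
      h e z = (\<integral>t. indicator (cball 0 L) (z + e *\<^sub>R t) * f (z + e *\<^sub>R t) \<partial>mollifier a)"
  shows "((\<lambda>e. \<integral>\<^sup>+ z. indicator (cball 0 k) z * ennreal ((h e z - f z)\<^sup>2) \<partial>borel_weight c \<phi>) \<longlongrightarrow> 0) (at_right 0)"
proof -
  interpret averaging "mollifier a" c C by (rule avg)
  note [measurable] = admissible_measurable[OF \<phi>]
  have "0 \<le> L" using k by simp
  from admissible_bounds[OF \<phi> this] obtain m M where mM: "0 < m" "m \<le> M"
    "AE z :: real \<times> (real ^ 'n) in lborel. norm z \<le> L \<longrightarrow> m \<le> \<phi> (norm z) \<and> \<phi> (norm z) \<le> M" by blast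
  define fL where "fL z = indicator (cball 0 L) z * f z" for z
  have [measurable]: "fL \<in> borel_measurable borel" unfolding fL_def by measurable
  have fL: "wnorm_sq c fL < \<infinity>"
    unfolding fL_def[abs_def] using mM by (intro wnorm_sq_ball_le[OF \<phi> _ mM(1) _ fin]) (auto elim: eventually_mono)
  let ?I = "\<lambda>e. \<integral>\<^sup>+ z. indicator (cball 0 k) z * ennreal ((h e z - f z)\<^sup>2) \<partial>borel_weight c \<phi>" and ?A = "\<lambda>e. wnorm_sq c (\<lambda>z. average e fL z - fL z)"
  have lim: "(?A \<longlongrightarrow> 0) (at_right 0)"
    using f0 fL by (intro average_tendsto) (auto simp: fL_def)
  have le: "?I e
    \<le> ennreal M * ?A e" if e: "0 < e" "e < 1" for e
  proof -
    note [measurable] = hm[OF e]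
    have am: "average e fL \<in> borel_measurable borel"
    proof -
      have "(\<lambda>p. fL (fst p + e *\<^sub>R snd p)) \<in> borel_measurable (lborel \<Otimes>\<^sub>M mollifier a)"
        by (rule shift_measurable) measurable
      then have "(\<lambda>z. \<integral>t. fL (z + e *\<^sub>R t) \<partial>mollifier a) \<in> borel_measurable lborel"
        by (intro borel_measurable_lebesgue_integral) (simp add: split_beta')
      then show ?thesis unfolding average_def[abs_def] by simp
    qed
    have "?I e
      = (\<integral>\<^sup>+ z. pow_weight c (fst z) * ennreal (\<phi> (norm z)) * (indicator (cball 0 k) z * ennreal ((h e z - f z)\<^sup>2)) \<partial>lborel)"
      by (rule nn_integral_borel_weight[OF \<phi>]) measurable
    also have "\<dots> \<le> (\<integral>\<^sup>+ z. ennreal M * (pow_weight c (fst z) * ennreal ((average e fL z - fL z)\<^sup>2)) \<partial>lborel)"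
    proof (rule nn_integral_mono_AE, use mM(3) in eventually_elim)
      fix z :: "real \<times> (real ^ 'n)" assume z: "norm z \<le> L \<longrightarrow> m \<le> \<phi> (norm z) \<and> \<phi> (norm z) \<le> M"
      show "pow_weight c (fst z) * ennreal (\<phi> (norm z)) * (indicator (cball 0 k) z * ennreal ((h e z - f z)\<^sup>2))
        \<le> ennreal M * (pow_weight c (fst z) * ennreal ((average e fL z - fL z)\<^sup>2))"
      proof (cases "norm z \<le> k \<and> 0 < fst z")
        case True
        then have eq: "h e z = average e fL z" "f z = fL z"
          using h[OF e, of z] k by (auto simp: average_def fL_def)
        have "ennreal (\<phi> (norm z)) \<le> ennreal M" using z True k by (intro ennreal_leI) auto
        then have "ennreal (\<phi> (norm z)) * (pow_weight c (fst z) * ennreal ((h e z - f z)\<^sup>2))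
            \<le> ennreal M * (pow_weight c (fst z) * ennreal ((h e z - f z)\<^sup>2))"
          by (intro mult_right_mono) simp_all
        then show ?thesis using True unfolding eq by (simp add: ac_simps)
      qed (auto simp: pow_weight_def)
    qed
    also have "\<dots> = ennreal M * ?A e"
    proof -
      note [measurable] = am
      show ?thesis unfolding wnorm_sq_def by (rule nn_integral_cmult) simp
    qed
    finally show ?thesis .
  qed
  have "((\<lambda>e. ennreal M * ?A e) \<longlongrightarrow> ennreal M * 0) (at_right 0)"
    by (intro ennreal_tendsto_cmult lim) simp
  then have lim': "((\<lambda>e. ennreal M * ?A e) \<longlongrightarrow> 0) (at_right 0)" by simp
  have "\<forall>\<^sub>F e in at_right (0::real). 0 < e \<and> e < 1"
    unfolding eventually_at_right_field by (intro exI[of _ 1]) auto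
  then have "\<forall>\<^sub>F e in at_right 0. ?I e
    \<le> ennreal M * ?A e"
    by eventually_elim (use le in blast)
  then show ?thesis by (intro tendsto_sandwich[OF always_eventually _ tendsto_const lim']) simp_all
qed

lemma smooth_approximation:
  fixes U :: "real \<times> (real ^ 'n) \<Rightarrow> real" and G :: "real \<times> (real ^ 'n) \<Rightarrow> real \<times> (real ^ 'n)"
  assumes \<phi>: "admissible \<phi>" and [measurable]: "U \<in> borel_measurable borel" "G \<in> borel_measurable borel"
    and U0: "\<And>z. fst z \<le> 0 \<Longrightarrow> U z = 0" and G0: "\<And>z. fst z \<le> 0 \<Longrightarrow> G z = 0"
    and loc: "\<And>a b. 0 < a \<Longrightarrow> integrable lborel (\<lambda>w. indicator (slab a b) w * U w)"
    and finU: "(\<integral>\<^sup>+ z. ennreal ((U z)\<^sup>2) \<partial>borel_weight c \<phi>) < \<infinity>"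
    and finG: "(\<integral>\<^sup>+ z. ennreal ((norm (G z))\<^sup>2) \<partial>borel_weight c \<phi>) < \<infinity>"
    and weak: "weak_identity (test_functions half_space) U G" and k: "0 < k"
  obtains v :: "real \<Rightarrow> real \<times> (real ^ 'n) \<Rightarrow> real" where
    "\<And>e. 0 < e \<Longrightarrow> smooth (v e)"
    "\<And>e z. c \<le> -1 \<Longrightarrow> 0 < e \<Longrightarrow> fst z < e \<Longrightarrow> v e z = 0"
    "((\<lambda>e. \<integral>\<^sup>+ z. indicator (cball 0 k) z * ennreal ((v e z - U z)\<^sup>2) \<partial>borel_weight c \<phi>) \<longlongrightarrow> 0) (at_right 0)"
    "\<And>i. i \<in> Basis \<Longrightarrow> ((\<lambda>e. \<integral>\<^sup>+ z. indicator (cball 0 k) z * ennreal (((grad (v e) z - G z) \<bullet> i)\<^sup>2) \<partial>borel_weight c \<phi>) \<longlongrightarrow> 0) (at_right 0)"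
proof -
  note conclude = that
  \<comment> \<open>A kernel ball at scale e < 1 reaches at most 3e/2 + e/2 = 2e < 2 from its base
    point, so 3 is enough.\<close>
  define L where "L = k + 3"
  have kL: "k \<le> L" "0 \<le> L" using k by (auto simp: L_def)
  obtain m M where mM: "0 < m" "m \<le> M" "AE z :: real \<times> (real ^ 'n) in lborel. norm z \<le> L \<longrightarrow> m \<le> \<phi> (norm z) \<and> \<phi> (norm z) \<le> M"
    by (rule admissible_bounds[OF \<phi> kL(2)]) blast
  have finGi: "(\<integral>\<^sup>+ z. ennreal ((G z \<bullet> i)\<^sup>2) \<partial>borel_weight c \<phi>) < \<infinity>" if "i \<in> Basis" for i
  proof (rule order.strict_trans1[OF nn_integral_mono finG])
    show "ennreal ((G z \<bullet> i)\<^sup>2) \<le> ennreal ((norm (G z))\<^sup>2)" for z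
      using Basis_le_norm[OF that, of "G z"] by (intro ennreal_leI) (metis abs_le_square_iff abs_norm_cancel)
  qed
  have am: "AE z :: real \<times> (real ^ 'n) in lborel. norm z \<le> L \<longrightarrow> m \<le> \<phi> (norm z)"
    using mM(3) by eventually_elim simp
  \<comment> \<open>Both signs of the shift at once: \<open>s\<close> is the direction, and
    \<open>T e\<close> a region on which \<open>U\<close> is integrable, the weak identity holds and
    the kernel balls remain.\<close>
  have main: thesis if a: "a = (s * (3 / 2), 0)" "\<bar>s\<bar> = 1" and avg: "averaging (mollifier a :: (real \<times> (real ^ 'n)) measure) c C"
    and T: "\<And>e. 0 < e \<Longrightarrow> T e \<in> sets borel" "\<And>e. 0 < e \<Longrightarrow> T e \<subseteq> cball 0 L"
      "\<And>e. 0 < e \<Longrightarrow> integrable lborel (\<lambda>w. indicator (T e) w * U w)"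
      "\<And>e. 0 < e \<Longrightarrow> weak_identity (test_functions (T e)) U G"
      "\<And>e z. 0 < e \<Longrightarrow> e < 1 \<Longrightarrow> norm z \<le> k \<Longrightarrow> 0 < fst z \<Longrightarrow> cball (z + e *\<^sub>R a) (e / 2) \<subseteq> T e"
      and van: "c \<le> -1 \<Longrightarrow> s = -1"
    for a :: "real \<times> (real ^ 'n)" and s C T
  proof -
    define v where "v e = (\<lambda>z. \<integral>w. bump (1 / e) a (w - z) / (bump_mass a * e ^ DIM(real \<times> (real ^ 'n))) * (indicator (T e) w * U w) \<partial>lborel)" for e
    note moll = mollified_weak_gradient[OF assms(2,3) T(1) T(2) T(3) T(4)]
    have sm: "smooth (v e)" if "0 < e" for e
      unfolding v_def by (rule moll(1)[OF that that that that that])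
    have v_eq: "v e z = (\<integral>t. indicator (cball 0 L) (z + e *\<^sub>R t) * U (z + e *\<^sub>R t) \<partial>mollifier a)"
      if "0 < e" "e < 1" "norm z \<le> k" "0 < fst z" for e z
      unfolding v_def by (rule moll(2)[OF that(1,1,1,1,1) T(5)[OF that]])
    have grad_eq: "grad (v e) z \<bullet> i = (\<integral>t. indicator (cball 0 L) (z + e *\<^sub>R t) * (G (z + e *\<^sub>R t) \<bullet> i) \<partial>mollifier a)"
      if "0 < e" "e < 1" "norm z \<le> k" "0 < fst z" "i \<in> Basis" for e z i
      unfolding v_def by (rule moll(3)[OF that(1,1,1,1,1) T(5)[OF that(1-4)] that(5)])
    show thesis
    proof (rule conclude[of v])
      show "smooth (v e)" if "0 < e" for e using sm that .
      show "v e z = 0" if "c \<le> -1" "0 < e" "fst z < e" for e z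
      proof -
        \<comment> \<open>For the downward kernel, points in its ball have height at most y - 3e/2 +
          e/2 = y - e, which is negative when y < e; there \<open>U\<close> is 0.\<close>
        have "bump (1 / e) a (w - z) / (bump_mass a * e ^ DIM(real \<times> (real ^ 'n))) * (indicator (T e) w * U w) = 0" for w
        proof (cases "w \<in> cball (z + e *\<^sub>R a) (e / 2)")
          case True
          have "fst (w - (z + e *\<^sub>R a)) = fst w - fst z + e * (3 / 2)" using a(1) van[OF that(1)] by simp
          moreover have "\<bar>fst (w - (z + e *\<^sub>R a))\<bar> \<le> e / 2"
            using True abs_fst_le_norm[of "w - (z + e *\<^sub>R a)"] by (simp add: dist_norm norm_minus_commute)
          ultimately have "fst w \<le> 0" using that by linarith
          then show ?thesis by (simp add: U0)
        next
          case False
          then show ?thesis using bump_zero_outside[OF that(2) False] by simp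
        qed
        then show ?thesis unfolding v_def by (simp only: Bochner_Integration.integral_zero)
      qed
      have vm: "v e \<in> borel_measurable borel" "(\<lambda>z. grad (v e) z \<bullet> i) \<in> borel_measurable borel" if "0 < e" for e i
        using smooth_measurable[OF sm[OF that]] grad_measurable[OF sm[OF that]]
        by (auto intro!: borel_measurable_inner)
      show "((\<lambda>e. \<integral>\<^sup>+ z. indicator (cball 0 k) z * ennreal ((v e z - U z)\<^sup>2) \<partial>borel_weight c \<phi>) \<longlongrightarrow> 0) (at_right 0)"
        by (rule mollified_tendsto[OF avg \<phi> assms(2) U0 finU k kL(1) vm(1)])
          (auto intro!: v_eq)
      show "((\<lambda>e. \<integral>\<^sup>+ z. indicator (cball 0 k) z * ennreal (((grad (v e) z - G z) \<bullet> i)\<^sup>2) \<partial>borel_weight c \<phi>) \<longlongrightarrow> 0) (at_right 0)"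
        if i: "i \<in> Basis" for i
        unfolding inner_diff_left
        by (rule mollified_tendsto[OF avg \<phi> _ _ finGi[OF i] k kL(1) vm(2)])
          (auto intro!: grad_eq i simp: G0)
    qed
  qed
  have ball: "norm w \<le> L" if "w \<in> cball (z + e *\<^sub>R (s * (3 / 2), 0)) (e / 2)" "norm z \<le> k" "0 < e" "e < 1" "\<bar>s\<bar> = 1"
    for w z :: "real \<times> (real ^ 'n)" and e s :: real
  proof -
    have "norm w \<le> norm (w - (z + e *\<^sub>R (s * (3 / 2), 0))) + norm (z + e *\<^sub>R (s * (3 / 2), 0 :: real ^ 'n))"
      using norm_triangle_ineq[of "w - (z + e *\<^sub>R (s * (3 / 2), 0))" "z + e *\<^sub>R (s * (3 / 2), 0)"] by simp
    moreover have "norm (z + e *\<^sub>R (s * (3 / 2), 0 :: real ^ 'n)) \<le> norm z + e * (3 / 2)"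
      using norm_triangle_ineq[of z "e *\<^sub>R (s * (3 / 2), 0)"] that(3,5) by (simp add: norm_Pair abs_mult)
    moreover have "norm (w - (z + e *\<^sub>R (s * (3 / 2), 0))) \<le> e / 2"
      using that(1) by (simp add: dist_norm norm_minus_commute)
    ultimately show ?thesis using that unfolding L_def by linarith
  qed
  show thesis
  proof (cases "c \<le> -1")
    case True
    have UL: "wnorm_sq c (\<lambda>z. indicator (cball 0 L) z * U z) < \<infinity>"
      by (rule wnorm_sq_ball_le[OF \<phi> _ mM(1) am finU]) measurable
    have GL: "wnorm_sq c (\<lambda>z. indicator (cball 0 L) z * (G z \<bullet> i)) < \<infinity>" if "i \<in> Basis" for i
      by (rule wnorm_sq_ball_le[OF \<phi> _ mM(1) am finGi[OF that]]) measurable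
    show thesis
    \<comment> \<open>Here \<open>T e\<close> is the full ball: the kernel crosses y = 0, so the
      weak identity up to the boundary is indispensable.\<close>
    proof (rule main[of _ "-1", OF refl])
      show "averaging (mollifier (- 1 * (3 / 2), 0) :: (real \<times> (real ^ 'n)) measure) c 1"
        using averaging_mollifier_down[of c, where 'b="real ^ 'n"] True by simp
      show "integrable lborel (\<lambda>w. indicator (cball 0 L) w * U w)"
        by (rule integrable_of_wnorm_sq[OF _ _ _ _ UL, of L]) (use True U0 in auto)
      show "weak_identity (test_functions (cball 0 L)) U G"
        by (rule weak_identity_up_to_boundary[OF True assms(2,3) U0 G0 UL GL weak])
      show "cball (z + e *\<^sub>R (- 1 * (3 / 2), 0)) (e / 2) \<subseteq> cball 0 L"
        if "0 < e" "e < 1" "norm z \<le> k" for e and z :: "real \<times> (real ^ 'n)"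
        using ball[of _ z e "-1"] that by auto
    qed auto
  next
    case False
    then have "-1 < c" by simp
    from averaging_mollifier_up[OF this]
    obtain C where C: "averaging (mollifier (3 / 2, 0) :: (real \<times> (real ^ 'n)) measure) c C" .
    show thesis
    \<comment> \<open>Here \<open>T e\<close> is \<open>slab e L\<close>: from a point of positive
      height the kernel sees only heights above 3e/2 - e/2 = e, a compact part of the open
      half-space.\<close>
    proof (rule main[of _ 1, OF refl])
      show "averaging (mollifier (1 * (3 / 2), 0) :: (real \<times> (real ^ 'n)) measure) c C"
        using C by simp
      show "integrable lborel (\<lambda>w. indicator (slab e L) w * U w)" if "0 < e" for e
        using loc[OF that] .
      show "weak_identity (test_functions (slab e L)) U G" if "0 < e" for e
      proof -
        have "slab e L \<subseteq> (half_space :: (real \<times> (real ^ 'n)) set)"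
          using that by (auto simp: slab_def half_space_def)
        then have "test_functions (slab e L) \<subseteq> test_functions (half_space :: (real \<times> (real ^ 'n)) set)"
          unfolding test_functions_def by blast
        then show ?thesis using weak unfolding weak_identity_def by blast
      qed
      show "cball (z + e *\<^sub>R (1 * (3 / 2), 0)) (e / 2) \<subseteq> slab e L"
        if "0 < e" "e < 1" "norm z \<le> k" "0 < fst z" for e and z :: "real \<times> (real ^ 'n)"
      proof
        fix w assume w: "w \<in> cball (z + e *\<^sub>R (1 * (3 / 2), 0)) (e / 2)"
        then have "\<bar>fst (w - (z + e *\<^sub>R (1 * (3 / 2), 0 :: real ^ 'n)))\<bar> \<le> e / 2"
          using abs_fst_le_norm[of "w - (z + e *\<^sub>R (1 * (3 / 2), 0))"] by (simp add: dist_norm norm_minus_commute)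
        then have "\<bar>fst w - fst z - e * (3 / 2)\<bar> \<le> e / 2" by (simp add: algebra_simps)
        then have "e \<le> fst w" using that(4) by linarith
        then show "w \<in> slab e L" using ball[OF w that(3,1,2)] by (simp add: slab_def)
      qed
    qed (use False in \<open>auto simp: slab_def\<close>)
  qed
qed

section \<open>Energy estimates for cut-off functions\<close>

text \<open>Young's inequality with a parameter: a small \<open>s\<close> keeps the factor of the
  main term near 1 at the expense of the other.\<close>

lemma norm_add_sq_le:
  fixes x y :: "'a::real_inner"
  assumes s: "0 < s"
  shows "(norm (x + y))\<^sup>2 \<le> (1 + s) * (norm x)\<^sup>2 + (1 + 1 / s) * (norm y)\<^sup>2"
proof -
  have "(norm (x + y))\<^sup>2 \<le> (norm x + norm y)\<^sup>2"
    by (intro power_mono norm_triangle_ineq) simp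
  moreover have "(norm x + norm y)\<^sup>2 = (norm x)\<^sup>2 + 2 * norm x * norm y + (norm y)\<^sup>2"
    by (simp add: power2_sum)
  moreover have "2 * norm x * norm y \<le> s * (norm x)\<^sup>2 + (1 / s) * (norm y)\<^sup>2"
    using zero_le_power2[of "s * norm x - norm y"] s
    by (simp add: field_simps power2_eq_square)
  ultimately show ?thesis by (simp add: distrib_right)
qed

text \<open>Read \<open>x\<close>, \<open>b\<close> as value and gradient of the cut-off,
  \<open>y\<close>, \<open>g\<close> as those of the smooth approximation, \<open>d\<close>,
  \<open>h\<close> as those of the limit. Using \<open>\<beta>\<close> both as gradient bound and as
  Young parameter makes the coefficients of the limit tend to 1 when \<open>\<beta>\<close> tends to
  0.\<close>

lemma cutoff_energy_le:
  fixes x y d :: real and g h b :: "'a::real_inner"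
  assumes \<beta>: "0 < \<beta>" and x: "0 \<le> x" "x \<le> 1" and b: "norm b \<le> \<beta>"
  shows "(norm (x *\<^sub>R g + y *\<^sub>R b))\<^sup>2 + (x * y)\<^sup>2
    \<le> (1 + \<beta>)\<^sup>2 * (norm h)\<^sup>2 + (1 + \<beta> + \<beta>\<^sup>2) * (1 + \<beta>) * d\<^sup>2
      + (1 + \<beta> + \<beta>\<^sup>2) * (1 + 1 / \<beta>) * ((norm (g - h))\<^sup>2 + (y - d)\<^sup>2)"
proof -
  have x2: "x\<^sup>2 \<le> 1" using x by (simp add: power_le_one)
  have c: "0 \<le> 1 + 1 / \<beta>" "0 \<le> 1 + \<beta>" "0 \<le> 1 + \<beta> + \<beta>\<^sup>2" using \<beta> by simp_all
  have Y: "y\<^sup>2 \<le> (1 + \<beta>) * d\<^sup>2 + (1 + 1 / \<beta>) * (y - d)\<^sup>2"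
    using norm_add_sq_le[OF \<beta>, of d "y - d"] by simp
  have Gh: "(norm g)\<^sup>2 \<le> (1 + \<beta>) * (norm h)\<^sup>2 + (1 + 1 / \<beta>) * (norm (g - h))\<^sup>2"
    using norm_add_sq_le[OF \<beta>, of h "g - h"] by simp
  have n1: "(norm (x *\<^sub>R g))\<^sup>2 \<le> (norm g)\<^sup>2"
    using x2 by (simp add: power_mult_distrib mult_left_le_one_le)
  have "(norm b)\<^sup>2 \<le> \<beta>\<^sup>2" using b by (intro power_mono) auto
  then have n2: "(norm (y *\<^sub>R b))\<^sup>2 \<le> \<beta>\<^sup>2 * y\<^sup>2"
    using mult_right_mono[of "(norm b)\<^sup>2" "\<beta>\<^sup>2" "y\<^sup>2"] by (simp add: power_mult_distrib mult.commute)
  have "(norm (x *\<^sub>R g + y *\<^sub>R b))\<^sup>2 \<le> (1 + \<beta>) * (norm (x *\<^sub>R g))\<^sup>2 + (1 + 1 / \<beta>) * (norm (y *\<^sub>R b))\<^sup>2"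
    by (rule norm_add_sq_le[OF \<beta>])
  also have "\<dots> \<le> (1 + \<beta>) * (norm g)\<^sup>2 + (1 + 1 / \<beta>) * (\<beta>\<^sup>2 * y\<^sup>2)"
    by (intro add_mono mult_left_mono n1 n2 c)
  \<comment> \<open>The large factor 1 + 1/\<open>\<beta>\<close> meets the square of the cut-off
    gradient, and the product is still small.\<close>
  also have "(1 + 1 / \<beta>) * (\<beta>\<^sup>2 * y\<^sup>2) = (\<beta> + \<beta>\<^sup>2) * y\<^sup>2"
    using \<beta> by (simp add: field_simps power2_eq_square)
  finally have 1: "(norm (x *\<^sub>R g + y *\<^sub>R b))\<^sup>2 \<le> (1 + \<beta>) * (norm g)\<^sup>2 + (\<beta> + \<beta>\<^sup>2) * y\<^sup>2" .
  have "(x * y)\<^sup>2 \<le> y\<^sup>2" using x2 by (simp add: power_mult_distrib mult_left_le_one_le)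
  with 1 have "(norm (x *\<^sub>R g + y *\<^sub>R b))\<^sup>2 + (x * y)\<^sup>2 \<le> (1 + \<beta>) * (norm g)\<^sup>2 + (1 + \<beta> + \<beta>\<^sup>2) * y\<^sup>2"
    by (simp add: distrib_right)
  also have "\<dots> \<le> (1 + \<beta>) * ((1 + \<beta>) * (norm h)\<^sup>2 + (1 + 1 / \<beta>) * (norm (g - h))\<^sup>2)
      + (1 + \<beta> + \<beta>\<^sup>2) * ((1 + \<beta>) * d\<^sup>2 + (1 + 1 / \<beta>) * (y - d)\<^sup>2)"
    by (intro add_mono mult_left_mono Y Gh c)
  finally have "(norm (x *\<^sub>R g + y *\<^sub>R b))\<^sup>2 + (x * y)\<^sup>2
    \<le> (1 + \<beta>) * ((1 + \<beta>) * (norm h)\<^sup>2 + (1 + 1 / \<beta>) * (norm (g - h))\<^sup>2)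
      + (1 + \<beta> + \<beta>\<^sup>2) * ((1 + \<beta>) * d\<^sup>2 + (1 + 1 / \<beta>) * (y - d)\<^sup>2)" .
  \<comment> \<open>Raises the smaller coefficient in front of the gradient error, so that both
    errors share the factor q r.\<close>
  moreover have "p * (p * H + r * X) + q * (p * D + r * Y) \<le> p\<^sup>2 * H + q * p * D + q * r * (X + Y)"
    if "p \<le> q" "0 \<le> r" "0 \<le> X" for p q r H X D Y :: real
    using mult_right_mono[OF that(1) mult_nonneg_nonneg[OF that(2,3)]]
    by (simp add: algebra_simps power2_eq_square)
  from this[of "1 + \<beta>" "1 + \<beta> + \<beta>\<^sup>2" "1 + 1 / \<beta>" "(norm (g - h))\<^sup>2"] c(1)
  have "(1 + \<beta>) * ((1 + \<beta>) * (norm h)\<^sup>2 + (1 + 1 / \<beta>) * (norm (g - h))\<^sup>2)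
      + (1 + \<beta> + \<beta>\<^sup>2) * ((1 + \<beta>) * d\<^sup>2 + (1 + 1 / \<beta>) * (y - d)\<^sup>2)
    \<le> (1 + \<beta>)\<^sup>2 * (norm h)\<^sup>2 + (1 + \<beta> + \<beta>\<^sup>2) * (1 + \<beta>) * d\<^sup>2
      + (1 + \<beta> + \<beta>\<^sup>2) * (1 + 1 / \<beta>) * ((norm (g - h))\<^sup>2 + (y - d)\<^sup>2)"
    by simp
  ultimately show ?thesis by (rule order.trans)
qed

lemma norm_sq_eq_sum_Basis: "(norm x)\<^sup>2 = (\<Sum>i\<in>Basis. (x \<bullet> i)\<^sup>2)" for x :: "'a::euclidean_space"
  by (metis (no_types, lifting) euclidean_inner power2_eq_square power2_norm_eq_inner sum.cong)

lemma tail_coercive_borel: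
  fixes w :: "real \<times> (real ^ 'n) \<Rightarrow> real"
  assumes \<phi>: "admissible \<phi>" and tc: "tail_coercive (weighted_measure c \<phi> :: (real \<times> (real ^ 'n)) measure) c \<Psi> C"
    and m: "\<And>z :: real \<times> (real ^ 'n). z \<in> half_space \<Longrightarrow> R \<le> norm z \<Longrightarrow> m \<le> \<Psi> (norm z)" "0 \<le> m"
    and w: "smooth w" "\<And>z. z \<notin> cball 0 k \<Longrightarrow> w z = 0"
    and van: "c \<le> -1 \<Longrightarrow> vanishes_near_boundary w"
  shows "ennreal m * (\<integral>\<^sup>+ z. indicator {z. R < norm z} z * ennreal ((w z)\<^sup>2) \<partial>borel_weight c \<phi>)
    \<le> ennreal C * (\<integral>\<^sup>+ z. ennreal ((norm (grad w z))\<^sup>2 + (w z)\<^sup>2) \<partial>borel_weight c \<phi>)"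
proof -
  let ?g = "\<lambda>z. ennreal ((norm (grad w z))\<^sup>2 + (w z)\<^sup>2)" and ?t = "\<lambda>z. indicator {z. R < norm z} z * ennreal ((w z)\<^sup>2)"
  note [measurable] = smooth_measurable[OF w(1)] grad_measurable[OF w(1)]
  have "compact (cball 0 k \<inter> closed_half_space :: (real \<times> (real ^ 'n)) set)"
    unfolding closed_half_space_def
    by (intro compact_Int_closed compact_cball closed_Collect_le continuous_intros)
  moreover have "\<forall>x\<in>closed_half_space - cball 0 k \<inter> closed_half_space. w x = 0"
    using w(2) by blast
  ultimately have "w \<in> Cc_infty closed_half_space"
    unfolding Cc_infty_def using w(1) by blast
  with tc van have TC: "(\<integral>\<^sup>+ z. ennreal (\<Psi> (norm z) * (w z)\<^sup>2) \<partial>weighted_measure c \<phi>)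
      \<le> ennreal C * (\<integral>\<^sup>+ z. ?g z \<partial>weighted_measure c \<phi>)"
    unfolding tail_coercive_def by blast
  have "ennreal m * (\<integral>\<^sup>+ z. ?t z \<partial>borel_weight c \<phi>)
      = (\<integral>\<^sup>+ z. ennreal m * (?t z) \<partial>borel_weight c \<phi>)"
    by (rule nn_integral_cmult[symmetric]) measurable
  also have "\<dots> = (\<integral>\<^sup>+ z. ennreal m * (?t z) \<partial>weighted_measure c \<phi>)"
    by (rule nn_integral_weighted_measure[OF \<phi>, symmetric]) measurable
  also have "\<dots> \<le> (\<integral>\<^sup>+ z. ennreal (\<Psi> (norm z) * (w z)\<^sup>2) \<partial>weighted_measure c \<phi>)"
  proof (rule nn_integral_mono)
    fix z :: "real \<times> (real ^ 'n)" assume "z \<in> space (weighted_measure c \<phi>)"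
    then have z: "z \<in> half_space" by (simp add: weighted_measure_def space_restrict_space)
    show "ennreal m * (?t z) \<le> ennreal (\<Psi> (norm z) * (w z)\<^sup>2)"
    proof (cases "R < norm z")
      case True
      then have "m * (w z)\<^sup>2 \<le> \<Psi> (norm z) * (w z)\<^sup>2" using m(1)[OF z] by (intro mult_right_mono) auto
      then have "ennreal (m * (w z)\<^sup>2) \<le> ennreal (\<Psi> (norm z) * (w z)\<^sup>2)" by (rule ennreal_leI)
      then show ?thesis using True m(2) by (simp add: ennreal_mult)
    qed simp
  qed
  also note TC
  also have "(\<integral>\<^sup>+ z. ?g z \<partial>weighted_measure c \<phi>)
    = (\<integral>\<^sup>+ z. ?g z \<partial>borel_weight c \<phi>)"
    by (rule nn_integral_weighted_measure[OF \<phi>]) measurable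
  finally show ?thesis .
qed

text \<open>The inner limit: (TC) is applied to the cut-off times the smooth approximation at scale
  \<open>e\<close>. The errors \<open>d1\<close> and \<open>d2\<close> have coefficients that are
  large in 1/\<open>\<beta>\<close> but independent of \<open>e\<close>, so they drop out as
  \<open>e\<close> tends to 0.\<close>

lemma cutoff_tail_estimate:
  fixes U :: "real \<times> (real ^ 'n) \<Rightarrow> real" and G :: "real \<times> (real ^ 'n) \<Rightarrow> real \<times> (real ^ 'n)"
  assumes \<phi>: "admissible \<phi>" and tc: "tail_coercive (weighted_measure c \<phi> :: (real \<times> (real ^ 'n)) measure) c \<Psi> C"
    and m: "\<And>z :: real \<times> (real ^ 'n). z \<in> half_space \<Longrightarrow> R \<le> norm z \<Longrightarrow> m \<le> \<Psi> (norm z)" "0 \<le> m"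
    and [measurable]: "U \<in> borel_measurable borel" "G \<in> borel_measurable borel"
    and U0: "\<And>z. fst z \<le> 0 \<Longrightarrow> U z = 0" and G0: "\<And>z. fst z \<le> 0 \<Longrightarrow> G z = 0"
    and loc: "\<And>a b. 0 < a \<Longrightarrow> integrable lborel (\<lambda>w. indicator (slab a b) w * U w)"
    and EU: "(\<integral>\<^sup>+ z. ennreal ((U z)\<^sup>2) \<partial>borel_weight c \<phi>) = ennreal EU"
    and EG: "(\<integral>\<^sup>+ z. ennreal ((norm (G z))\<^sup>2) \<partial>borel_weight c \<phi>) = ennreal EG"
    and weak: "weak_identity (test_functions half_space) U G" and k: "0 < k"
    and \<zeta>: "smooth \<zeta>" "\<And>z. z \<notin> cball 0 k \<Longrightarrow> \<zeta> z = 0" "\<And>z. 0 \<le> \<zeta> z" "\<And>z. \<zeta> z \<le> 1"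
      "\<And>z. norm (grad \<zeta> z) \<le> \<beta>" and \<beta>: "0 < \<beta>"
  shows "ennreal m * (\<integral>\<^sup>+ z. indicator {z. R < norm z} z * ennreal ((\<zeta> z * U z)\<^sup>2) \<partial>borel_weight c \<phi>)
    \<le> ennreal (1 + \<beta>) * (ennreal C * (ennreal ((1 + \<beta>)\<^sup>2) * ennreal EG + ennreal ((1 + \<beta> + \<beta>\<^sup>2) * (1 + \<beta>)) * ennreal EU))"
proof (rule smooth_approximation[where c=c, OF \<phi> assms(5,6) U0 G0 loc _ _ weak k])
  let ?N = "borel_weight c \<phi> :: (real \<times> (real ^ 'n)) measure"
  let ?R = "\<lambda>z :: real \<times> (real ^ 'n). indicator {z. R < norm z} z :: ennreal"
  let ?B = "\<lambda>z :: real \<times> (real ^ 'n). indicator (cball 0 k) z :: ennreal"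
  let ?T = "\<lambda>f. \<integral>\<^sup>+ z. ?R z * ennreal ((f z)\<^sup>2) \<partial>?N"
  let ?p = "(1 + \<beta> + \<beta>\<^sup>2) * (1 + \<beta>)"
  let ?q = "(1 + \<beta> + \<beta>\<^sup>2) * (1 + 1 / \<beta>)"
  show "(\<integral>\<^sup>+ z. ennreal ((U z)\<^sup>2) \<partial>?N) < \<infinity>" "(\<integral>\<^sup>+ z. ennreal ((norm (G z))\<^sup>2) \<partial>?N) < \<infinity>"
    by (simp_all add: EU EG)
  fix v :: "real \<Rightarrow> real \<times> (real ^ 'n) \<Rightarrow> real"
  let ?F = "\<lambda>e i z. ennreal (((grad (v e) z - G z) \<bullet> i)\<^sup>2)"
  let ?D = "\<lambda>e z. ennreal ((v e z - U z)\<^sup>2)" and ?E = "\<lambda>e z. ennreal ((norm (grad (v e) z - G z))\<^sup>2)"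
  assume v: "\<And>e. 0 < e \<Longrightarrow> smooth (v e)"
    "\<And>e z. c \<le> -1 \<Longrightarrow> 0 < e \<Longrightarrow> fst z < e \<Longrightarrow> v e z = 0"
    "((\<lambda>e. \<integral>\<^sup>+ z. ?B z * ?D e z \<partial>?N) \<longlongrightarrow> 0) (at_right 0)"
    "\<And>i. i \<in> Basis \<Longrightarrow> ((\<lambda>e. \<integral>\<^sup>+ z. ?B z * ?F e i z \<partial>?N) \<longlongrightarrow> 0) (at_right 0)"
  note [measurable] = smooth_measurable[OF \<zeta>(1)]
  define d1 where "d1 e = (\<integral>\<^sup>+ z. ?B z * ?D e z \<partial>?N)" for e
  define d2 where "d2 e = (\<integral>\<^sup>+ z. ?B z * ?E e z \<partial>?N)" for e
  define q where "q = ennreal (?q)"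
  define A where "A = ennreal ((1 + \<beta>)\<^sup>2) * ennreal EG + ennreal (?p) * ennreal EU"
  have nonneg: "0 \<le> (1 + \<beta>)\<^sup>2" "0 \<le> ?p" "0 \<le> ?q" "0 \<le> 1 + \<beta>" "0 \<le> 1 + 1 / \<beta>"
    using \<beta> by simp_all
  have le: "ennreal m * (?T (\<lambda>z. \<zeta> z * U z))
      \<le> ennreal (1 + \<beta>) * (ennreal C * (A + q * (d2 e + d1 e))) + ennreal (1 + 1 / \<beta>) * (ennreal m * d1 e)"
    if e: "0 < e" for e
  proof -
    note sm = v(1)[OF e]
    note [measurable] = smooth_measurable[OF sm] grad_measurable[OF sm]
    define w where "w z = \<zeta> z * v e z" for z
    have w: "smooth w" unfolding w_def by (intro smooth_mult \<zeta> sm)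
    have wm [measurable]: "w \<in> borel_measurable borel" unfolding w_def by measurable
    have w0: "w z = 0" if "z \<notin> cball 0 k" for z using \<zeta>(2)[OF that] by (simp add: w_def)
    have "vanishes_near_boundary w" if "c \<le> -1"
      unfolding vanishes_near_boundary_def w_def using v(2)[OF that e] e by auto
    from tail_coercive_borel[OF \<phi> tc m w w0 this]
    have TC: "ennreal m * (?T w)
      \<le> ennreal C * (\<integral>\<^sup>+ z. ennreal ((norm (grad w z))\<^sup>2 + (w z)\<^sup>2) \<partial>?N)" .
    have "(\<integral>\<^sup>+ z. ennreal ((norm (grad w z))\<^sup>2 + (w z)\<^sup>2) \<partial>?N)
      \<le> (\<integral>\<^sup>+ z. ennreal ((1 + \<beta>)\<^sup>2) * ennreal ((norm (G z))\<^sup>2) + ennreal (?p) * ennreal ((U z)\<^sup>2)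
          + q * (?B z * ?E e z + ?B z * ?D e z) \<partial>?N)"
    proof (rule nn_integral_mono)
      fix z :: "real \<times> (real ^ 'n)"
      show "ennreal ((norm (grad w z))\<^sup>2 + (w z)\<^sup>2)
        \<le> ennreal ((1 + \<beta>)\<^sup>2) * ennreal ((norm (G z))\<^sup>2) + ennreal (?p) * ennreal ((U z)\<^sup>2)
          + q * (?B z * ?E e z + ?B z * ?D e z)"
      proof (cases "z \<in> cball 0 k")
        case True
        have "grad w z = \<zeta> z *\<^sub>R grad (v e) z + v e z *\<^sub>R grad \<zeta> z"
          unfolding w_def by (rule grad_mult[OF \<zeta>(1) sm])
        then have "(norm (grad w z))\<^sup>2 + (w z)\<^sup>2 \<le> (1 + \<beta>)\<^sup>2 * (norm (G z))\<^sup>2 + ?p * (U z)\<^sup>2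
          + ?q * ((norm (grad (v e) z - G z))\<^sup>2 + (v e z - U z)\<^sup>2)"
          unfolding w_def using cutoff_energy_le[OF \<beta> \<zeta>(3,4,5)] by simp
        from ennreal_leI[OF this] show ?thesis
          using True nonneg unfolding q_def
          by (simp only: ennreal_plus ennreal_mult mult_nonneg_nonneg add_nonneg_nonneg zero_le_power2 indicator_simps if_True mult_1)
      next
        case False
        then have "grad w z = 0" "w z = 0" using grad_zero_outside[OF closed_cball w0 False] w0 by auto
        then show ?thesis by simp
      qed
    qed
    also have "\<dots> = A + q * (d2 e + d1 e)"
      unfolding A_def EU[symmetric] EG[symmetric] d1_def d2_def
      by (simp add: nn_integral_add nn_integral_cmult)
    finally have energy: "(\<integral>\<^sup>+ z. ennreal ((norm (grad w z))\<^sup>2 + (w z)\<^sup>2) \<partial>?N) \<le> A + q * (d2 e + d1 e)" .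
    have "(?T (\<lambda>z. \<zeta> z * U z))
      \<le> (\<integral>\<^sup>+ z. ennreal (1 + \<beta>) * (?R z * ennreal ((w z)\<^sup>2)) + ennreal (1 + 1 / \<beta>) * (?B z * ?D e z) \<partial>?N)"
    proof (rule nn_integral_mono)
      fix z :: "real \<times> (real ^ 'n)"
      show "?R z * ennreal ((\<zeta> z * U z)\<^sup>2) \<le> ennreal (1 + \<beta>) * (?R z * ennreal ((w z)\<^sup>2)) + ennreal (1 + 1 / \<beta>) * (?B z * ?D e z)"
      proof (cases "z \<in> cball 0 k \<and> R < norm z")
        case True
        \<comment> \<open>The tail of the limit function is split into the function known to satisfy
          the estimate and the approximation error.\<close>
        have "w z + \<zeta> z * (U z - v e z) = \<zeta> z * U z" by (simp add: w_def right_diff_distrib)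
        then have "(\<zeta> z * U z)\<^sup>2 \<le> (1 + \<beta>) * (w z)\<^sup>2 + (1 + 1 / \<beta>) * (\<zeta> z * (U z - v e z))\<^sup>2"
          using norm_add_sq_le[OF \<beta>, of "w z" "\<zeta> z * (U z - v e z)"] by (simp only: real_norm_def power2_abs)
        also have "\<dots> \<le> (1 + \<beta>) * (w z)\<^sup>2 + (1 + 1 / \<beta>) * (v e z - U z)\<^sup>2"
          using \<zeta>(3,4)[of z]
          by (intro add_left_mono mult_left_mono nonneg)
            (simp add: power_mult_distrib power2_commute mult_left_le_one_le power_le_one)
        finally have "(\<zeta> z * U z)\<^sup>2 \<le> (1 + \<beta>) * (w z)\<^sup>2 + (1 + 1 / \<beta>) * (v e z - U z)\<^sup>2" .
        from ennreal_leI[OF this]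
        have "ennreal ((\<zeta> z * U z)\<^sup>2) \<le> ennreal (1 + \<beta>) * ennreal ((w z)\<^sup>2) + ennreal (1 + 1 / \<beta>) * ?D e z"
          using nonneg by (simp only: ennreal_plus[OF mult_nonneg_nonneg mult_nonneg_nonneg] ennreal_mult zero_le_power2)
        then show ?thesis using True by simp
      next
        case False
        then show ?thesis using \<zeta>(2)[of z] by (cases "R < norm z") auto
      qed
    qed
    also have "\<dots> = ennreal (1 + \<beta>) * (?T w) + ennreal (1 + 1 / \<beta>) * d1 e"
      unfolding d1_def by (simp add: nn_integral_add nn_integral_cmult)
    finally have "ennreal m * (?T (\<lambda>z. \<zeta> z * U z))
      \<le> ennreal m * (ennreal (1 + \<beta>) * (?T w) + ennreal (1 + 1 / \<beta>) * d1 e)"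
      by (rule mult_left_mono) simp
    also have "\<dots> = ennreal (1 + \<beta>) * (ennreal m * (?T w)) + ennreal (1 + 1 / \<beta>) * (ennreal m * d1 e)"
      by (simp only: distrib_left mult.left_commute)
    also have "\<dots> \<le> ennreal (1 + \<beta>) * (ennreal C * (A + q * (d2 e + d1 e))) + ennreal (1 + 1 / \<beta>) * (ennreal m * d1 e)"
      by (intro add_right_mono mult_left_mono order.trans[OF TC] energy) simp_all
    finally show ?thesis .
  qed
  have l1: "(d1 \<longlongrightarrow> 0) (at_right 0)" using v(3) unfolding d1_def .
  have l2: "(d2 \<longlongrightarrow> 0) (at_right 0)"
  proof -
    have "((\<lambda>e. \<Sum>i\<in>Basis. \<integral>\<^sup>+ z. ?B z * ?F e i z \<partial>?N) \<longlongrightarrow> (\<Sum>i\<in>(Basis :: (real \<times> (real ^ 'n)) set). 0)) (at_right 0)"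
      by (rule tendsto_sum) (rule v(4))
    moreover have "\<forall>\<^sub>F e in at_right 0. (\<Sum>i\<in>Basis. \<integral>\<^sup>+ z. ?B z * ?F e i z \<partial>?N) = d2 e"
      using eventually_at_right_less[of 0]
    proof eventually_elim
      fix e :: real assume e: "0 < e"
      note [measurable] = grad_measurable[OF v(1)[OF e]]
      have "(\<Sum>i\<in>Basis. \<integral>\<^sup>+ z. ?B z * ?F e i z \<partial>?N)
        = (\<integral>\<^sup>+ z. (\<Sum>i\<in>Basis. ?B z * ?F e i z) \<partial>?N)"
        by (rule nn_integral_sum[symmetric]) measurable
      also have "\<dots> = d2 e"
        unfolding d2_def norm_sq_eq_sum_Basis
        by (intro nn_integral_cong) (simp add: sum_distrib_left[symmetric] sum_ennreal del: inner_diff_left)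
      finally show "(\<Sum>i\<in>Basis. \<integral>\<^sup>+ z. ?B z * ?F e i z \<partial>?N) = d2 e" .
    qed
    ultimately show ?thesis by (simp add: Lim_transform_eventually)
  qed
  have "((\<lambda>e. ennreal (1 + \<beta>) * (ennreal C * (A + q * (d2 e + d1 e))) + ennreal (1 + 1 / \<beta>) * (ennreal m * d1 e))
    \<longlongrightarrow> ennreal (1 + \<beta>) * (ennreal C * (A + q * (0 + 0))) + ennreal (1 + 1 / \<beta>) * (ennreal m * 0)) (at_right 0)"
    by (intro tendsto_add ennreal_tendsto_cmult tendsto_const l1 l2) (auto simp: q_def)
  then have "((\<lambda>e. ennreal (1 + \<beta>) * (ennreal C * (A + q * (d2 e + d1 e))) + ennreal (1 + 1 / \<beta>) * (ennreal m * d1 e))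
    \<longlongrightarrow> ennreal (1 + \<beta>) * (ennreal C * A)) (at_right 0)" by simp
  then show ?thesis
    unfolding A_def[symmetric]
  proof (rule tendsto_lowerbound)
    show "\<forall>\<^sub>F e in at_right 0. ennreal m * (?T (\<lambda>z. \<zeta> z * U z))
      \<le> ennreal (1 + \<beta>) * (ennreal C * (A + q * (d2 e + d1 e))) + ennreal (1 + 1 / \<beta>) * (ennreal m * d1 e)"
      using eventually_at_right_less[of 0] by eventually_elim (rule le)
  qed simp
qed

text \<open>Supported in the ball of radius \<open>k\<close> and normalised to 1 at the origin. It
  is not constant on any ball around 0; pointwise convergence to 1 as \<open>k\<close> grows is what
  dominated convergence uses.\<close>

definition cutoff :: "real \<Rightarrow> 'a::euclidean_space \<Rightarrow> real" where
  "cutoff k z = bump 1 0 ((1 / (2 * k)) *\<^sub>R z) / bump 1 0 (0 :: 'a)"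

lemma bump_center_pos: "0 < bump 1 0 0"
  by (simp add: bump_def flat_pos)

lemma smooth_cutoff: "smooth (cutoff k :: 'a::euclidean_space \<Rightarrow> real)"
proof -
  have "cutoff k = (\<lambda>z :: 'a. bump (1 / (2 * k)) 0 z / bump 1 0 (0 :: 'a))"
    by (simp add: cutoff_def[abs_def] bump_def)
  then show ?thesis by (simp add: smooth_divide_const smooth_bump)
qed

lemma cutoff_eq_0: "0 < k \<Longrightarrow> z \<notin> cball 0 k \<Longrightarrow> cutoff k z = 0"
  using bump_eq_0_iff[of 1 0 "(1 / (2 * k)) *\<^sub>R z"] by (simp add: cutoff_def field_simps)

lemma cutoff_nonneg: "0 \<le> cutoff k z"
  by (simp add: cutoff_def bump_nonneg)

lemma cutoff_le_1: "cutoff k (z :: 'a::euclidean_space) \<le> 1"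
proof -
  have "bump 1 0 x \<le> bump 1 0 (0 :: 'a)" for x :: 'a
    unfolding bump_def by (intro flat_mono) simp
  then show ?thesis using bump_center_pos[where 'a='a] by (simp add: cutoff_def)
qed

lemma cutoff_tendsto_1: "(\<lambda>n. cutoff (real (Suc n)) (z :: 'a::euclidean_space)) \<longlonglongrightarrow> 1"
proof -
  have "(\<lambda>n. (inverse (real (Suc n)) * (1 / 2)) *\<^sub>R z) \<longlonglongrightarrow> (0 * (1 / 2)) *\<^sub>R z"
    by (intro tendsto_intros LIMSEQ_inverse_real_of_nat)
  moreover have eq: "inverse (real (Suc n)) * (1 / 2) = 1 / (2 * real (Suc n))" for n
    by (simp add: field_simps)
  ultimately have "(\<lambda>n. (1 / (2 * real (Suc n))) *\<^sub>R z) \<longlonglongrightarrow> 0"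
    unfolding eq by (simp only: mult_zero_left scaleR_zero_left)
  moreover have "continuous_on UNIV (bump 1 (0 :: 'a))"
    by (intro smooth_imp_continuous_on smooth_bump)
  then have "isCont (bump 1 0) (0 :: 'a)" by (simp add: continuous_on_eq_continuous_at)
  ultimately have "(\<lambda>n. bump 1 0 ((1 / (2 * real (Suc n))) *\<^sub>R z)) \<longlonglongrightarrow> bump 1 0 (0 :: 'a)"
    by (intro isCont_tendsto_compose[where g="bump 1 0"])
  then have "(\<lambda>n. cutoff (real (Suc n)) z) \<longlonglongrightarrow> bump 1 0 (0 :: 'a) / bump 1 0 (0 :: 'a)"
    unfolding cutoff_def using bump_center_pos[where 'a='a] by (intro tendsto_intros) auto
  then show ?thesis using bump_center_pos[where 'a='a] by simp
qed

lemma grad_cutoff_bound: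
  obtains b where "0 < b" "\<And>k (z :: 'a::euclidean_space). 0 < k \<Longrightarrow> norm (grad (cutoff k) z) \<le> b / k"
proof -
  let ?B = "bump 1 0 :: 'a \<Rightarrow> real"
  have out: "?B x = 0" if "x \<notin> cball 0 (1 / 2)" for x
    using bump_eq_0_iff[of 1 "0 :: 'a" x] that by simp
  have g0: "grad ?B x = 0" if "x \<notin> cball 0 (1 / 2)" for x
    using grad_zero_outside[OF closed_cball out that] .
  obtain b where b: "0 < b" "\<And>x. norm (grad ?B x) \<le> b"
    using bounded_compact_support[OF continuous_on_grad[OF smooth_bump] compact_cball g0] by blast
  note B0 = bump_center_pos[where 'a='a]
  have "norm (grad (cutoff k) z) \<le> b / (2 * ?B 0) / k" if "0 < k" for k and z :: 'a
  proof -
    have "((\<lambda>z :: 'a. (1 / (2 * k)) *\<^sub>R z) has_derivative (\<lambda>h. (1 / (2 * k)) *\<^sub>R h)) (at z)"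
      by (auto intro!: derivative_eq_intros)
    from has_derivative_compose[OF this smooth_has_derivative_grad[OF smooth_bump]]
    have "((\<lambda>z. ?B ((1 / (2 * k)) *\<^sub>R z) * (1 / ?B 0)) has_derivative
        (\<lambda>h. (grad ?B ((1 / (2 * k)) *\<^sub>R z) \<bullet> ((1 / (2 * k)) *\<^sub>R h)) * (1 / ?B 0))) (at z)"
      by (rule has_derivative_mult_left)
    moreover have "(\<lambda>h. (grad ?B ((1 / (2 * k)) *\<^sub>R z) \<bullet> ((1 / (2 * k)) *\<^sub>R h)) * (1 / ?B 0))
        = (\<bullet>) ((1 / (2 * k) / ?B 0) *\<^sub>R grad ?B ((1 / (2 * k)) *\<^sub>R z))"
      by (auto simp: fun_eq_iff)
    ultimately have "(cutoff k has_derivative (\<bullet>) ((1 / (2 * k) / ?B 0) *\<^sub>R grad ?B ((1 / (2 * k)) *\<^sub>R z))) (at z)"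
      by (simp add: cutoff_def[abs_def])
    then have "grad (cutoff k) z = (1 / (2 * k) / ?B 0) *\<^sub>R grad ?B ((1 / (2 * k)) *\<^sub>R z)" by (rule grad_eqI)
    then have "norm (grad (cutoff k) z) = (1 / (2 * k) / ?B 0) * norm (grad ?B ((1 / (2 * k)) *\<^sub>R z))"
      using that B0 by simp
    also have "\<dots> \<le> (1 / (2 * k) / ?B 0) * b"
      using that B0 b by (intro mult_left_mono) auto
    also have "\<dots> = b / (2 * ?B 0) / k" by (simp add: mult.commute)
    finally show ?thesis .
  qed
  then show ?thesis using b(1) B0 by (intro that[of "b / (2 * ?B 0)"]) auto
qed

text \<open>The outer limit: the cut-off radius n + 1 tends to infinity and \<open>\<beta> n\<close>
  to 0. The left side converges dominatedly, and the bound \<open>A\<close> is continuous with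
  \<open>A 0\<close> equal to the right side.\<close>

lemma tail_estimate_borel:
  fixes U :: "real \<times> (real ^ 'n) \<Rightarrow> real" and G :: "real \<times> (real ^ 'n) \<Rightarrow> real \<times> (real ^ 'n)"
  assumes \<phi>: "admissible \<phi>" and tc: "tail_coercive (weighted_measure c \<phi> :: (real \<times> (real ^ 'n)) measure) c \<Psi> C"
    and m: "\<And>z :: real \<times> (real ^ 'n). z \<in> half_space \<Longrightarrow> R \<le> norm z \<Longrightarrow> m \<le> \<Psi> (norm z)" "0 \<le> m"
    and [measurable]: "U \<in> borel_measurable borel" "G \<in> borel_measurable borel"
    and U0: "\<And>z. fst z \<le> 0 \<Longrightarrow> U z = 0" and G0: "\<And>z. fst z \<le> 0 \<Longrightarrow> G z = 0"
    and loc: "\<And>a b. 0 < a \<Longrightarrow> integrable lborel (\<lambda>w. indicator (slab a b) w * U w)"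
    and finU: "(\<integral>\<^sup>+ z. ennreal ((U z)\<^sup>2) \<partial>borel_weight c \<phi>) < \<infinity>"
    and finG: "(\<integral>\<^sup>+ z. ennreal ((norm (G z))\<^sup>2) \<partial>borel_weight c \<phi>) < \<infinity>"
    and weak: "weak_identity (test_functions half_space) U G"
  shows "ennreal m * (\<integral>\<^sup>+ z. indicator {z. R < norm z} z * ennreal ((U z)\<^sup>2) \<partial>borel_weight c \<phi>)
    \<le> ennreal C * ((\<integral>\<^sup>+ z. ennreal ((U z)\<^sup>2) \<partial>borel_weight c \<phi>) + (\<integral>\<^sup>+ z. ennreal ((norm (G z))\<^sup>2) \<partial>borel_weight c \<phi>))"
proof -
  let ?N = "borel_weight c \<phi> :: (real \<times> (real ^ 'n)) measure"
  let ?R = "\<lambda>z :: real \<times> (real ^ 'n). indicator {z. R < norm z} z :: ennreal"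
  obtain EU where EU: "(\<integral>\<^sup>+ z. ennreal ((U z)\<^sup>2) \<partial>?N) = ennreal EU"
    using finU by (metis ennreal_cases infinity_ennreal_def less_irrefl)
  obtain EG where EG: "(\<integral>\<^sup>+ z. ennreal ((norm (G z))\<^sup>2) \<partial>?N) = ennreal EG"
    using finG by (metis ennreal_cases infinity_ennreal_def less_irrefl)
  obtain b where b: "0 < b" "\<And>k (z :: real \<times> (real ^ 'n)). 0 < k \<Longrightarrow> norm (grad (cutoff k) z) \<le> b / k"
    using grad_cutoff_bound[where 'a="real \<times> (real ^ 'n)"] by blast
  define \<beta> where "\<beta> n = b / real (Suc n)" for n
  have \<beta>: "0 < \<beta> n" for n using b(1) by (simp add: \<beta>_def)
  have \<beta>_lim: "\<beta> \<longlonglongrightarrow> 0"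
    using tendsto_mult[OF tendsto_const[of b] LIMSEQ_inverse_real_of_nat] by (simp add: \<beta>_def[abs_def] divide_inverse)
  let ?z = "\<lambda>n. cutoff (real (Suc n)) :: real \<times> (real ^ 'n) \<Rightarrow> real"
  have [measurable]: "?z n \<in> borel_measurable (borel :: (real \<times> (real ^ 'n)) measure)" for n
    by (intro smooth_measurable smooth_cutoff)
  define X where "X n = (\<integral>\<^sup>+ z. ?R z * ennreal ((?z n z * U z)\<^sup>2) \<partial>?N)" for n
  have X_lim: "X \<longlonglongrightarrow> (\<integral>\<^sup>+ z. ?R z * ennreal ((U z)\<^sup>2) \<partial>?N)"
    unfolding X_def
  proof (rule nn_integral_dominated_convergence)
    show "(\<integral>\<^sup>+ z. ennreal ((U z)\<^sup>2) \<partial>?N) < \<infinity>" by (rule finU)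
    show "AE z in ?N. ?R z * ennreal ((?z n z * U z)\<^sup>2) \<le> ennreal ((U z)\<^sup>2)" for n
    proof (rule AE_I2)
      fix z :: "real \<times> (real ^ 'n)"
      have "(?z n z)\<^sup>2 \<le> 1" by (simp add: power_le_one cutoff_nonneg cutoff_le_1)
      then have "(?z n z * U z)\<^sup>2 \<le> (U z)\<^sup>2"
        by (simp add: power_mult_distrib mult_left_le_one_le)
      from ennreal_leI[OF this] show "?R z * ennreal ((?z n z * U z)\<^sup>2) \<le> ennreal ((U z)\<^sup>2)"
        by (simp split: split_indicator)
    qed
    show "AE z in ?N. (\<lambda>n. ?R z * ennreal ((?z n z * U z)\<^sup>2)) \<longlonglongrightarrow> ?R z * ennreal ((U z)\<^sup>2)"
    proof (rule AE_I2)
      fix z :: "real \<times> (real ^ 'n)"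
      have "(\<lambda>n. (?z n z * U z)\<^sup>2) \<longlonglongrightarrow> (1 * U z)\<^sup>2"
        by (intro tendsto_intros cutoff_tendsto_1)
      then have "(\<lambda>n. ennreal ((?z n z * U z)\<^sup>2)) \<longlonglongrightarrow> ennreal ((U z)\<^sup>2)"
        by (intro tendsto_ennrealI) simp
      then show "(\<lambda>n. ?R z * ennreal ((?z n z * U z)\<^sup>2)) \<longlonglongrightarrow> ?R z * ennreal ((U z)\<^sup>2)"
        by (intro ennreal_tendsto_cmult) (auto split: split_indicator)
    qed
  qed measurable
  define A where "A x = ennreal (1 + x) * (ennreal C * (ennreal ((1 + x)\<^sup>2) * ennreal EG + ennreal ((1 + x + x\<^sup>2) * (1 + x)) * ennreal EU))" for x :: real
  have le: "ennreal m * X n \<le> A (\<beta> n)" for n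
    unfolding X_def A_def
  proof (rule cutoff_tail_estimate[OF \<phi> tc m _ _ U0 G0 loc EU EG weak _ smooth_cutoff _ cutoff_nonneg cutoff_le_1])
    show "norm (grad (?z n) z) \<le> \<beta> n" for z :: "real \<times> (real ^ 'n)"
      unfolding \<beta>_def by (rule b(2)) simp
    show "?z n z = 0" if "z \<notin> cball 0 (real (Suc n))" for z :: "real \<times> (real ^ 'n)"
      using that by (intro cutoff_eq_0) simp_all
  qed (simp_all add: \<beta>)
  have "(\<lambda>n. A (\<beta> n)) \<longlonglongrightarrow> A 0"
    unfolding A_def
    by (intro tendsto_mult_ennreal tendsto_add tendsto_ennrealI tendsto_intros \<beta>_lim) simp_all
  moreover have "(\<lambda>n. ennreal m * X n) \<longlonglongrightarrow> ennreal m * (\<integral>\<^sup>+ z. ?R z * ennreal ((U z)\<^sup>2) \<partial>?N)"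
    by (intro ennreal_tendsto_cmult X_lim) simp
  ultimately have "ennreal m * (\<integral>\<^sup>+ z. ?R z * ennreal ((U z)\<^sup>2) \<partial>?N) \<le> A 0"
    using le by (intro LIMSEQ_le) auto
  then show ?thesis unfolding A_def EU EG by (simp add: add.commute)
qed

section \<open>Borel representatives and the tail estimate\<close>

lemma slab_subset_half_space: "0 < a \<Longrightarrow> slab a b \<subseteq> (half_space :: (real \<times> (real ^ 'n)) set)"
  by (auto simp: slab_def half_space_def)

text \<open>Local integrability speaks only of compact subsets and says nothing about
  \<open>u\<close> elsewhere; the product with the indicator is a pointwise limit along
  slabs.\<close>

lemma L1_loc_measurable:
  fixes u :: "real \<times> (real ^ 'n) \<Rightarrow> real"
  assumes u: "u \<in> L1_loc half_space"
  shows "(\<lambda>z. indicator half_space z * u z) \<in> borel_measurable lebesgue"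
proof (rule borel_measurable_LIMSEQ_real)
  let ?S = "\<lambda>n. slab (inverse (real (Suc n))) (real n) :: (real \<times> (real ^ 'n)) set"
  show "(\<lambda>z. indicator (?S n) z * u z) \<in> borel_measurable lebesgue" for n
  proof -
    have "?S n \<subseteq> half_space" by (rule slab_subset_half_space) simp
    then have "u absolutely_integrable_on ?S n"
      using u compact_slab unfolding L1_loc_def by blast
    then have "(\<lambda>z. indicator (?S n) z *\<^sub>R u z) \<in> borel_measurable lebesgue"
      unfolding set_integrable_def by (rule borel_measurable_integrable)
    then show ?thesis by simp
  qed
  show "(\<lambda>n. indicator (?S n) z * u z) \<longlonglongrightarrow> indicator half_space z * u z" for z
  proof (cases "z \<in> half_space")
    case True
    then have "0 < fst z" by (simp add: half_space_def)
    obtain N where N: "max (norm z) (inverse (fst z)) < real N" using reals_Archimedean2 by blast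
    show ?thesis
    proof (rule tendsto_eventually, use eventually_ge_at_top[of N] in eventually_elim)
      fix n assume "N \<le> n"
      then have "inverse (fst z) \<le> real (Suc n)" "norm z \<le> real n" using N by auto
      then have "z \<in> ?S n" using \<open>0 < fst z\<close> by (simp add: slab_def field_simps)
      then show "indicator (?S n) z * u z = indicator half_space z * u z" using True by simp
    qed
  next
    case False
    then have "z \<notin> ?S n" for n using slab_subset_half_space[of "inverse (real (Suc n))" "real n"] by auto
    then show ?thesis using False by simp
  qed
qed

text \<open>Lebesgue measurable functions are Borel up to a null set. The value 0 for
  \<open>fst z \<le> 0\<close> makes the representative the zero extension used in the
  averaging.\<close>

lemma L1_loc_borel_representative:
  fixes u :: "real \<times> (real ^ 'n) \<Rightarrow> real"
  assumes u: "u \<in> L1_loc half_space"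
  shows "\<exists>U \<in> borel_measurable borel. (\<forall>z. fst z \<le> 0 \<longrightarrow> U z = 0) \<and> (AE z in lebesgue. z \<in> half_space \<longrightarrow> u z = U z)"
proof -
  obtain V where V: "V \<in> borel_measurable lborel" "AE z in lborel. indicator half_space z * u z = V z"
    using completion_ex_borel_measurable_real[OF L1_loc_measurable[OF u]] by blast
  from V(1) have [measurable]: "V \<in> borel_measurable borel" by simp
  show ?thesis
  proof (intro bexI[of _ "\<lambda>z. indicator half_space z * V z"] conjI allI impI)
    show "(\<lambda>z. indicator half_space z * V z) \<in> borel_measurable borel" by measurable
    show "AE z in lebesgue. z \<in> half_space \<longrightarrow> u z = indicator half_space z * V z"
      using AE_completion[OF V(2)] by eventually_elim auto
  qed (simp add: half_space_def)
qed

lemma L1_loc_inner: "g \<in> L1_loc S \<Longrightarrow> (\<lambda>z. g z \<bullet> i) \<in> L1_loc S"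
proof -
  assume g: "g \<in> L1_loc S"
  have "(\<lambda>z. g z \<bullet> i) absolutely_integrable_on K" if "compact K" "K \<subseteq> S" for K
  proof -
    have "integrable lebesgue (\<lambda>z. indicator K z *\<^sub>R g z)"
      using g that by (simp add: L1_loc_def set_integrable_def)
    then have "integrable lebesgue (\<lambda>z. (indicator K z *\<^sub>R g z) \<bullet> i)" by (rule integrable_inner_left)
    then show ?thesis by (simp add: set_integrable_def)
  qed
  then show ?thesis by (simp add: L1_loc_def)
qed

lemma L1_loc_borel_representative_vector:
  fixes g :: "real \<times> (real ^ 'n) \<Rightarrow> 'b::euclidean_space"
  assumes g: "g \<in> L1_loc half_space"
  shows "\<exists>G \<in> borel_measurable borel. (\<forall>z. fst z \<le> 0 \<longrightarrow> G z = 0) \<and> (AE z in lebesgue. z \<in> half_space \<longrightarrow> g z = G z)"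
proof -
  have "\<forall>i. \<exists>U. U \<in> borel_measurable borel \<and> (\<forall>z. fst z \<le> 0 \<longrightarrow> U z = 0) \<and>
      (AE z in lebesgue. z \<in> half_space \<longrightarrow> g z \<bullet> i = U z)"
    using L1_loc_borel_representative[OF L1_loc_inner[OF g]] by blast
  from choice[OF this] obtain U where "\<forall>i. U i \<in> borel_measurable borel \<and> (\<forall>z. fst z \<le> 0 \<longrightarrow> U i z = 0) \<and>
      (AE z in lebesgue. z \<in> half_space \<longrightarrow> g z \<bullet> i = U i z)" ..
  then have U: "\<And>i. U i \<in> borel_measurable borel" "\<And>i z. fst z \<le> 0 \<Longrightarrow> U i z = 0"
    "\<And>i. AE z in lebesgue. z \<in> half_space \<longrightarrow> g z \<bullet> i = U i z" by blast+
  note [measurable] = U(1)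
  show ?thesis
  proof (intro bexI[of _ "\<lambda>z. \<Sum>i\<in>Basis. U i z *\<^sub>R i"] conjI allI impI)
    show "(\<lambda>z. \<Sum>i\<in>Basis. U i z *\<^sub>R i) \<in> borel_measurable borel" by measurable
    show "(\<Sum>i\<in>Basis. U i z *\<^sub>R i) = 0" if "fst z \<le> 0" for z using U(2)[OF that] by simp
    have "AE z in lebesgue. \<forall>i\<in>Basis. z \<in> half_space \<longrightarrow> g z \<bullet> i = U i z"
      by (rule AE_finite_allI) (auto intro: U(3))
    then show "AE z in lebesgue. z \<in> half_space \<longrightarrow> g z = (\<Sum>i\<in>Basis. U i z *\<^sub>R i)"
    proof eventually_elim
      fix z assume z: "\<forall>i\<in>Basis. z \<in> half_space \<longrightarrow> g z \<bullet> i = U i z"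
      show "z \<in> half_space \<longrightarrow> g z = (\<Sum>i\<in>Basis. U i z *\<^sub>R i)"
      proof
        assume "z \<in> half_space"
        then have "(\<Sum>i\<in>Basis. U i z *\<^sub>R i) = (\<Sum>i\<in>Basis. (g z \<bullet> i) *\<^sub>R i)" using z by (intro sum.cong) auto
        then show "g z = (\<Sum>i\<in>Basis. U i z *\<^sub>R i)" by (simp add: euclidean_representation)
      qed
    qed
  qed
qed

lemma AE_weighted_measure:
  fixes P :: "real \<times> (real ^ 'n) \<Rightarrow> bool"
  assumes \<phi>: "admissible \<phi>" and P: "AE z in lebesgue. z \<in> half_space \<longrightarrow> P z"
  shows "AE z in weighted_measure c \<phi>. P z"
proof -
  have "AE z in lebesgue_on half_space. P z"
    using P by (subst AE_restrict_space_iff) auto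
  then show ?thesis unfolding weighted_measure_def
    by (subst AE_density[OF lebesgue_on_half_space_weight_measurable[OF \<phi>]]) auto
qed

lemma L2_norm_sq_borel_weight:
  fixes f F :: "real \<times> (real ^ 'n) \<Rightarrow> 'b::euclidean_space"
  assumes \<phi>: "admissible \<phi>" and [measurable]: "F \<in> borel_measurable borel"
    and ae: "AE z in lebesgue. z \<in> half_space \<longrightarrow> f z = F z"
  shows "L2_norm_sq (weighted_measure c \<phi>) f = (\<integral>\<^sup>+ z. ennreal ((norm (F z))\<^sup>2) \<partial>borel_weight c \<phi>)"
proof -
  have "L2_norm_sq (weighted_measure c \<phi>) f = (\<integral>\<^sup>+ z. ennreal ((norm (F z))\<^sup>2) \<partial>weighted_measure c \<phi>)"
    unfolding L2_norm_sq_def using AE_weighted_measure[OF \<phi> ae, of c]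
    by (intro nn_integral_cong_AE) (auto elim!: eventually_mono)
  also have "\<dots> = (\<integral>\<^sup>+ z. ennreal ((norm (F z))\<^sup>2) \<partial>borel_weight c \<phi>)"
    by (rule nn_integral_weighted_measure[OF \<phi>]) measurable
  finally show ?thesis .
qed

text \<open>Turns the integrals in the definition of the weak gradient into those of
  \<open>weak_identity\<close>: the zero extension absorbs the restriction to the
  half-space.\<close>

lemma set_integral_half_space_eq:
  fixes f F h :: "real \<times> (real ^ 'n) \<Rightarrow> real"
  assumes f: "f \<in> L1_loc half_space" and F: "F \<in> borel_measurable borel" "\<And>z. fst z \<le> 0 \<Longrightarrow> F z = 0"
    and ae: "AE z in lebesgue. z \<in> half_space \<longrightarrow> f z = F z" and h: "h \<in> borel_measurable borel"
  shows "(LINT z:half_space|lebesgue. f z * h z) = (\<integral>z. F z * h z \<partial>lborel)"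
proof -
  have "(LINT z:half_space|lebesgue. f z * h z) = (\<integral>z. (indicator half_space z * f z) * h z \<partial>lebesgue)"
    by (simp add: set_lebesgue_integral_def mult.assoc)
  also have "\<dots> = (\<integral>z. F z * h z \<partial>lebesgue)"
  proof (rule integral_cong_AE)
    have hl: "h \<in> borel_measurable lebesgue" and Fl: "F \<in> borel_measurable lebesgue"
      using h F(1) by (auto intro: measurable_completion)
    show "(\<lambda>z. (indicator half_space z * f z) * h z) \<in> borel_measurable lebesgue"
      by (intro borel_measurable_times L1_loc_measurable f hl)
    show "(\<lambda>z. F z * h z) \<in> borel_measurable lebesgue"
      by (intro borel_measurable_times hl Fl)
    show "AE z in lebesgue. (indicator half_space z * f z) * h z = F z * h z"
      using ae by eventually_elim (use F(2) in \<open>auto simp: half_space_def not_less split: split_indicator\<close>)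
  qed
  also have "\<dots> = (\<integral>z. F z * h z \<partial>lborel)"
    using F(1) h by (intro integral_completion) simp
  finally show ?thesis .
qed

theorem lemma4p2:
  fixes c C_TC R m_R :: real
    and \<phi> \<Psi> :: "real \<Rightarrow> real"
    and \<mu> :: "(real \<times> (real ^ 'n)) measure"
    and u :: "real \<times> (real ^ 'n) \<Rightarrow> real"
  assumes "admissible \<phi>"
    and "\<mu> = weighted_measure c \<phi>"
    and "0 < C_TC"
    and "tail_coercive \<mu> c \<Psi> C_TC"
    and "m_R = (INF z\<in>{z \<in> (half_space :: (real \<times> (real ^ 'n)) set). R \<le> norm z}. \<Psi> (norm z))"
    and "0 < m_R"
    and "u \<in> H1_space \<mu>"
  shows "(\<integral>\<^sup>+ z\<in>{z \<in> half_space. R < norm z}. ennreal (\<bar>u z\<bar>\<^sup>2) \<partial>\<mu>)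
           \<le> ennreal (C_TC / m_R) * H1_norm_sq \<mu> u"
proof -
  note \<phi> = assms(1) and \<mu> = assms(2) and C = assms(3) and m_R = assms(5,6)
  define g where "g = weak_gradient u"
  have u: "u \<in> L1_loc half_space" "L2_norm_sq \<mu> u < \<infinity>" and g: "L2_norm_sq \<mu> g < \<infinity>"
    and ex: "\<exists>g. has_weak_gradient u g"
    using assms(7) by (auto simp: H1_space_def L2_space_def g_def)
  from ex have wg: "has_weak_gradient u g" unfolding g_def weak_gradient_def by (rule someI_ex)
  then have gL: "g \<in> L1_loc half_space" by (simp add: has_weak_gradient_def)
  obtain U where U [measurable]: "U \<in> borel_measurable borel" and U0: "\<And>z. fst z \<le> 0 \<Longrightarrow> U z = 0"
    and uU: "AE z in lebesgue. z \<in> half_space \<longrightarrow> u z = U z"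
    using L1_loc_borel_representative[OF u(1)] by blast
  obtain G where G [measurable]: "G \<in> borel_measurable borel" and G0: "\<And>z. fst z \<le> 0 \<Longrightarrow> G z = 0"
    and gG: "AE z in lebesgue. z \<in> half_space \<longrightarrow> g z = G z"
    using L1_loc_borel_representative_vector[OF gL] by blast
  have EU: "L2_norm_sq \<mu> u = (\<integral>\<^sup>+ z. ennreal ((U z)\<^sup>2) \<partial>borel_weight c \<phi>)"
    unfolding \<mu> L2_norm_sq_borel_weight[OF \<phi> U uU] by simp
  have EG: "L2_norm_sq \<mu> g = (\<integral>\<^sup>+ z. ennreal ((norm (G z))\<^sup>2) \<partial>borel_weight c \<phi>)"
    unfolding \<mu> L2_norm_sq_borel_weight[OF \<phi> G gG] ..
  let ?X = "\<integral>\<^sup>+ z. indicator {z. R < norm z} z * ennreal ((U z)\<^sup>2) \<partial>borel_weight c \<phi>"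
  have tail: "(\<integral>\<^sup>+ z\<in>{z \<in> half_space. R < norm z}. ennreal (\<bar>u z\<bar>\<^sup>2) \<partial>\<mu>)
      = ?X"
  proof -
    have "(\<integral>\<^sup>+ z\<in>{z \<in> half_space. R < norm z}. ennreal (\<bar>u z\<bar>\<^sup>2) \<partial>\<mu>)
      = (\<integral>\<^sup>+ z. indicator {z. R < norm z} z * ennreal ((U z)\<^sup>2) \<partial>\<mu>)"
    proof (rule nn_integral_cong_AE)
      have "AE z in \<mu>. u z = U z" unfolding \<mu> by (rule AE_weighted_measure[OF \<phi> uU])
      moreover have "AE z in \<mu>. z \<in> half_space"
        unfolding \<mu> by (rule AE_weighted_measure[OF \<phi>]) simp
      ultimately show "AE z in \<mu>. ennreal (\<bar>u z\<bar>\<^sup>2) * indicator {z \<in> half_space. R < norm z} z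
          = indicator {z. R < norm z} z * ennreal ((U z)\<^sup>2)"
        by eventually_elim (auto split: split_indicator)
    qed
    also have "\<dots> = ?X"
      unfolding \<mu> by (rule nn_integral_weighted_measure[OF \<phi>]) measurable
    finally show ?thesis .
  qed
  have loc: "integrable lborel (\<lambda>w. indicator (slab a b) w * U w)" if "0 < a" for a b
  proof -
    have "u absolutely_integrable_on slab a b"
      using u(1) compact_slab slab_subset_half_space[OF that] unfolding L1_loc_def by blast
    then have i: "integrable lebesgue (\<lambda>z. indicator (slab a b) z *\<^sub>R u z)" by (simp add: set_integrable_def)
    have m: "(\<lambda>w. indicator (slab a b) w * U w) \<in> borel_measurable borel" by measurable
    have "AE z in lebesgue. indicator (slab a b) z *\<^sub>R u z = indicator (slab a b) z * U z"
      using uU by eventually_elim (use slab_subset_half_space[OF that, of b] in \<open>auto split: split_indicator\<close>)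
    with i m have "integrable lebesgue (\<lambda>w. indicator (slab a b) w * U w)"
      by (subst integrable_cong_AE[where g="\<lambda>z. indicator (slab a b) z *\<^sub>R u z"])
        (auto intro: measurable_completion borel_measurable_integrable)
    then show ?thesis using m by (simp add: integrable_completion)
  qed
  have weak: "weak_identity (test_functions half_space) U G"
    unfolding weak_identity_def
  proof (intro ballI)
    fix \<eta> :: "real \<times> (real ^ 'n) \<Rightarrow> real" and i :: "real \<times> (real ^ 'n)"
    assume \<eta>: "\<eta> \<in> test_functions half_space" and i: "i \<in> Basis"
    then have sm: "smooth \<eta>" and "\<eta> \<in> Cc_infty half_space"
      by (auto simp: test_functions_def Cc_infty_def)
    with wg i have "(LINT z:half_space|lebesgue. u z * frechet_derivative \<eta> (at z) i) =
        - (LINT z:half_space|lebesgue. (g z \<bullet> i) * \<eta> z)"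
      unfolding has_weak_gradient_def by blast
    moreover have "(LINT z:half_space|lebesgue. u z * frechet_derivative \<eta> (at z) i) = (\<integral>w. U w * (grad \<eta> w \<bullet> i) \<partial>lborel)"
      unfolding frechet_derivative_smooth[OF sm]
      using grad_measurable[OF sm]
      by (intro set_integral_half_space_eq u(1) U U0 uU) (auto intro!: borel_measurable_inner)
    moreover have "(LINT z:half_space|lebesgue. (g z \<bullet> i) * \<eta> z) = (\<integral>w. (G w \<bullet> i) * \<eta> w \<partial>lborel)"
    proof (rule set_integral_half_space_eq)
      show "(\<lambda>z. g z \<bullet> i) \<in> L1_loc half_space" by (rule L1_loc_inner[OF gL])
      show "AE z in lebesgue. z \<in> half_space \<longrightarrow> g z \<bullet> i = G z \<bullet> i" using gG by eventually_elim simp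
      show "\<eta> \<in> borel_measurable borel" by (rule smooth_measurable[OF sm])
    qed (auto simp: G0)
    ultimately show "(\<integral>w. U w * (grad \<eta> w \<bullet> i) \<partial>lborel) = - (\<integral>w. (G w \<bullet> i) * \<eta> w \<partial>lborel)" by simp
  qed
  have m: "m_R \<le> \<Psi> (norm z)" if "z \<in> half_space" "R \<le> norm z" for z :: "real \<times> (real ^ 'n)"
    unfolding m_R(1)
  proof (rule cINF_lower)
    \<comment> \<open>An infimum of reals is a lower bound only for sets bounded below;
      nonnegativity of \<open>\<Psi>\<close> provides that.\<close>
    show "bdd_below ((\<lambda>z. \<Psi> (norm z)) ` {z \<in> (half_space :: (real \<times> (real ^ 'n)) set). R \<le> norm z})"
      using assms(4) by (intro bdd_belowI[of _ 0]) (auto simp: tail_coercive_def)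
  qed (use that in simp)
  have tc: "tail_coercive (weighted_measure c \<phi> :: (real \<times> (real ^ 'n)) measure) c \<Psi> C_TC"
    using assms(4) unfolding \<mu> .
  note finU = u(2)[unfolded EU] and finG = g[unfolded EG]
  have "ennreal m_R * ?X
    \<le> ennreal C_TC * H1_norm_sq \<mu> u"
    unfolding H1_norm_sq_def g_def[symmetric] EU EG
    by (rule tail_estimate_borel[OF \<phi> tc m less_imp_le[OF m_R(2)] U G U0 G0 loc finU finG weak])
  \<comment> \<open>Division by \<open>m_R\<close> is done as multiplication by its inverse, which
    cancels since \<open>m_R\<close> is positive and finite, even if the tail integral were
    infinite.\<close>
  then have "ennreal (1 / m_R) * (ennreal m_R * ?X)
    \<le> ennreal (1 / m_R) * (ennreal C_TC * H1_norm_sq \<mu> u)"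
    by (rule mult_left_mono) simp
  moreover have "ennreal (1 / m_R) * ennreal m_R = 1" "ennreal (1 / m_R) * ennreal C_TC = ennreal (C_TC / m_R)"
    using m_R(2) C by (simp_all add: ennreal_mult[symmetric])
  ultimately show ?thesis unfolding tail by (simp add: mult.assoc[symmetric])
qed

end
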